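(* For each $m\ge1$, let $c_{3,m}$ be the number of move-equivalence classes of $(3,m)$-amplitrees. Then $$\sum_{m\ge0}c_{3,m+1}x^m=\frac{1+28x+56x^2+14x^3}{(1-x)^7}.$$
   Context: A plabic tree is a plabic graph (planar graph in a disk, black/white internal vertices, boundary vertices $1,\dots,n$ labeled clockwise each incident to one edge, leafless) whose underlying graph is a tree; bipartite with boundary vertices $B_{bd}$ regarded as black and internal black vertices $B_{int}$; its type is $(k,n)$ with $k=1+\sum_{b\in B_{int}}(\deg b-2)$. A $(k,m)$-amplitree is a bipartite plabic tree of type $(k,km+1)$ which is $m$-balanced: for each edge $e$, writing $G\setminus\{e\}=G_1\sqcup G_2$ (each component receiving half of $e$), one has $1\le|B_{bd}\cap G_i|-m\sum_{b\in G_i\cap B_{int}}(\deg b-2)\le m$ for $i=1,2$ (degrees in $G$). Move-equivalence: generated by the plabic graph moves (square move; contracting/expanding adjacent internal vertices of the same color; inserting/removing degree-2 internal vertices). *)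

theory Defs
  imports
    "Graph_Theory.Graph_Theory"
    "HOL-Combinatorics.Orbits"
    "HOL-Computational_Algebra.Formal_Power_Series"
begin

text \<open>
  A plabic graph, drawn in a disk, is represented by a combinatorial map. Each undirected edge of
  the underlying multigraph is a pair of opposite arcs, exchanged by \<open>rev_arc\<close>; \<open>rot\<close> sends an
  arc \<open>a\<close> to the next arc, in clockwise order, among the arcs leaving the tail of \<open>a\<close>.
  The boundary vertex with label \<open>i \<in> {1..n}\<close> is \<open>bdry ! (i - 1)\<close>. The set \<open>black\<close> consists of the
  black internal vertices; the remaining internal vertices are white.
\<close>

record plabic =
  ugraph :: "(nat, nat) pre_digraph"
  rev_arc :: "nat \<Rightarrow> nat"
  rot :: "nat \<Rightarrow> nat"
  black :: "nat set"
  bdry :: "nat list"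

definition internal :: "plabic \<Rightarrow> nat set" where
  "internal G = verts (ugraph G) - set (bdry G)"

text \<open>In the bidirected graph, the degree of a vertex is its number of outgoing arcs.\<close>

definition deg :: "plabic \<Rightarrow> nat \<Rightarrow> nat" where
  "deg G v = out_degree (ugraph G) v"

text \<open>
  Traverse \<open>a\<close>, then take the arc following clockwise the one that leads back. Since \<open>rot\<close> is
  clockwise, this is the sharpest possible left turn, so the orbits are the faces, each traversed
  with the face on the left.
\<close>

definition face_succ :: "plabic \<Rightarrow> nat \<Rightarrow> nat" where
  "face_succ G a = rot G (rev_arc G a)"

definition faces :: "plabic \<Rightarrow> nat set set" where
  "faces G = orbit (face_succ G) ` arcs (ugraph G)"

definition planar_map :: "plabic \<Rightarrow> bool" where
  "planar_map G \<longleftrightarrow>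
     fin_digraph (ugraph G) \<and> bidirected_digraph (ugraph G) (rev_arc G) \<and>
     Digraph_Component.connected (ugraph G) \<and>
     rot G permutes arcs (ugraph G) \<and>
     (\<forall>v\<in>verts (ugraph G). cyclic_on (rot G) (out_arcs (ugraph G) v)) \<and>
     card (verts (ugraph G)) + card (faces G) = card (arcs (ugraph G)) div 2 + 2"

text \<open>
  The boundary vertices lie on the boundary of a disk in clockwise order: walking, as above, along
  the outer face from one boundary vertex, the next boundary vertex met is the cyclically next one.
\<close>

definition boundary_clockwise :: "plabic \<Rightarrow> bool" where
  "boundary_clockwise G \<longleftrightarrow>
     (\<forall>i<length (bdry G). \<exists>a\<in>out_arcs (ugraph G) (bdry G ! i). \<exists>k>0.
        tail (ugraph G) ((face_succ G ^^ k) a) = bdry G ! (Suc i mod length (bdry G)) \<and>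
        (\<forall>j. 0 < j \<and> j < k \<longrightarrow> tail (ugraph G) ((face_succ G ^^ j) a) \<notin> set (bdry G)))"

text \<open>
  Only connected plabic graphs are considered. This is harmless for plabic trees, since all moves
  below and their inverses preserve connectedness.
\<close>

definition plabic_graph :: "plabic \<Rightarrow> bool" where
  "plabic_graph G \<longleftrightarrow>
     planar_map G \<and>
     distinct (bdry G) \<and> set (bdry G) \<subseteq> verts (ugraph G) \<and>
     (\<forall>v\<in>set (bdry G). deg G v = 1) \<and>
     boundary_clockwise G \<and>
     (\<forall>v\<in>internal G. deg G v \<noteq> 1) \<and>
     black G \<subseteq> internal G"

text \<open>
  The notion \<^const>\<open>tree\<close> of the library does not apply to bidirected graphs, because there an arc
  followed by its reverse counts as a cycle.
\<close>

definition plabic_tree :: "plabic \<Rightarrow> bool" where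
  "plabic_tree G \<longleftrightarrow> plabic_graph G \<and>
     \<not> (\<exists>p. pre_digraph.cycle (ugraph G) p \<and> (\<forall>a\<in>set p. rev_arc G a \<notin> set p))"

definition bipartite :: "plabic \<Rightarrow> bool" where
  "bipartite G \<longleftrightarrow>
     (\<forall>a\<in>arcs (ugraph G).
        (tail (ugraph G) a \<in> black G \<union> set (bdry G)) \<noteq>
        (head (ugraph G) a \<in> black G \<union> set (bdry G)))"

definition has_type :: "plabic \<Rightarrow> nat \<Rightarrow> nat \<Rightarrow> bool" where
  "has_type G k n \<longleftrightarrow>
     int k = 1 + (\<Sum>b\<in>black G. int (deg G b) - 2) \<and> n = length (bdry G)"

text \<open>
  The vertex set of the component of \<open>G \ {e}\<close> that contains the tail of \<open>a\<close>, where \<open>e\<close> is the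
  edge consisting of the arc \<open>a\<close> and its reverse. The other component is the side of the reverse.
\<close>

definition side :: "plabic \<Rightarrow> nat \<Rightarrow> nat set" where
  "side G a =
     {v. reachable (pre_digraph.del_arc (pre_digraph.del_arc (ugraph G) a) (rev_arc G a))
           (tail (ugraph G) a) v}"

definition balanced :: "nat \<Rightarrow> plabic \<Rightarrow> bool" where
  "balanced m G \<longleftrightarrow>
     (\<forall>a\<in>arcs (ugraph G).
        let s = int (card (set (bdry G) \<inter> side G a))
                - int m * (\<Sum>b\<in>side G a \<inter> black G. int (deg G b) - 2)
        in 1 \<le> s \<and> s \<le> int m)"

definition amplitree :: "nat \<Rightarrow> nat \<Rightarrow> plabic \<Rightarrow> bool" where
  "amplitree k m G \<longleftrightarrow>
     plabic_tree G \<and> bipartite G \<and> has_type G k (k * m + 1) \<and> balanced m G"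

text \<open>Equality up to an orientation-preserving homeomorphism fixing the boundary labels.\<close>

definition plabic_iso :: "plabic \<Rightarrow> plabic \<Rightarrow> bool" where
  "plabic_iso G H \<longleftrightarrow> (\<exists>f g.
     bij_betw f (verts (ugraph G)) (verts (ugraph H)) \<and>
     bij_betw g (arcs (ugraph G)) (arcs (ugraph H)) \<and>
     (\<forall>a\<in>arcs (ugraph G).
        tail (ugraph H) (g a) = f (tail (ugraph G) a) \<and>
        head (ugraph H) (g a) = f (head (ugraph G) a) \<and>
        rev_arc H (g a) = g (rev_arc G a) \<and>
        rot H (g a) = g (rot G a)) \<and>
     black H = f ` black G \<and>
     bdry H = map f (bdry G))"

text \<open>
  Contracting the edge of \<open>a\<close>: the head \<open>v\<close> of \<open>a\<close> is merged into its tail \<open>u\<close>, and the arcs that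
  follow the reverse of \<open>a\<close> clockwise around \<open>v\<close> take the place of \<open>a\<close> around \<open>u\<close>.
\<close>

definition contract :: "plabic \<Rightarrow> nat \<Rightarrow> plabic" where
  "contract G a =
     (let g = ugraph G; a' = rev_arc G a; u = tail g a; v = head g a in
      \<lparr>ugraph = \<lparr>verts = verts g - {v}, arcs = arcs g - {a, a'},
                 tail = (\<lambda>e. if tail g e = v then u else tail g e),
                 head = (\<lambda>e. if head g e = v then u else head g e)\<rparr>,
       rev_arc = (\<lambda>e. if e \<in> {a, a'} then e else rev_arc G e),
       rot = (\<lambda>e. if e \<in> {a, a'} then e
                  else if rot G e = a then rot G a'
                  else if rot G e = a' then rot G a
                  else rot G e),
       black = black G - {v},
       bdry = bdry G\<rparr>)"

definition contraction_move :: "plabic \<Rightarrow> plabic \<Rightarrow> bool" where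
  "contraction_move G H \<longleftrightarrow>
     (\<exists>a\<in>arcs (ugraph G). let u = tail (ugraph G) a; v = head (ugraph G) a in
        u \<noteq> v \<and> u \<in> internal G \<and> v \<in> internal G \<and> (u \<in> black G \<longleftrightarrow> v \<in> black G) \<and>
        H = contract G a)"

text \<open>
  Removing the vertex \<open>v\<close> whose outgoing arcs are \<open>a\<close> and \<open>b\<close>: the reverses of \<open>a\<close> and \<open>b\<close> become
  the two arcs of a single edge.
\<close>

definition remove_deg2 :: "plabic \<Rightarrow> nat \<Rightarrow> nat \<Rightarrow> nat \<Rightarrow> plabic" where
  "remove_deg2 G v a b =
     (let g = ugraph G; a' = rev_arc G a; b' = rev_arc G b in
      \<lparr>ugraph = \<lparr>verts = verts g - {v}, arcs = arcs g - {a, b}, tail = tail g,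
                 head = (head g)(a' := head g b, b' := head g a)\<rparr>,
       rev_arc = (rev_arc G)(a := a, b := b, a' := b', b' := a'),
       rot = (rot G)(a := a, b := b),
       black = black G - {v},
       bdry = bdry G\<rparr>)"

definition removal_move :: "plabic \<Rightarrow> plabic \<Rightarrow> bool" where
  "removal_move G H \<longleftrightarrow>
     (\<exists>v\<in>internal G. \<exists>a b. a \<noteq> b \<and> rev_arc G a \<noteq> b \<and>
        out_arcs (ugraph G) v = {a, b} \<and> H = remove_deg2 G v a b)"

text \<open>
  The square move exchanges the colours of the four trivalent vertices, of alternating colours,
  around a quadrilateral face.
\<close>

definition square_move :: "plabic \<Rightarrow> plabic \<Rightarrow> bool" where
  "square_move G H \<longleftrightarrow>
     (\<exists>a\<in>arcs (ugraph G). let w = (\<lambda>i. tail (ugraph G) ((face_succ G ^^ i) a)) in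
        (face_succ G ^^ 4) a = a \<and> inj_on w {..<4} \<and>
        (\<forall>i<4. w i \<in> internal G \<and> deg G (w i) = 3 \<and>
               (w i \<in> black G \<longleftrightarrow> w (Suc i) \<notin> black G)) \<and>
        H = G\<lparr>black := (black G - w ` {..<4}) \<union> (w ` {..<4} - black G)\<rparr>)"

definition plabic_step :: "plabic \<Rightarrow> plabic \<Rightarrow> bool" where
  "plabic_step G H \<longleftrightarrow> plabic_graph G \<and> plabic_graph H \<and>
     (plabic_iso G H \<or> contraction_move G H \<or> removal_move G H \<or> square_move G H)"

text \<open>The symmetric closure adds the expansions and the insertions of vertices of degree 2.\<close>

definition move_equivalent :: "plabic \<Rightarrow> plabic \<Rightarrow> bool" where
  "move_equivalent = equivclp plabic_step"

definition amplitree_classes :: "nat \<Rightarrow> nat \<Rightarrow> plabic set set" where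
  "amplitree_classes k m =
     {G. amplitree k m G} //
     {(G, H). amplitree k m G \<and> amplitree k m H \<and> move_equivalent G H}"

definition num_amplitree_classes :: "nat \<Rightarrow> nat \<Rightarrow> nat" where
  "num_amplitree_classes k m = card (amplitree_classes k m)"

end

(*
  Rooting a plabic tree at boundary vertex 1 turns it into a plane tree with coloured nodes, whose
  contour is the unique face, and this plane tree determines the plabic tree up to isomorphism.
  Contracting an edge merges a node with a child of the same colour, removing a vertex of degree 2
  erases a node with a single child, and square moves never apply, because they need a bounded face.
  Hence the normal form obtained by merging and erasing as long as possible is a complete invariant
  of move-equivalence. Among connected graphs, trees are characterised by the relation V = E + 1,
  which is visibly preserved by the moves in both directions.

  Leaves and the numbers deg b - 2 are counted additively in a plane tree, so the conditions on an
  amplitree say that every subtree s satisfies 1 <= leaves s - m * excess s <= m, and this passes to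
  the normal form. For k = 3 the normal forms have excess 2: one black node of degree 4, or two of
  degree 3 joined by a white node. Counting the admissible branch sizes gives a polynomial in m.
*)

theory Submission
  imports Defs "HOL-Library.Nat_Bijection"
begin

text \<open>A step relates only graphs that are themselves plabic. For invariance this helps: both
  ends of a move are known to be planar with clockwise boundary, and only the count of vertices and
  edges has to be carried over. That is why trees are recognised by counting rather than by
  acyclicity. For completeness it is the main burden: every graph on the way to the normal form must
  be shown planar with its boundary in clockwise order. Both properties are read off from the
  contour, kept as a list of all arcs in face order. One face turns Euler's formula into the count,
  and the clockwise condition becomes an equation between \<open>bdry G\<close> and the boundary
  tails along that list. A reducing move merely drops two arcs from it. Normal forms need not be
  bipartite; each is attained by an amplitree because nodes of degree 2 can be inserted until the
  colours alternate. With m = n + 1 the count for k = 3 is a polynomial in n of degree 6, and 1, 28,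
  56, 14 are its coordinates with respect to the binomials
  \<open>(n + 6 - j) choose 6\<close>.\<close>

abbreviation Ar :: "plabic \<Rightarrow> nat set" where "Ar G \<equiv> arcs (ugraph G)"
abbreviation Vs :: "plabic \<Rightarrow> nat set" where "Vs G \<equiv> verts (ugraph G)"
abbreviation src :: "plabic \<Rightarrow> nat \<Rightarrow> nat" where "src G \<equiv> tail (ugraph G)"
abbreviation tgt :: "plabic \<Rightarrow> nat \<Rightarrow> nat" where "tgt G \<equiv> head (ugraph G)"
abbreviation outs :: "plabic \<Rightarrow> nat \<Rightarrow> nat set" where "outs G \<equiv> out_arcs (ugraph G)"

section \<open>Cyclic permutations as lists\<close>

text \<open>The equation \<open>map f (y # cs) = cs @ [y]\<close> is the list form of a cycle of
  \<open>f\<close>: each entry goes to the next and the last one back to \<open>y\<close>. Rotations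
  around a vertex and face walks are both handled in this form, in which cycles can be cut and
  spliced.\<close>

lemma funpow_chain:
  assumes "map f (y # cs) = cs @ [y]" "i \<le> length cs"
  shows "(f ^^ i) y = (y # cs) ! i"
  using assms(2)
proof (induction i)
  case (Suc i)
  then have "f ((y # cs) ! i) = (cs @ [y]) ! i"
    by (metis assms(1) le_imp_less_Suc less_or_eq_imp_le Suc_le_lessD nth_map length_Cons)
  with Suc show ?case by (simp add: nth_append)
qed simp

lemma funpow_cycle:
  assumes "map f (y # cs) = cs @ [y]"
  shows "(f ^^ Suc (length cs)) y = y"
proof -
  have "f ((y # cs) ! length cs) = (cs @ [y]) ! length cs"
    by (metis assms lessI nth_map length_Cons)
  then show ?thesis using funpow_chain[OF assms, of "length cs"] by simp
qed

lemma cyclic_on_list: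
  assumes "map f (y # cs) = cs @ [y]"
  shows "cyclic_on f (set (y # cs))"
proof -
  have "orbit f y = {(f ^^ i) y | i. i < Suc (length cs)}"
    by (rule orbit_altdef_bounded[OF funpow_cycle[OF assms]]) simp
  also have "\<dots> = {(y # cs) ! i | i. i < Suc (length cs)}"
    using funpow_chain[OF assms] by (metis less_Suc_eq_le)
  also have "\<dots> = set (y # cs)" by (simp only: set_conv_nth length_Cons)
  finally show ?thesis unfolding cyclic_on_def by auto
qed

lemma cyclic_on_ex_list:
  assumes "cyclic_on f S" "y \<in> S"
  obtains cs where "distinct (y # cs)" "set (y # cs) = S" "map f (y # cs) = cs @ [y]"
proof -
  have orb: "orbit f y = S" by (rule orbit_cyclic_eq3[OF assms])
  then have self: "y \<in> orbit f y" using assms by simp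
  define n where "n = funpow_dist1 f y y"
  have n: "0 < n" "(f ^^ n) y = y" unfolding n_def using funpow_dist1_prop[OF self] by auto
  define cs where "cs = map (\<lambda>i. (f ^^ i) y) [1..<n]"
  have ycs: "y # cs = map (\<lambda>i. (f ^^ i) y) [0..<n]"
    using n(1) unfolding cs_def by (simp add: upt_conv_Cons)
  have "inj_on (\<lambda>i. (f ^^ i) y) {0..<n}"
    unfolding n_def by (rule inj_on_funpow_dist1[OF self])
  then have "distinct (y # cs)" unfolding ycs by (simp add: distinct_map)
  moreover have "set (y # cs) = S"
    unfolding ycs orb[symmetric] orbit_altdef_bounded[OF n(2,1)] by auto
  moreover have "map f (y # cs) = cs @ [y]"
  proof -
    have "map f (y # cs) = map (\<lambda>i. (f ^^ i) y) (map Suc [0..<n])" unfolding ycs by simp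
    also have "map Suc [0..<n] = [1..<n] @ [n]" using n(1) by (simp add: map_Suc_upt)
    finally show ?thesis unfolding cs_def using n(2) by simp
  qed
  ultimately show ?thesis by (rule that)
qed

text \<open>The entries are the iterates of \<open>f\<close> on the common starting point, so only
  the lengths could differ, and these are the size of the orbit.\<close>

lemma map_cycle_unique:
  assumes "map f (y # cs) = cs @ [y]" "map f (y # ds) = ds @ [y]"
    "distinct (y # cs)" "distinct (y # ds)"
  shows "cs = ds"
proof -
  have set_eq: "set (y # cs) = set (y # ds)"
    using cyclic_on_list[OF assms(1)] cyclic_on_list[OF assms(2)]
    by (metis list.set_intros(1) orbit_cyclic_eq3)
  then have len: "length cs = length ds"
    using assms(3,4) distinct_card by (metis length_Cons nat.inject)
  have "y # cs = y # ds"
    by (rule nth_equalityI) (use len funpow_chain[OF assms(1)] funpow_chain[OF assms(2)] in auto)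
  then show ?thesis by simp
qed

section \<open>Plabic graphs as rotation systems\<close>

text \<open>All of \<open>plabic_graph\<close> except Euler's formula and the distinctness and
  clockwise order of the boundary. A newly built graph is placed in this locale early, and
  \<open>boundary_clockwise_iff\<close> then settles its boundary.\<close>

locale plabic_map =
  fixes G :: plabic
  assumes fin: "fin_digraph (ugraph G)"
    and bid: "bidirected_digraph (ugraph G) (rev_arc G)"
    and conn: "Digraph_Component.connected (ugraph G)"
    and rot_permutes: "rot G permutes Ar G"
    and rot_cyclic: "\<And>v. v \<in> Vs G \<Longrightarrow> cyclic_on (rot G) (outs G v)"
    and bdry_sub: "set (bdry G) \<subseteq> Vs G"
    and bdry_deg: "\<And>v. v \<in> set (bdry G) \<Longrightarrow> deg G v = 1"
    and internal_deg: "\<And>v. v \<in> internal G \<Longrightarrow> deg G v \<noteq> 1"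
    and black_sub: "black G \<subseteq> internal G"
begin

sublocale fin_digraph "ugraph G" by (rule fin)
sublocale bidirected_digraph "ugraph G" "rev_arc G" by (rule bid)

lemma rot_in: "e \<in> Ar G \<Longrightarrow> rot G e \<in> Ar G"
  using rot_permutes by (simp add: permutes_in_image)

lemma src_rot: "e \<in> Ar G \<Longrightarrow> src G (rot G e) = src G e"
  using cyclic_on_inI[OF rot_cyclic, of "src G e" e] by auto

lemma rot_eq_iff: "rot G d = rot G e \<longleftrightarrow> d = e"
  using permutes_inj[OF rot_permutes] by (auto dest: injD)

lemma outs_nonempty: "v \<in> Vs G \<Longrightarrow> outs G v \<noteq> {}"
  using rot_cyclic by (auto simp: cyclic_on_def)

lemma connected_closed:
  assumes "u \<in> S" "u \<in> Vs G" "\<And>e. e \<in> Ar G \<Longrightarrow> src G e \<in> S \<Longrightarrow> tgt G e \<in> S"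
  shows "Vs G \<subseteq> S"
proof
  fix v assume v: "v \<in> Vs G"
  have "reachable (with_proj (mk_symmetric (ugraph G))) u v"
    using conn v assms(2) unfolding Digraph_Component.connected_def by (auto elim: strongly_connectedE)
  then have "u \<rightarrow>\<^sup>*\<^bsub>ugraph G\<^esub> v"
    using reachable_mk_symmetric_eq[OF sym_arcs] by simp
  then show "v \<in> S"
    by (induct rule: reachable_induct) (use assms in \<open>auto simp: arcs_ends_conv\<close>)
qed

lemma internal_or_bdry: "v \<in> Vs G \<Longrightarrow> v \<in> internal G \<or> v \<in> set (bdry G)"
  by (auto simp: internal_def)

lemma outs_bdry:
  assumes "e \<in> Ar G" "src G e \<in> set (bdry G)"
  shows "outs G (src G e) = {e}"
proof -
  have "card (outs G (src G e)) = 1" using bdry_deg assms(2) by (simp add: deg_def out_degree_def)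
  then obtain d where "outs G (src G e) = {d}" by (auto simp: card_Suc_eq)
  with assms(1) show ?thesis by auto
qed

text \<open>Seen from \<open>x\<close>, the arcs in \<open>cs\<close> lead to the children: they
  leave the head of \<open>x\<close> clockwise, beginning right after the arc that goes
  back.\<close>

definition star :: "nat \<Rightarrow> nat list \<Rightarrow> bool" where
  "star x cs \<longleftrightarrow> distinct (rev_arc G x # cs) \<and> set (rev_arc G x # cs) = outs G (tgt G x) \<and>
     map (rot G) (rev_arc G x # cs) = cs @ [rev_arc G x]"

lemma star_ex:
  assumes "x \<in> Ar G"
  obtains cs where "star x cs"
  by (rule cyclic_on_ex_list[OF rot_cyclic[of "tgt G x"], of "rev_arc G x"])
    (use assms in \<open>auto simp: star_def\<close>)

end

text \<open>The component of the head of \<open>x\<close> once the edge of \<open>x\<close> is cut,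
  so it equals \<open>side G (rev_arc G x)\<close> by \<open>side_rev\<close>. The plain transitive
  closure gives the induction principle \<open>beyond_least\<close>.\<close>

definition beyond :: "plabic \<Rightarrow> nat \<Rightarrow> nat set" where
  "beyond G x = {v. (tgt G x, v) \<in> ((\<lambda>e. (src G e, tgt G e)) ` (Ar G - {x, rev_arc G x}))\<^sup>*}"

text \<open>Every edge is a bridge. This is the form of acyclicity that fits \<open>beyond\<close>;
  \<open>acyclic_iff_treelike\<close> links it to cycles.\<close>

definition treelike :: "plabic \<Rightarrow> bool" where
  "treelike G \<longleftrightarrow> (\<forall>x\<in>Ar G. src G x \<notin> beyond G x)"

lemma tgt_in_beyond: "tgt G x \<in> beyond G x"
  by (simp add: beyond_def)

lemma beyond_step:
  "\<lbrakk>src G e \<in> beyond G x; e \<in> Ar G; e \<noteq> x; e \<noteq> rev_arc G x\<rbrakk> \<Longrightarrow> tgt G e \<in> beyond G x"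
  unfolding beyond_def by (auto intro: rtrancl_into_rtrancl)

lemma beyond_least:
  assumes "tgt G x \<in> S"
    "\<And>e. \<lbrakk>e \<in> Ar G; e \<noteq> x; e \<noteq> rev_arc G x; src G e \<in> S; src G e \<in> beyond G x\<rbrakk> \<Longrightarrow> tgt G e \<in> S"
  shows "beyond G x \<subseteq> S"
proof
  fix v assume "v \<in> beyond G x"
  then have "(tgt G x, v) \<in> ((\<lambda>e. (src G e, tgt G e)) ` (Ar G - {x, rev_arc G x}))\<^sup>*"
    by (simp add: beyond_def)
  then have "v \<in> beyond G x \<and> v \<in> S"
    by induction (use assms in \<open>auto intro: beyond_step tgt_in_beyond\<close>)
  then show "v \<in> S" by simp
qed

context plabic_map
begin

lemma beyond_sub: "x \<in> Ar G \<Longrightarrow> beyond G x \<subseteq> Vs G"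
  by (rule beyond_least) auto

lemma finite_beyond: "x \<in> Ar G \<Longrightarrow> finite (beyond G x)"
  using beyond_sub finite_verts by (blast intro: finite_subset)

lemma beyond_Un:
  assumes "x \<in> Ar G"
  shows "beyond G x \<union> beyond G (rev_arc G x) = Vs G"
proof
  show "beyond G x \<union> beyond G (rev_arc G x) \<subseteq> Vs G"
    using beyond_sub assms by simp
  have tt: "tgt G x \<in> beyond G x" "src G x \<in> beyond G (rev_arc G x)"
    using tgt_in_beyond[of G x] tgt_in_beyond[of G "rev_arc G x"] assms by auto
  show "Vs G \<subseteq> beyond G x \<union> beyond G (rev_arc G x)"
  proof (rule connected_closed[of "tgt G x"])
    fix e assume e: "e \<in> Ar G" "src G e \<in> beyond G x \<union> beyond G (rev_arc G x)"
    show "tgt G e \<in> beyond G x \<union> beyond G (rev_arc G x)"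
    proof (cases "e = x \<or> e = rev_arc G x")
      case True
      then show ?thesis using tt assms by auto
    next
      case False
      then show ?thesis using e beyond_step[of G e x] beyond_step[of G e "rev_arc G x"] by auto
    qed
  qed (use assms tt in auto)
qed

end

locale treelike_map = plabic_map +
  assumes tl: "treelike G"
begin

lemma src_notin: "x \<in> Ar G \<Longrightarrow> src G x \<notin> beyond G x"
  using tl by (auto simp: treelike_def)

text \<open>Edges can be traversed both ways, so a walk beyond \<open>y\<close> can enter the part
  beyond \<open>z\<close> only along \<open>z\<close> itself, whose tail is excluded by
  \<open>sz\<close>. If it started there, reversing \<open>y\<close> would put the tail of
  \<open>y\<close> there too, against \<open>sy\<close>.\<close>

lemma beyond_disj:
  assumes y: "y \<in> Ar G" and z: "z \<in> Ar G" and yz: "y \<noteq> z"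
    and sz: "src G z \<notin> beyond G y" and sy: "src G y \<notin> beyond G z"
  shows "beyond G y \<inter> beyond G z = {}"
proof -
  have "beyond G y \<subseteq> - beyond G z"
  proof (rule beyond_least)
    show "tgt G y \<in> - beyond G z"
    proof
      assume a: "tgt G y \<in> beyond G z"
      have "rev_arc G y \<noteq> z" using sz y tgt_in_beyond[of G y] by auto
      moreover have "rev_arc G y \<noteq> rev_arc G z" using yz by (simp add: arev_eq_iff)
      ultimately have "tgt G (rev_arc G y) \<in> beyond G z"
        using beyond_step[of G "rev_arc G y" z] a y by auto
      with sy y show False by simp
    qed
    fix e assume e: "e \<in> Ar G" "e \<noteq> y" "e \<noteq> rev_arc G y" "src G e \<in> - beyond G z" "src G e \<in> beyond G y"
    show "tgt G e \<in> - beyond G z"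
    proof
      assume a: "tgt G e \<in> beyond G z"
      have "rev_arc G e \<noteq> rev_arc G z" using e sz by (auto simp: arev_eq_iff)
      moreover have "rev_arc G e \<noteq> z"
      proof
        assume "rev_arc G e = z"
        then have "src G e = tgt G z" using e(1) by auto
        with e(4) tgt_in_beyond[of G z] show False by simp
      qed
      ultimately have "tgt G (rev_arc G e) \<in> beyond G z"
        using beyond_step[of G "rev_arc G e" z] a e by auto
      with e show False by simp
    qed
  qed
  then show ?thesis by auto
qed

lemma beyond_rev_disj:
  assumes "x \<in> Ar G"
  shows "beyond G x \<inter> beyond G (rev_arc G x) = {}"
proof -
  have "beyond G x \<subseteq> - beyond G (rev_arc G x)"
  proof (rule beyond_least)
    show "tgt G x \<in> - beyond G (rev_arc G x)" using src_notin[of "rev_arc G x"] assms by simp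
    fix e assume e: "e \<in> Ar G" "e \<noteq> x" "e \<noteq> rev_arc G x" "src G e \<in> - beyond G (rev_arc G x)"
    have "rev_arc G e \<noteq> x" "rev_arc G e \<noteq> rev_arc G x" using e arev_arev by (metis, simp add: arev_eq_iff)
    then show "tgt G e \<in> - beyond G (rev_arc G x)"
      using beyond_step[of G "rev_arc G e" "rev_arc G x"] e by auto
  qed
  then show ?thesis by auto
qed

lemma
  assumes x: "x \<in> Ar G" and y: "y \<in> outs G (tgt G x)" "y \<noteq> rev_arc G x"
  shows beyond_child_sub: "beyond G y \<subseteq> beyond G x" and child_neq: "y \<noteq> x"
proof -
  show yx: "y \<noteq> x" using src_notin[OF x] tgt_in_beyond[of G x] y by auto
  have sy: "src G y \<notin> beyond G y" using src_notin[of y] y by auto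
  \<comment> \<open>Carrying both memberships keeps the walk off the edge of \<open>x\<close>: being
    beyond \<open>x\<close> rules out \<open>x\<close> itself, and being beyond \<open>y\<close>
    rules out its reverse, which starts at the tail of \<open>y\<close>.\<close>
  have "beyond G y \<subseteq> beyond G x \<inter> beyond G y"
  proof (rule beyond_least)
    show "tgt G y \<in> beyond G x \<inter> beyond G y"
      using beyond_step[of G y x] y yx tgt_in_beyond[of G x] tgt_in_beyond[of G y] by auto
    fix e assume e: "e \<in> Ar G" "e \<noteq> y" "e \<noteq> rev_arc G y" "src G e \<in> beyond G x \<inter> beyond G y"
    have "e \<noteq> x" using src_notin[OF x] e by auto
    moreover have "e \<noteq> rev_arc G x" using e sy y x by auto
    ultimately show "tgt G e \<in> beyond G x \<inter> beyond G y"
      using beyond_step[of G e x] beyond_step[of G e y] e by auto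
  qed
  then show "beyond G y \<subseteq> beyond G x" by auto
qed

lemma children_disj:
  assumes "y \<in> Ar G" "z \<in> Ar G" "src G y = src G z" "y \<noteq> z"
  shows "beyond G y \<inter> beyond G z = {}"
  using beyond_disj[OF assms(1,2,4)] src_notin[OF assms(1)] src_notin[OF assms(2)] assms(3)
  by simp

text \<open>A walk leaves the part beyond a child only over the edge of that child, which brings it
  back to the head of \<open>x\<close>. Counting over one side of an edge follows this
  recursion.\<close>

lemma beyond_children:
  assumes x: "x \<in> Ar G" 
  shows "beyond G x = insert (tgt G x) (\<Union>y\<in>outs G (tgt G x) - {rev_arc G x}. beyond G y)"
    (is "_ = ?R")
proof
  show "?R \<subseteq> beyond G x" using beyond_child_sub[OF x] tgt_in_beyond by blast
  show "beyond G x \<subseteq> ?R"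
  proof (rule beyond_least)
    fix e assume e: "e \<in> Ar G" "e \<noteq> x" "e \<noteq> rev_arc G x" "src G e \<in> ?R"
    show "tgt G e \<in> ?R"
    proof (cases "src G e = tgt G x")
      case True
      then show ?thesis using e tgt_in_beyond[of G e] by auto
    next
      case False
      then obtain y where y: "y \<in> outs G (tgt G x)" "y \<noteq> rev_arc G x" "src G e \<in> beyond G y"
        using e(4) by (auto simp del: in_out_arcs_conv)
      show ?thesis
      proof (cases "e = rev_arc G y")
        case True
        then show ?thesis using y by auto
      next
        case False
        have "e \<noteq> y" using y src_notin[of y] by auto
        then have "tgt G e \<in> beyond G y" using beyond_step[of G e y] False y e by auto
        then show ?thesis using y by auto
      qed
    qed
  qed simp
qed

end

section \<open>The plane tree seen through an arc\<close>

datatype plane_tree = Leaf | Node bool "plane_tree list"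

text \<open>A relation instead of a function, because recursion along arcs would run forever around
  a cycle. Existence is proved for trees in \<open>rep_ex\<close>, uniqueness in general in
  \<open>rep_unique\<close>. The conditions on \<open>cs\<close> are those of
  \<open>star\<close>.\<close>

inductive rep :: "plabic \<Rightarrow> nat \<Rightarrow> plane_tree \<Rightarrow> bool" for G where
  rep_Leaf: "\<lbrakk>x \<in> Ar G; tgt G x \<in> set (bdry G)\<rbrakk> \<Longrightarrow> rep G x Leaf"
| rep_Node: "\<lbrakk>x \<in> Ar G; tgt G x \<in> internal G; distinct (rev_arc G x # cs);
     set (rev_arc G x # cs) = outs G (tgt G x);
     map (rot G) (rev_arc G x # cs) = cs @ [rev_arc G x];
     list_all2 (rep G) cs ts\<rbrakk> \<Longrightarrow> rep G x (Node (tgt G x \<in> black G) ts)"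

lemma rep_in: "rep G x t \<Longrightarrow> x \<in> Ar G"
  by (auto elim: rep.cases)

lemma (in treelike_map) rep_ex: "x \<in> Ar G \<Longrightarrow> \<exists>t. rep G x t"
proof (induction "card (beyond G x)" arbitrary: x rule: less_induct)
  case less
  show ?case
  proof (cases "tgt G x \<in> set (bdry G)")
    case True
    then show ?thesis using less.prems rep_Leaf by blast
  next
    case False
    then have int: "tgt G x \<in> internal G" using internal_or_bdry[of "tgt G x"] less.prems by auto
    obtain cs where cs: "star x cs" using star_ex[OF less.prems] .
    have "\<exists>t. rep G c t" if "c \<in> set cs" for c
    proof -
      have c: "c \<in> outs G (tgt G x)" "c \<noteq> rev_arc G x" using cs that unfolding star_def by auto
      have "beyond G c \<subset> beyond G x"
        using beyond_child_sub[OF less.prems c] src_notin[of c] c tgt_in_beyond[of G x] by auto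
      then show ?thesis using less.hyps[of c] c psubset_card_mono[OF finite_beyond[OF less.prems]] by auto
    qed
    then have "list_all2 (rep G) cs (map (\<lambda>c. SOME t. rep G c t) cs)"
      by (auto simp: list_all2_conv_all_nth intro: someI_ex)
    then show ?thesis using rep_Node[OF less.prems int] cs unfolding star_def by blast
  qed
qed

lemma rep_unique: "rep G x t \<Longrightarrow> rep G x t' \<Longrightarrow> t = t'"
proof (induction x t arbitrary: t' rule: rep.induct)
  case (rep_Leaf x)
  from rep_Leaf(3,2) show ?case by (cases rule: rep.cases) (auto simp: internal_def)
next
  case (rep_Node x cs ts)
  from \<open>rep G x t'\<close> show ?case
  proof (cases rule: rep.cases)
    case rep_Leaf
    then show ?thesis using rep_Node.hyps(2) by (simp add: internal_def)
  next
    case node: (rep_Node cs' ts')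
    have cs: "cs' = cs"
      by (rule map_cycle_unique[OF node(6) rep_Node.hyps(5) node(4) rep_Node.hyps(3)])
    have ih: "list_all2 (\<lambda>c t. rep G c t \<and> (\<forall>t'. rep G c t' \<longrightarrow> t = t')) cs ts"
      using rep_Node.IH by simp
    have nd: "list_all2 (rep G) cs ts'" using node(7) cs by simp
    have "ts = ts'"
    proof (rule nth_equalityI)
      show "length ts = length ts'"
        using list_all2_lengthD[OF ih] list_all2_lengthD[OF nd] by simp
      fix i assume "i < length ts"
      then have i: "i < length cs" using list_all2_lengthD[OF ih] by simp
      show "ts ! i = ts' ! i"
        using list_all2_nthD[OF ih i] list_all2_nthD[OF nd i] by simp
    qed
    then show ?thesis using node(1) by simp
  qed
qed

lemma plabic_graph_map: "plabic_graph G \<Longrightarrow> plabic_map G"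
  unfolding plabic_graph_def planar_map_def plabic_map_def by auto

section \<open>Trees, sides of edges and counting\<close>

context plabic_map
begin

text \<open>The arcs are deleted in the order in which \<open>side G (rev_arc G x)\<close> deletes
  them.\<close>

lemma reachable_del_edge:
  assumes "x \<in> Ar G" "u \<in> Vs G"
  shows "reachable (pre_digraph.del_arc (pre_digraph.del_arc (ugraph G) (rev_arc G x)) x) u v \<longleftrightarrow>
    (u, v) \<in> ((\<lambda>e. (src G e, tgt G e)) ` (Ar G - {x, rev_arc G x}))\<^sup>*"
proof -
  let ?D = "pre_digraph.del_arc (pre_digraph.del_arc (ugraph G) (rev_arc G x)) x"
  interpret D: wf_digraph ?D
    by unfold_locales (auto simp: pre_digraph.del_arc_def)
  have "arcs_ends ?D = (\<lambda>e. (src G e, tgt G e)) ` (Ar G - {x, rev_arc G x})"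
    by (auto simp: arcs_ends_conv pre_digraph.del_arc_def)
  then show ?thesis
    using D.reachable_conv'[of u v] assms by (simp add: pre_digraph.del_arc_def)
qed

lemma side_rev:
  assumes "x \<in> Ar G"
  shows "side G (rev_arc G x) = beyond G x"
  using reachable_del_edge[OF assms, of "tgt G x"] assms
  by (simp add: side_def beyond_def)

lemma apath_no_rev:
  assumes "apath u p v"
  shows "\<forall>e\<in>set p. rev_arc G e \<notin> set p"
  using assms
proof (induction p arbitrary: u)
  case (Cons e es)
  have e: "e \<in> Ar G" "src G e = u" and es: "apath (tgt G e) es v"
    and u: "u \<notin> set (awalk_verts (tgt G e) es)"
    using Cons.prems by (auto simp: apath_Cons_iff)
  have "set (awalk_verts (tgt G e) es) = {tgt G e} \<union> src G ` set es \<union> tgt G ` set es"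
    using set_awalk_verts[of "tgt G e" es v] es by (simp add: apath_def)
  then have "rev_arc G e \<notin> set es" using u e by force
  moreover have "rev_arc G e \<noteq> e" using e arev_neq by simp
  moreover have "\<forall>f\<in>set es. rev_arc G f \<noteq> e" using \<open>rev_arc G e \<notin> set es\<close> by auto
  ultimately show ?case using Cons.IH[OF es] by auto
qed simp

text \<open>After its first arc \<open>x\<close>, a cycle that uses no edge twice returns to the
  tail of \<open>x\<close> while avoiding the edge of \<open>x\<close>. Conversely, a simple path
  from the head of \<open>x\<close> back to its tail that avoids this edge closes up with
  \<open>x\<close>, and a simple path never uses an arc together with its reverse.\<close>

lemma acyclic_iff_treelike:
  "(\<exists>p. cycle p \<and> (\<forall>a\<in>set p. rev_arc G a \<notin> set p)) \<longleftrightarrow> \<not> treelike G"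
proof
  assume "\<exists>p. cycle p \<and> (\<forall>a\<in>set p. rev_arc G a \<notin> set p)"
  then obtain p u where p: "awalk u p u" "distinct (tl (awalk_verts u p))" "p \<noteq> []"
    and nr: "\<forall>a\<in>set p. rev_arc G a \<notin> set p"
    unfolding cycle_def by auto
  have dp: "distinct p" by (rule distinct_tl_verts_imp_distinct[OF p(1,2)])
  obtain x q where xq: "p = x # q" using p(3) by (cases p) auto
  have x: "x \<in> Ar G" "src G x = u" and q: "awalk (tgt G x) q u"
    using p(1) unfolding xq by (auto simp: awalk_Cons_iff)
  have "x \<notin> set q" "rev_arc G x \<notin> set q" using dp nr unfolding xq by auto
  then have *: "u \<in> beyond G x" if "awalk w q u" "w \<in> beyond G x" for w
    using that
  proof (induction q arbitrary: w)
    case Nil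
    then show ?case by (simp add: awalk_Nil_iff)
  next
    case (Cons e es)
    then show ?case by (auto simp: awalk_Cons_iff intro: beyond_step)
  qed
  have "u \<in> beyond G x" by (rule *[OF q tgt_in_beyond])
  then show "\<not> treelike G" using x by (auto simp: treelike_def)
next
  assume "\<not> treelike G"
  then obtain x where x: "x \<in> Ar G" "src G x \<in> beyond G x" by (auto simp: treelike_def)
  let ?D = "pre_digraph.del_arc (pre_digraph.del_arc (ugraph G) (rev_arc G x)) x"
  interpret D: wf_digraph ?D
    by unfold_locales (auto simp: pre_digraph.del_arc_def)
  have "reachable ?D (tgt G x) (src G x)"
    using x reachable_del_edge[OF x(1), of "tgt G x" "src G x"] by (simp add: beyond_def)
  then obtain p where p: "D.apath (tgt G x) p (src G x)" by (auto simp: D.reachable_apath)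
  have sub: "subgraph ?D (ugraph G)"
    by (auto simp: subgraph_def compatible_def pre_digraph.del_arc_def) (unfold_locales, auto)
  have ap: "apath (tgt G x) p (src G x)"
    by (rule subgraph_apath_imp_apath[OF p sub])
  have "set p \<subseteq> Ar G - {x, rev_arc G x}"
    using p unfolding D.apath_def D.awalk_def by (auto simp: pre_digraph.del_arc_def)
  then have 1: "x \<notin> set p" "rev_arc G x \<notin> set p" by auto
  have "cycle (x # p)"
    unfolding cycle_def using ap x
    by (intro exI[of _ "src G x"]) (auto simp: apath_def awalk_Cons_iff)
  moreover have "\<forall>a\<in>set (x # p). rev_arc G a \<notin> set (x # p)"
    using apath_no_rev[OF ap] 1 x arev_neq by auto
  ultimately show "\<exists>p. cycle p \<and> (\<forall>a\<in>set p. rev_arc G a \<notin> set p)" by blast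
qed

text \<open>If the vertices \<open>v\<close> other than the base point stay reachable without the edge of \<open>x\<close>, then the last
  edges of shortest paths to them are pairwise distinct, which is too many edges.\<close>

lemma treelikeI_card:
  assumes count: "card (Vs G) = card (Ar G) div 2 + 1"
  shows "treelike G"
proof (rule ccontr)
  assume "\<not> treelike G"
  then obtain x where x: "x \<in> Ar G" "src G x \<in> beyond G x" by (auto simp: treelike_def)
  let ?A = "Ar G - {x, rev_arc G x}"
  let ?R = "(\<lambda>e. (src G e, tgt G e)) ` ?A"
  let ?r = "tgt G x"
  have all: "Vs G \<subseteq> beyond G x"
  proof (rule connected_closed[of ?r])
    fix e assume e: "e \<in> Ar G" "src G e \<in> beyond G x"
    show "tgt G e \<in> beyond G x"
      using beyond_step[of G e x] e x tgt_in_beyond[of G x] by (cases "e = x \<or> e = rev_arc G x") auto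
  qed (use x tgt_in_beyond in auto)
  define d where "d v = (LEAST n. (?r, v) \<in> ?R ^^ n)" for v
  have "\<exists>e\<in>?A. tgt G e = v \<and> d v = Suc (d (src G e))" if v: "v \<in> Vs G" "v \<noteq> ?r" for v
  proof -
    have "(?r, v) \<in> ?R\<^sup>*" using all v by (auto simp: beyond_def)
    then obtain n where n: "(?r, v) \<in> ?R ^^ n" using rtrancl_imp_relpow by blast
    then have dv: "(?r, v) \<in> ?R ^^ d v" unfolding d_def by (rule LeastI)
    then have "d v \<noteq> 0" using v(2) by (intro notI) simp
    then obtain k where k: "d v = Suc k" by (cases "d v") auto
    with dv obtain e where e: "e \<in> ?A" "tgt G e = v" "(?r, src G e) \<in> ?R ^^ k" by auto
    have "d (src G e) \<le> k" unfolding d_def using e(3) by (rule Least_le)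
    moreover have "(?r, v) \<in> ?R ^^ Suc (d (src G e))"
    proof -
      have "(?r, src G e) \<in> ?R ^^ d (src G e)" unfolding d_def using e(3) by (rule LeastI)
      then show ?thesis using e by auto
    qed
    then have "d v \<le> Suc (d (src G e))" unfolding d_def[of v] by (rule Least_le)
    ultimately show ?thesis using e k by (intro bexI[of _ e]) auto
  qed
  then obtain p where p: "\<And>v. v \<in> Vs G \<Longrightarrow> v \<noteq> ?r \<Longrightarrow> p v \<in> ?A \<and> tgt G (p v) = v \<and> d v = Suc (d (src G (p v)))"
    by metis
  let ?W = "Vs G - {?r}"
  have inj: "inj_on p ?W" by (rule inj_onI) (metis DiffD1 DiffD2 p singletonI)
  \<comment> \<open>If the arc chosen for \<open>v\<close> were the reverse of the one chosen for
    \<open>w\<close>, then \<open>d v\<close> and \<open>d w\<close> would each exceed the other by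
    one.\<close>
  have disj: "p ` ?W \<inter> rev_arc G ` p ` ?W = {}"
  proof (rule ccontr)
    assume "p ` ?W \<inter> rev_arc G ` p ` ?W \<noteq> {}"
    then obtain v w where vw: "v \<in> ?W" "w \<in> ?W" "p v = rev_arc G (p w)" by auto
    have pv: "p v \<in> ?A" "tgt G (p v) = v" "d v = Suc (d (src G (p v)))"
      and pw: "p w \<in> ?A" "tgt G (p w) = w" "d w = Suc (d (src G (p w)))"
      using p[of v] p[of w] vw(1,2) by simp_all
    have "src G (p v) = w" "src G (p w) = v"
      using tail_arev[of "p w"] head_arev[of "p w"] vw(3) pv(1,2) pw(1,2) by simp_all
    then show False using pv(3) pw(3) by simp
  qed
  have sub: "p ` ?W \<union> rev_arc G ` p ` ?W \<subseteq> ?A"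
  proof -
    have "rev_arc G e \<in> ?A" if "e \<in> ?A" for e using that x by (auto simp: arev_eq_iff)
    then show ?thesis using p by auto
  qed
  \<comment> \<open>Both directions of an edge count as arcs. The chosen arcs thus give one edge for
    each vertex other than the base point, and none is the edge of \<open>x\<close>: one edge more
    than there are.\<close>
  have "2 * card ?W = card (p ` ?W) + card (rev_arc G ` p ` ?W)"
    using inj by (simp add: card_image inj_on_arev)
  also have "\<dots> = card (p ` ?W \<union> rev_arc G ` p ` ?W)"
    using disj by (intro card_Un_disjoint[symmetric]) auto
  also have "\<dots> \<le> card ?A" by (rule card_mono[OF _ sub]) auto
  also have "\<dots> = card (Ar G) - 2"
    using x arev_neq[of x] by (subst card_Diff_subset) auto
  finally have "2 * card ?W \<le> card (Ar G) - 2" .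
  moreover have "card {x, rev_arc G x} \<le> card (Ar G)" using x by (intro card_mono) auto
  then have "card (Ar G) \<ge> 2" using x arev_neq[of x] by (auto simp: card_insert_if split: if_splits)
  moreover have "card ?W = card (Ar G) div 2" using count x by simp
  ultimately show False by linarith
qed

end

section \<open>Contours\<close>

text \<open>One closed face walk through all arcs, so there is a single face and Euler's formula
  reads V = E + 1. This count goes in at \<open>planar_mapI\<close> and comes out at
  \<open>planar_card\<close>.\<close>

definition contour :: "plabic \<Rightarrow> nat \<Rightarrow> nat list \<Rightarrow> bool" where
  "contour G r ps \<longleftrightarrow> distinct (r # ps) \<and> set (r # ps) = Ar G \<and> map (face_succ G) (r # ps) = ps @ [r]"

lemma faces_contour:
  assumes "contour G r ps"
  shows "faces G = {Ar G}"
proof -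
  have "cyclic_on (face_succ G) (Ar G)"
    using assms cyclic_on_list[of "face_succ G" r ps] by (simp add: contour_def)
  then have "orbit (face_succ G) a = Ar G" if "a \<in> Ar G" for a
    using that by (rule orbit_cyclic_eq3)
  moreover have "Ar G \<noteq> {}" using assms by (auto simp: contour_def)
  ultimately show ?thesis by (auto simp: faces_def)
qed

text \<open>Connectedness is drawn from the contour: consecutive arcs meet in a vertex, and every
  vertex has an outgoing arc because a cyclic set is nonempty.\<close>

lemma planar_mapI:
  assumes fin: "fin_digraph (ugraph G)" and bid: "bidirected_digraph (ugraph G) (rev_arc G)"
    and perm: "rot G permutes Ar G"
    and cyc: "\<And>v. v \<in> Vs G \<Longrightarrow> cyclic_on (rot G) (outs G v)"
    and c: "contour G r ps"
    and count: "card (Vs G) = card (Ar G) div 2 + 1"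
  shows "planar_map G"
proof -
  interpret fin_digraph "ugraph G" by (rule fin)
  interpret bidirected_digraph "ugraph G" "rev_arc G" by (rule bid)
  have r: "r \<in> Ar G" using c by (auto simp: contour_def)
  have step: "src G (face_succ G e) = tgt G e" if "e \<in> Ar G" for e
    using cyclic_on_inI[OF cyc, of "tgt G e" "rev_arc G e"] that by (auto simp: face_succ_def)
  have reach: "src G r \<rightarrow>\<^sup>*\<^bsub>ugraph G\<^esub> src G e" if "e \<in> Ar G" for e
  proof -
    have "cyclic_on (face_succ G) (Ar G)"
      using c cyclic_on_list[of "face_succ G" r ps] by (simp add: contour_def)
    then have orb: "orbit (face_succ G) r = Ar G" using r by (rule orbit_cyclic_eq3)
    then have "e \<in> orbit (face_succ G) r" using that by simp
    then show ?thesis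
    proof induction
      case base
      have "src G r \<rightarrow>\<^bsub>ugraph G\<^esub> tgt G r" using r by (auto simp: arcs_ends_conv)
      then show ?case using step[OF r] by auto
    next
      case (step y)
      then have y: "y \<in> Ar G" using orb by simp
      have "src G y \<rightarrow>\<^bsub>ugraph G\<^esub> tgt G y" using y by (auto simp: arcs_ends_conv)
      then show ?case using \<open>\<And>e. e \<in> Ar G \<Longrightarrow> src G (face_succ G e) = tgt G e\<close>[OF y] step
        by (auto intro: reachable_adj_trans)
    qed
  qed
  have reachv: "src G r \<rightarrow>\<^sup>*\<^bsub>ugraph G\<^esub> v" if v: "v \<in> Vs G" for v
  proof -
    obtain e where "e \<in> outs G v" using cyc[OF v] by (auto simp: cyclic_on_def)
    then show ?thesis using reach[of e] by auto
  qed
  have "strongly_connected (ugraph G)"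
  proof
    show "Vs G \<noteq> {}" using tail_in_verts[OF r] by blast
    fix u v assume "u \<in> Vs G" "v \<in> Vs G"
    then show "u \<rightarrow>\<^sup>*\<^bsub>ugraph G\<^esub> v" using reachv symmetric_reachable' reachable_trans by blast
  qed
  then have "Digraph_Component.connected (ugraph G)"
    unfolding Digraph_Component.connected_def strongly_connected_def
    by (simp add: reachable_mk_symmetric_eq[OF sym_arcs])
  then show ?thesis unfolding planar_map_def
    using assms faces_contour[OF c] by simp
qed

lemma (in plabic_map) planar_card:
  assumes "planar_map G" "contour G r ps"
  shows "card (Vs G) = card (Ar G) div 2 + 1"
  using assms(1) faces_contour[OF assms(2)] by (simp add: planar_map_def)

section \<open>The order of the boundary along the contour\<close>

lemma funpow_list:
  assumes "map f (x # vs) = vs @ [z]" "j \<le> Suc (length vs)"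
  shows "(f ^^ j) x = (x # vs @ [z]) ! j"
  using assms(2)
proof (induction j)
  case (Suc j)
  then have "f ((x # vs) ! j) = (vs @ [z]) ! j"
    by (metis assms(1) Suc_le_lessD length_Cons nth_map)
  moreover have "(x # vs @ [z]) ! j = (x # vs) ! j"
    using Suc.prems by (metis Suc_le_lessD append_Cons length_Cons nth_append)
  ultimately show ?case using Suc by simp
qed simp

lemma filter_nth_split:
  "i < length (filter Q p) \<Longrightarrow>
    \<exists>us vs. p = us @ filter Q p ! i # vs \<and> filter Q vs = drop (Suc i) (filter Q p)"
proof (induction p arbitrary: i)
  case (Cons a p)
  show ?case
  proof (cases "Q a")
    case True
    show ?thesis
    proof (cases i)
      case 0
      have "a # p = [] @ filter Q (a # p) ! i # p" "filter Q p = drop (Suc i) (filter Q (a # p))"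
        using True 0 by auto
      then show ?thesis by blast
    next
      case (Suc k)
      then obtain us vs where "p = us @ filter Q p ! k # vs" "filter Q vs = drop (Suc k) (filter Q p)"
        using Cons.IH[of k] Cons.prems True by auto
      then show ?thesis using True Suc by (intro exI[of _ "a # us"] exI[of _ vs]) auto
    qed
  next
    case False
    then obtain us vs where "p = us @ filter Q p ! i # vs" "filter Q vs = drop (Suc i) (filter Q p)"
      using Cons.IH[of i] Cons.prems by auto
    then show ?thesis using False by (intro exI[of _ "a # us"] exI[of _ vs]) auto
  qed
qed simp

text \<open>Replaces the first-return condition in \<open>boundary_clockwise\<close> by adjacency in
  a filtered list. The cycle starts at an entry satisfying \<open>Q\<close>, so that the last
  filtered entry returns to the first one.\<close>

lemma first_return:
  assumes p: "map f (r # ps) = ps @ [r]" and r: "Q r" and i: "i < length (filter Q (r # ps))"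
  defines "qs \<equiv> filter Q (r # ps)"
  shows "\<exists>k>0. (f ^^ k) (qs ! i) = qs ! (Suc i mod length qs) \<and>
    (\<forall>j. 0 < j \<and> j < k \<longrightarrow> \<not> Q ((f ^^ j) (qs ! i)))"
proof -
  obtain us vs where sp: "r # ps = us @ qs ! i # vs" and vs: "filter Q vs = drop (Suc i) qs"
    using filter_nth_split[of i Q "r # ps"] i unfolding qs_def by blast
  have fvs: "map f (qs ! i # vs) = vs @ [r]"
  proof -
    have "map f (qs ! i # vs) = drop (length us) (map f (r # ps))" using sp by simp
    also have "\<dots> = drop (Suc (length us)) ((r # ps) @ [r])" using p by simp
    also have "\<dots> = vs @ [r]" unfolding sp by simp
    finally show ?thesis .
  qed
  show ?thesis
  proof (cases "Suc i < length qs")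
    case True
    let ?y = "qs ! Suc i"
    have "filter Q vs = ?y # drop (Suc (Suc i)) qs" using vs True by (simp add: Cons_nth_drop_Suc)
    then obtain v1 v2 where v: "vs = v1 @ ?y # v2" "\<forall>v\<in>set v1. \<not> Q v"
      by (auto simp: filter_eq_Cons_iff)
    have f1: "map f (qs ! i # v1) = v1 @ [?y]"
    proof -
      have "take (Suc (length v1)) (map f (qs ! i # vs)) = take (Suc (length v1)) (vs @ [r])"
        using fvs by simp
      then show ?thesis unfolding v(1) by simp
    qed
    show ?thesis
    proof (intro exI[of _ "Suc (length v1)"] conjI allI impI)
      show "(f ^^ Suc (length v1)) (qs ! i) = qs ! (Suc i mod length qs)"
        using funpow_list[OF f1, of "Suc (length v1)"] True by (simp add: nth_append)
      fix j assume j: "0 < j \<and> j < Suc (length v1)"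
      then obtain j' where "j = Suc j'" by (cases j) auto
      then show "\<not> Q ((f ^^ j) (qs ! i))"
        using funpow_list[OF f1, of j] j v(2) by (simp add: nth_append del: funpow.simps)
    qed simp
  next
    case False
    then have last: "Suc i = length qs" using i unfolding qs_def by simp
    then have v: "\<forall>v\<in>set vs. \<not> Q v" using vs by (simp add: filter_empty_conv)
    have q0: "qs ! 0 = r" using r by (simp add: qs_def)
    show ?thesis
    proof (intro exI[of _ "Suc (length vs)"] conjI allI impI)
      show "(f ^^ Suc (length vs)) (qs ! i) = qs ! (Suc i mod length qs)"
        using funpow_list[OF fvs, of "Suc (length vs)"] last q0 by (simp add: nth_append)
      fix j assume j: "0 < j \<and> j < Suc (length vs)"
      then obtain j' where "j = Suc j'" by (cases j) auto
      then show "\<not> Q ((f ^^ j) (qs ! i))"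
        using funpow_list[OF fvs, of j] j v by (simp add: nth_append del: funpow.simps)
    qed simp
  qed
qed

lemma first_return_unique:
  assumes "0 < (k::nat)" "Q (g k)" "\<forall>j. 0 < j \<and> j < k \<longrightarrow> \<not> Q (g j)"
    and "0 < l" "Q (g l)" "\<forall>j. 0 < j \<and> j < l \<longrightarrow> \<not> Q (g j)"
  shows "k = l"
proof -
  have "\<not> k < l" "\<not> l < k" using assms by blast+
  then show ?thesis by simp
qed

text \<open>A boundary vertex has one outgoing arc, so the filtered contour meets each label exactly
  once, and the next label met is the next entry of the filtered list. As both lists begin with
  label 1, agreement of successors is agreement of the lists.\<close>

lemma (in plabic_map) boundary_clockwise_iff:
  assumes c: "contour G r ps" and r: "src G r = bdry G ! 0" and n: "bdry G \<noteq> []"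
    and d: "distinct (bdry G)"
  shows "boundary_clockwise G \<longleftrightarrow>
    map (src G) (filter (\<lambda>e. src G e \<in> set (bdry G)) (r # ps)) = bdry G"
proof -
  let ?Q = "\<lambda>e. src G e \<in> set (bdry G)"
  define qs where "qs = filter ?Q (r # ps)"
  have cs: "distinct (r # ps)" "set (r # ps) = Ar G" "map (face_succ G) (r # ps) = ps @ [r]"
    using c by (auto simp: contour_def)
  have setq: "set qs = {e \<in> Ar G. ?Q e}" unfolding qs_def using cs(2) by auto
  have inj: "inj_on (src G) (set qs)"
  proof (rule inj_onI)
    fix x y assume "x \<in> set qs" "y \<in> set qs" "src G x = src G y"
    then show "x = y" using setq outs_bdry[of x] by auto
  qed
  have "src G ` set qs = set (bdry G)"
  proof
    show "set (bdry G) \<subseteq> src G ` set qs"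
    proof
      fix v assume v: "v \<in> set (bdry G)"
      then obtain e where "e \<in> outs G v" using bdry_sub outs_nonempty by blast
      then show "v \<in> src G ` set qs" using v setq by force
    qed
  qed (auto simp: setq)
  then have len: "length qs = length (bdry G)"
    using card_image[OF inj] distinct_card[of qs] distinct_card[OF d] cs(1) by (simp add: qs_def)
  have rQ: "?Q r" using r n by simp
  have q0: "qs ! 0 = r" using rQ by (simp add: qs_def)
  have fr: "\<exists>k>0. (face_succ G ^^ k) (qs ! i) = qs ! (Suc i mod length qs) \<and>
    (\<forall>j. 0 < j \<and> j < k \<longrightarrow> \<not> ?Q ((face_succ G ^^ j) (qs ! i)))" if "i < length qs" for i
    using first_return[OF cs(3), of ?Q i] rQ that unfolding qs_def by blast
  have qin: "qs ! i \<in> Ar G \<and> ?Q (qs ! i)" if "i < length qs" for i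
    using nth_mem[OF that] setq by auto
  have "boundary_clockwise G \<longleftrightarrow> map (src G) qs = bdry G"
  proof
    assume bc: "boundary_clockwise G"
    have "src G (qs ! i) = bdry G ! i" if "i < length qs" for i
      using that
    proof (induction i)
      case 0
      then show ?case using q0 r by simp
    next
      case (Suc i)
      have i: "i < length (bdry G)" using Suc len by simp
      from bc[unfolded boundary_clockwise_def, rule_format, OF i]
      obtain a k where a: "a \<in> outs G (bdry G ! i)" and k: "k > 0"
        "src G ((face_succ G ^^ k) a) = bdry G ! (Suc i mod length (bdry G))"
        "\<forall>j. 0 < j \<and> j < k \<longrightarrow> \<not> ?Q ((face_succ G ^^ j) a)" by auto
      have aq: "a = qs ! i"
        using outs_bdry[of "qs ! i"] qin[of i] Suc a by auto
      have mod: "Suc i mod length qs = Suc i" "Suc i mod length (bdry G) = Suc i"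
        using Suc.prems len by auto
      obtain l where l: "l > 0" "(face_succ G ^^ l) (qs ! i) = qs ! Suc i"
        "\<forall>j. 0 < j \<and> j < l \<longrightarrow> \<not> ?Q ((face_succ G ^^ j) (qs ! i))"
        using fr[of i] Suc.prems mod by auto
      have "k = l"
      proof (rule first_return_unique[where Q = ?Q and g = "\<lambda>j. (face_succ G ^^ j) a"])
        show "?Q ((face_succ G ^^ k) a)" using k(2) Suc.prems len mod(2) by simp
        show "?Q ((face_succ G ^^ l) a)" using l(2) qin[OF Suc.prems] aq by simp
      qed (use k(1,3) l(1,3) aq in simp_all)
      then show ?case using k l aq mod by simp
    qed
    then show "map (src G) qs = bdry G" using len by (intro nth_equalityI) auto
  next
    assume m: "map (src G) qs = bdry G"
    have s: "src G (qs ! i) = bdry G ! i" if "i < length qs" for i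
      using that m by (metis nth_map)
    show "boundary_clockwise G"
      unfolding boundary_clockwise_def
    proof (intro allI impI)
      fix i assume "i < length (bdry G)"
      then have i: "i < length qs" using len by simp
      then have "Suc i mod length qs < length qs" by (intro mod_less_divisor) auto
      then show "\<exists>a\<in>outs G (bdry G ! i). \<exists>k>0.
        src G ((face_succ G ^^ k) a) = bdry G ! (Suc i mod length (bdry G)) \<and>
        (\<forall>j. 0 < j \<and> j < k \<longrightarrow> src G ((face_succ G ^^ j) a) \<notin> set (bdry G))"
        using fr[OF i] qin[OF i] s[OF i] s[of "Suc i mod length qs"] len
        by (intro bexI[of _ "qs ! i"]) auto
    qed
  qed
  then show ?thesis by (simp add: qs_def)
qed

lemma rot_permutesI:
  assumes fin: "fin_digraph (ugraph G)"
    and cyc: "\<And>v. v \<in> Vs G \<Longrightarrow> cyclic_on (rot G) (outs G v)"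
    and out: "\<And>e. e \<notin> Ar G \<Longrightarrow> rot G e = e"
  shows "rot G permutes Ar G"
proof (rule bij_imp_permutes)
  interpret fin_digraph "ugraph G" by (rule fin)
  have orb: "orbit (rot G) e = outs G (src G e)" if "e \<in> Ar G" for e
    by (rule orbit_cyclic_eq3[OF cyc]) (use that in auto)
  have "rot G e \<in> Ar G" if e: "e \<in> Ar G" for e
    using orbit.base[of "rot G" e] orb[OF e] by auto
  moreover have "\<exists>d\<in>Ar G. e = rot G d" if e: "e \<in> Ar G" for e
  proof -
    have "e \<in> orbit (rot G) e" using orb[OF e] e by simp
    then show ?thesis
    proof cases
      case base
      then show ?thesis using e by blast
    next
      case (step y)
      then show ?thesis using orb[OF e] by auto
    qed
  qed
  ultimately have eq: "rot G ` Ar G = Ar G" by blast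
  then show "bij_betw (rot G) (Ar G) (Ar G)"
    unfolding bij_betw_def by (auto intro: eq_card_imp_inj_on)
qed (rule out)

section \<open>The plabic graph of a plane tree\<close>

fun kids :: "plane_tree \<Rightarrow> plane_tree list" where
  "kids Leaf = []"
| "kids (Node c ts) = ts"

fun subt :: "plane_tree \<Rightarrow> nat list \<Rightarrow> plane_tree option" where
  "subt t [] = Some t"
| "subt t (i # p) = (if i < length (kids t) then subt (kids t ! i) p else None)"

definition pos :: "plane_tree \<Rightarrow> nat list set" where
  "pos t = {p. subt t p \<noteq> None}"

fun wf_tree :: "plane_tree \<Rightarrow> bool" where
  "wf_tree Leaf = True"
| "wf_tree (Node c ts) = (ts \<noteq> [] \<and> (\<forall>t\<in>set ts. wf_tree t))"

lemma subt_append: "subt t (p @ q) = (case subt t p of None \<Rightarrow> None | Some s \<Rightarrow> subt s q)"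
  by (induction t p rule: subt.induct) auto

lemma subt_snoc:
  "subt t p = Some s \<Longrightarrow> subt t (p @ [i]) = (if i < length (kids s) then Some (kids s ! i) else None)"
  by (simp add: subt_append)

lemma Nil_in_pos [simp]: "[] \<in> pos t"
  by (simp add: pos_def)

lemma pos_snocD: "p @ [i] \<in> pos t \<Longrightarrow> p \<in> pos t"
  by (auto simp: pos_def subt_append split: option.splits)

lemma pos_snoc_iff: "subt t p = Some s \<Longrightarrow> p @ [i] \<in> pos t \<longleftrightarrow> i < length (kids s)"
  by (simp add: pos_def subt_snoc)

lemma pos_rec: "pos t = insert [] (\<Union>i<length (kids t). (#) i ` pos (kids t ! i))"
proof (rule set_eqI)
  fix p show "p \<in> pos t \<longleftrightarrow> p \<in> insert [] (\<Union>i<length (kids t). (#) i ` pos (kids t ! i))"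
    by (cases p) (auto simp: pos_def)
qed

lemma finite_pos: "finite (pos t)"
proof (induction t)
  case (Node c ts)
  then show ?case by (subst pos_rec) auto
qed (subst pos_rec, simp)

lemma wf_subt: "wf_tree t \<Longrightarrow> subt t p = Some s \<Longrightarrow> wf_tree s"
proof (induction t p rule: subt.induct)
  case (2 t i p)
  then show ?case by (cases t) (auto split: if_splits)
qed simp

text \<open>The node at address \<open>p\<close> is \<open>nd p\<close>; the edge to its parent (the root vertex \<open>0\<close> if \<open>p = []\<close>)
  consists of the arcs \<open>dn p\<close> towards it and \<open>up p\<close> away from it.\<close>

definition nd :: "nat list \<Rightarrow> nat" where "nd p = Suc (list_encode p)"
definition dn :: "nat list \<Rightarrow> nat" where "dn p = 2 * list_encode p"
definition up :: "nat list \<Rightarrow> nat" where "up p = Suc (2 * list_encode p)"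
definition addr :: "nat \<Rightarrow> nat list" where "addr e = list_decode (e div 2)"
definition par :: "nat list \<Rightarrow> nat" where "par p = (if p = [] then 0 else nd (butlast p))"

lemma addr_dn [simp]: "addr (dn p) = p" and addr_up [simp]: "addr (up p) = p"
  by (simp_all add: addr_def dn_def up_def)

lemma even_dn [simp]: "even (dn p)" and odd_up [simp]: "odd (up p)"
  by (simp_all add: dn_def up_def)

lemma dn_eq [simp]: "dn p = dn q \<longleftrightarrow> p = q" and up_eq [simp]: "up p = up q \<longleftrightarrow> p = q"
  and nd_eq [simp]: "nd p = nd q \<longleftrightarrow> p = q" and nd_neq [simp]: "nd p \<noteq> 0" "0 \<noteq> nd p"
  using list_encode_eq by (simp_all add: dn_def up_def nd_def)

lemma dn_up_neq [simp]: "dn p \<noteq> up q" "up q \<noteq> dn p"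
  by (metis even_dn odd_up)+

lemma dn_addr: "even e \<Longrightarrow> dn (addr e) = e" and up_addr: "odd e \<Longrightarrow> up (addr e) = e"
  by (simp_all add: addr_def dn_def up_def)

lemma par_simps [simp]: "par [] = 0" "par (p @ [i]) = nd p"
  by (simp_all add: par_def)

text \<open>The rotation in \<open>graph_of\<close>: \<open>sib\<close> follows \<open>dn p\<close>
  around the parent, and \<open>fst_kid\<close> follows \<open>up p\<close> around the node. In the
  face walk they follow \<open>up p\<close> and \<open>dn p\<close> respectively
  (\<open>fs_up\<close>, \<open>fs_dn\<close>). At the root vertex the only arc is its own
  successor.\<close>

definition sib :: "plane_tree \<Rightarrow> nat list \<Rightarrow> nat" where
  "sib t p = (if p = [] then dn []
     else if butlast p @ [Suc (last p)] \<in> pos t then dn (butlast p @ [Suc (last p)])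
     else up (butlast p))"

definition fst_kid :: "plane_tree \<Rightarrow> nat list \<Rightarrow> nat" where
  "fst_kid t p = (if p @ [0] \<in> pos t then dn (p @ [0]) else up p)"

text \<open>The depth-first tour, which will be the contour. In \<open>walks\<close>, the number
  \<open>i\<close> is the index of the next tree among the children of the node at
  \<open>p\<close>.\<close>

fun walk :: "plane_tree \<Rightarrow> nat list \<Rightarrow> nat list"
  and walks :: "plane_tree list \<Rightarrow> nat list \<Rightarrow> nat \<Rightarrow> nat list" where
  "walk Leaf p = [dn p, up p]"
| "walk (Node c ts) p = dn p # walks ts p 0 @ [up p]"
| "walks [] p i = []"
| "walks (t # ts) p i = walk t (p @ [i]) @ walks ts p (Suc i)"

text \<open>The arcs whose tail is a boundary vertex: the one leaving the root vertex and those
  leaving the leaves (\<open>src_bdry\<close>).\<close>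

definition bd_arc :: "plane_tree \<Rightarrow> nat \<Rightarrow> bool" where
  "bd_arc t e \<longleftrightarrow> e = dn [] \<or> odd e \<and> subt t (addr e) = Some Leaf"

definition graph_src :: "nat \<Rightarrow> nat" where
  "graph_src e = (if even e then par (addr e) else nd (addr e))"

lemma graph_src_simps [simp]: "graph_src (dn p) = par p" "graph_src (up p) = nd p"
  by (simp_all add: graph_src_def)

text \<open>Vertex \<open>0\<close> is the boundary vertex with label 1, and the leaves are labelled
  in the order of the tour. The tests on \<open>addr e\<close> make \<open>rev_arc\<close> and
  \<open>rot\<close> the identity off the arcs, as \<open>bidirected_digraph\<close> and
  \<open>permutes\<close> demand.\<close>

definition graph_of :: "plane_tree \<Rightarrow> plabic" where
  "graph_of t =
     \<lparr>ugraph = \<lparr>verts = insert 0 (nd ` pos t), arcs = dn ` pos t \<union> up ` pos t,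
        tail = graph_src, head = (\<lambda>e. if even e then nd (addr e) else par (addr e))\<rparr>,
      rev_arc = (\<lambda>e. if addr e \<notin> pos t then e else if even e then up (addr e) else dn (addr e)),
      rot = (\<lambda>e. if addr e \<notin> pos t then e else if even e then sib t (addr e) else fst_kid t (addr e)),
      black = nd ` {p. \<exists>ts. subt t p = Some (Node True ts)},
      bdry = map graph_src (filter (bd_arc t) (walk t []))\<rparr>"

lemma Vs_graph [simp]: "Vs (graph_of t) = insert 0 (nd ` pos t)"
  and Ar_graph: "Ar (graph_of t) = dn ` pos t \<union> up ` pos t"
  and src_dn [simp]: "src (graph_of t) (dn p) = par p"
  and src_up [simp]: "src (graph_of t) (up p) = nd p"
  and tgt_dn [simp]: "tgt (graph_of t) (dn p) = nd p"
  and tgt_up [simp]: "tgt (graph_of t) (up p) = par p"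
  by (simp_all add: graph_of_def graph_src_def)

lemma rev_dn [simp]: "p \<in> pos t \<Longrightarrow> rev_arc (graph_of t) (dn p) = up p"
  and rev_up [simp]: "p \<in> pos t \<Longrightarrow> rev_arc (graph_of t) (up p) = dn p"
  and rot_dn: "p \<in> pos t \<Longrightarrow> rot (graph_of t) (dn p) = sib t p"
  and rot_up: "p \<in> pos t \<Longrightarrow> rot (graph_of t) (up p) = fst_kid t p"
  and black_graph: "black (graph_of t) = nd ` {p. \<exists>ts. subt t p = Some (Node True ts)}"
  and bdry_graph: "bdry (graph_of t) = map graph_src (filter (bd_arc t) (walk t []))"
  by (simp_all add: graph_of_def)

lemma Ar_graph_iff: "e \<in> Ar (graph_of t) \<longleftrightarrow> addr e \<in> pos t"
proof
  assume "addr e \<in> pos t"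
  then show "e \<in> Ar (graph_of t)"
    unfolding Ar_graph using dn_addr[of e] up_addr[of e] by (cases "even e") (metis UnI1 imageI, metis UnI2 imageI)
qed (auto simp: Ar_graph)

lemma Ar_graph_cases:
  assumes "e \<in> Ar (graph_of t)"
  obtains p where "e = dn p" "p \<in> pos t" | p where "e = up p" "p \<in> pos t"
  using assms unfolding Ar_graph by auto

lemma set_walk:
  "set (walk s p) = {e. \<exists>q\<in>pos s. e = dn (p @ q) \<or> e = up (p @ q)}"
  "set (walks ss p i) = {e. \<exists>j<length ss. \<exists>q\<in>pos (ss ! j). e = dn (p @ (i + j) # q) \<or> e = up (p @ (i + j) # q)}"
proof (induction s p and ss p i rule: walk_walks.induct)
  case (1 p)
  then show ?case by (subst pos_rec) auto
next
  case (2 c ts p)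
  show ?case unfolding walk.simps by (subst pos_rec) (auto simp: 2)
next
  case (4 t ts p i)
  show ?case
  proof (rule set_eqI)
    fix e
    have "(\<exists>j<Suc (length ts). P j) \<longleftrightarrow> P 0 \<or> (\<exists>j<length ts. P (Suc j))" for P
      by (metis Suc_less_eq less_Suc_eq_0_disj)
    then show "e \<in> set (walks (t # ts) p i) \<longleftrightarrow> e \<in> {e. \<exists>j<length (t # ts). \<exists>q\<in>pos ((t # ts) ! j).
      e = dn (p @ (i + j) # q) \<or> e = up (p @ (i + j) # q)}"
      using 4 by simp
  qed
qed auto

lemma distinct_walk: "distinct (walk s p)" "distinct (walks ss p i)"
proof (induction s p and ss p i rule: walk_walks.induct)
  case (4 t ts p i)
  then show ?case by (auto simp: set_walk)
qed (auto simp: set_walk)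

lemma fs_dn: "p \<in> pos t \<Longrightarrow> face_succ (graph_of t) (dn p) = fst_kid t p"
  and fs_up: "p \<in> pos t \<Longrightarrow> face_succ (graph_of t) (up p) = sib t p"
  by (simp_all add: face_succ_def rot_dn rot_up)

lemma hd_walk: "hd (walk s p) = dn p" "walk s p \<noteq> []"
  by (cases s; simp)+

text \<open>The tour of a subtree is followed by \<open>sib\<close>, which has to be the start of
  the remaining tour. The second claim therefore also carries the head of that remainder through the
  induction.\<close>

lemma face_walk:
  "subt t p = Some s \<Longrightarrow> map (face_succ (graph_of t)) (walk s p) = tl (walk s p) @ [sib t p]"
  "subt t p = Some s0 \<Longrightarrow> ss = drop i (kids s0) \<Longrightarrow>
     map (face_succ (graph_of t)) (walks ss p i) = tl (walks ss p i @ [up p]) \<and>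
     hd (walks ss p i @ [up p]) = (if p @ [i] \<in> pos t then dn (p @ [i]) else up p)"
proof (induction s p and ss p i arbitrary: and s0 rule: walk_walks.induct)
  case (1 p)
  then have "p \<in> pos t" "p @ [0] \<notin> pos t" by (simp_all add: pos_snoc_iff) (simp add: pos_def)
  then show ?case by (simp add: fs_dn fs_up fst_kid_def)
next
  case (2 c ts p)
  have W: "map (face_succ (graph_of t)) (walks ts p 0) = tl (walks ts p 0 @ [up p])"
    "hd (walks ts p 0 @ [up p]) = (if p @ [0] \<in> pos t then dn (p @ [0]) else up p)"
    using 2(1)[OF 2(2)] by auto
  have p: "p \<in> pos t" using 2 by (simp add: pos_def)
  have "map (face_succ (graph_of t)) (walk (Node c ts) p) =
    hd (walks ts p 0 @ [up p]) # tl (walks ts p 0 @ [up p]) @ [sib t p]"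
    using W p by (simp add: fs_dn fs_up fst_kid_def)
  also have "\<dots> = tl (walk (Node c ts) p) @ [sib t p]"
    by (simp del: hd_append2)
  finally show ?case .
next
  case (3 p i)
  then show ?case by (simp add: pos_snoc_iff)
next
  case (4 u ts p i)
  have len: "i < length (kids s0)" using 4(4) by (metis drop_all list.distinct(1) not_less)
  have u: "u = kids s0 ! i" "ts = drop (Suc i) (kids s0)"
    using 4(4) len by (simp_all flip: Cons_nth_drop_Suc)
  have "subt t (p @ [i]) = Some u" using subt_snoc[OF 4(3)] len u by simp
  note A = 4(1)[OF this] and B = 4(2)[OF 4(3) u(2)]
  have pi: "p @ [i] \<in> pos t" using pos_snoc_iff[OF 4(3)] len by simp
  have "sib t (p @ [i]) = hd (walks ts p (Suc i) @ [up p])"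
    using B by (simp add: sib_def)
  then have "map (face_succ (graph_of t)) (walks (u # ts) p i) =
    tl (walk u (p @ [i])) @ (hd (walks ts p (Suc i) @ [up p]) # tl (walks ts p (Suc i) @ [up p]))"
    using A B by simp
  also have "\<dots> = tl (walk u (p @ [i])) @ walks ts p (Suc i) @ [up p]" by simp
  also have "\<dots> = tl (walks (u # ts) p i @ [up p])" using hd_walk(2)[of u "p @ [i]"] by simp
  finally show ?case using hd_walk[of u "p @ [i]"] pi by simp
qed

lemma walk_root: "walk t [] = dn [] # tl (walk t [])"
  by (cases t) simp_all

lemma contour_graph: "contour (graph_of t) (dn []) (tl (walk t []))"
proof -
  have "set (walk t []) = Ar (graph_of t)"
    unfolding set_walk Ar_graph by auto
  then show ?thesis
    unfolding contour_def walk_root[symmetric]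
    using face_walk(1)[of t "[]" t] distinct_walk(1)[of t "[]"] by (simp add: sib_def)
qed

lemma outs_graph_0: "outs (graph_of t) 0 = {dn []}"
  by (auto simp: Ar_graph par_def split: if_splits)

lemma outs_graph_nd:
  assumes "subt t p = Some s"
  shows "outs (graph_of t) (nd p) = set (up p # map (\<lambda>i. dn (p @ [i])) [0..<length (kids s)])"
proof -
  have "p \<in> pos t" using assms by (simp add: pos_def)
  then have "e \<in> outs (graph_of t) (nd p) \<longleftrightarrow> e = up p \<or> (\<exists>i. e = dn (p @ [i]) \<and> p @ [i] \<in> pos t)" for e
    by (auto simp: Ar_graph par_def split: if_splits) (metis append_butlast_last_id)+
  then show ?thesis by (auto simp: pos_snoc_iff[OF assms] simp del: in_out_arcs_conv)
qed

lemma star_graph: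
  assumes "subt t p = Some s"
  shows "map (rot (graph_of t)) (up p # map (\<lambda>i. dn (p @ [i])) [0..<length (kids s)]) =
     map (\<lambda>i. dn (p @ [i])) [0..<length (kids s)] @ [up p]"
proof (cases "length (kids s)")
  case 0
  have "p \<in> pos t" using assms by (simp add: pos_def)
  then show ?thesis using 0 pos_snoc_iff[OF assms] by (simp add: rot_up fst_kid_def)
next
  case (Suc n)
  have p: "p \<in> pos t" using assms by (simp add: pos_def)
  have r: "rot (graph_of t) (dn (p @ [i])) = (if Suc i < Suc n then dn (p @ [Suc i]) else up p)" if "i < Suc n" for i
    using that pos_snoc_iff[OF assms] Suc by (simp add: rot_dn sib_def)
  have 1: "map (rot (graph_of t)) (map (\<lambda>i. dn (p @ [i])) [0..<Suc n]) =
    map (\<lambda>i. dn (p @ [i])) (map Suc [0..<n]) @ [up p]"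
    using r by simp
  have 2: "rot (graph_of t) (up p) = dn (p @ [0])"
    using p pos_snoc_iff[OF assms] Suc by (simp add: rot_up fst_kid_def)
  have "[0..<Suc n] = 0 # map Suc [0..<n]" by (simp add: map_Suc_upt upt_conv_Cons)
  then have "map (\<lambda>i. dn (p @ [i])) [0..<Suc n] = dn (p @ [0]) # map (\<lambda>i. dn (p @ [i])) (map Suc [0..<n])"
    by simp
  then show ?thesis unfolding Suc list.map(2) 1 2 by simp
qed

lemma set_bdry_graph: "set (bdry (graph_of t)) = insert 0 (nd ` {p. subt t p = Some Leaf})"
proof -
  have "{e \<in> Ar (graph_of t). bd_arc t e} = insert (dn []) (up ` {p. subt t p = Some Leaf})"
    by (auto simp: Ar_graph bd_arc_def pos_def)
  moreover have "set (walk t []) = Ar (graph_of t)"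
    using contour_graph[of t] unfolding contour_def walk_root[symmetric] by simp
  then have "set (bdry (graph_of t)) = graph_src ` {e \<in> Ar (graph_of t). bd_arc t e}"
    unfolding bdry_graph by auto
  moreover have "graph_src ` up ` P = nd ` P" for P by (simp add: image_image)
  ultimately show ?thesis by simp
qed

lemma src_bdry:
  assumes e: "e \<in> Ar (graph_of t)"
  shows "src (graph_of t) e \<in> set (bdry (graph_of t)) \<longleftrightarrow> bd_arc t e"
  using e
proof (cases rule: Ar_graph_cases)
  case (1 p)
  have *: "nd q \<noteq> par p" if q: "subt t q = Some Leaf" for q
  proof
    assume "nd q = par p"
    then have "p \<noteq> []" "q = butlast p" by (auto simp: par_def split: if_splits)
    then have "p = q @ [last p]" by simp
    then show False using 1(2) pos_snoc_iff[OF q, of "last p"] by simp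
  qed
  have "par p = 0 \<longleftrightarrow> p = []" by (simp add: par_def)
  moreover have "par p \<notin> nd ` {p. subt t p = Some Leaf}" using * by force
  ultimately show ?thesis using 1(1) by (simp add: set_bdry_graph bd_arc_def)
next
  case (2 p)
  then show ?thesis by (auto simp: set_bdry_graph bd_arc_def)
qed

lemma plabic_graph_graph_of:
  assumes wf: "wf_tree t"
  shows "plabic_graph (graph_of t)" "card (Vs (graph_of t)) = card (Ar (graph_of t)) div 2 + 1"
proof -
  let ?G = "graph_of t"
  have wfd: "wf_digraph (ugraph ?G)"
  proof
    fix e assume "e \<in> Ar ?G"
    then show "src ?G e \<in> Vs ?G" "tgt ?G e \<in> Vs ?G"
      by (cases rule: Ar_graph_cases; auto simp: par_def; metis append_butlast_last_id imageI pos_snocD)+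
  qed
  interpret wf_digraph "ugraph ?G" by (rule wfd)
  have fin: "fin_digraph (ugraph ?G)"
    by unfold_locales (simp_all add: Ar_graph finite_pos)
  have bid: "bidirected_digraph (ugraph ?G) (rev_arc ?G)"
  proof (rule bidirected_digraphI)
    fix e assume "e \<notin> Ar ?G"
    then have "addr e \<notin> pos t" by (simp add: Ar_graph_iff)
    then show "rev_arc ?G e = e" by (simp add: graph_of_def)
  next
    fix e assume e: "e \<in> Ar ?G"
    then show "rev_arc ?G e \<noteq> e" by (cases rule: Ar_graph_cases) auto
    from e show "rev_arc ?G (rev_arc ?G e) = e" by (cases rule: Ar_graph_cases) auto
    from e show "src ?G (rev_arc ?G e) = tgt ?G e" by (cases rule: Ar_graph_cases) auto
  qed
  interpret bidirected_digraph "ugraph ?G" "rev_arc ?G" by (rule bid)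
  have cyc: "cyclic_on (rot ?G) (outs ?G v)" if v: "v \<in> Vs ?G" for v
  proof (cases "v = 0")
    case True
    have "rot ?G (dn []) = dn []" by (simp add: rot_dn sib_def)
    then show ?thesis unfolding True outs_graph_0
      using cyclic_on_list[of "rot ?G" "dn []" "[]"] by simp
  next
    case False
    then obtain p s where "v = nd p" and s: "subt t p = Some s" using v by (auto simp: pos_def)
    then show ?thesis using cyclic_on_list[OF star_graph[OF s]] outs_graph_nd[OF s] by simp
  qed
  have perm: "rot ?G permutes Ar ?G"
  proof (rule rot_permutesI[OF fin cyc])
    fix e assume "e \<notin> Ar ?G"
    then have "addr e \<notin> pos t" by (simp add: Ar_graph_iff)
    then show "rot ?G e = e" by (simp add: graph_of_def)
  qed
  have "card (Ar ?G) = 2 * card (pos t)"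
    unfolding Ar_graph using finite_pos[of t]
    by (subst card_Un_disjoint) (auto simp: card_image inj_on_def)
  moreover have "card (Vs ?G) = card (pos t) + 1"
    using finite_pos[of t] by (subst Vs_graph, subst card_insert_disjoint) (auto simp: card_image inj_on_def)
  ultimately show count: "card (Vs ?G) = card (Ar ?G) div 2 + 1" by simp
  have planar: "planar_map ?G"
    by (rule planar_mapI[OF fin bid perm cyc contour_graph count])
  have deg: "deg ?G (nd p) = Suc (length (kids s))" if "subt t p = Some s" for p s
    unfolding deg_def out_degree_def outs_graph_nd[OF that]
    by (subst distinct_card) (auto simp: distinct_map inj_on_def)
  have pm: "plabic_map ?G"
  proof
    fix v assume "v \<in> set (bdry ?G)"
    then show "deg ?G v = 1"
      unfolding set_bdry_graph using deg outs_graph_0[of t]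
      by (auto simp: deg_def out_degree_def)
  next
    fix v assume "v \<in> internal ?G"
    then obtain p s where "v = nd p" and s: "subt t p = Some s" "s \<noteq> Leaf"
      by (auto simp: internal_def set_bdry_graph pos_def)
    moreover have "kids s \<noteq> []" using wf_subt[OF wf s(1)] s(2) by (cases s) auto
    ultimately show "deg ?G v \<noteq> 1" using deg by auto
  next
    show "Digraph_Component.connected (ugraph ?G)" using planar by (simp add: planar_map_def)
    show "set (bdry ?G) \<subseteq> Vs ?G" by (auto simp: set_bdry_graph pos_def)
    show "black ?G \<subseteq> internal ?G" by (auto simp: black_graph internal_def set_bdry_graph pos_def)
    show "finite (Vs ?G)" "finite (Ar ?G)" using fin by (auto simp: fin_digraph_def fin_digraph_axioms_def)
  qed (use perm cyc in auto)
  interpret plabic_map ?G by (rule pm)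
  have arcsw: "set (walk t []) = Ar ?G"
    using contour_graph[of t] unfolding contour_def walk_root[symmetric] by simp
  have src: "src ?G = graph_src" by (simp add: graph_of_def)
  have "distinct (bdry ?G)"
    unfolding bdry_graph distinct_map
  proof
    show "distinct (filter (bd_arc t) (walk t []))" by (simp add: distinct_walk)
    show "inj_on graph_src (set (filter (bd_arc t) (walk t [])))"
    proof (rule inj_onI)
      fix x y assume xy: "x \<in> set (filter (bd_arc t) (walk t []))" "y \<in> set (filter (bd_arc t) (walk t []))"
        and e: "graph_src x = graph_src y"
      have "outs ?G (src ?G x) = {x}" using outs_bdry[of x] xy src_bdry arcsw by auto
      moreover have "y \<in> outs ?G (src ?G x)" using xy e arcsw by (simp add: src)
      ultimately show "x = y" by simp
    qed
  qed
  moreover have "boundary_clockwise ?G"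
  proof -
    have 0: "bdry ?G = 0 # tl (bdry ?G)"
      unfolding bdry_graph by (subst (1 2) walk_root) (simp add: bd_arc_def graph_src_def)
    have f: "filter (\<lambda>e. src ?G e \<in> set (bdry ?G)) (walk t []) = filter (bd_arc t) (walk t [])"
      by (rule filter_cong) (use src_bdry arcsw in auto)
    show ?thesis
      using boundary_clockwise_iff[OF contour_graph _ _ calculation] 0 f
      by (metis walk_root bdry_graph src src_dn par_simps(1) list.distinct(1) nth_Cons_0)
  qed
  ultimately show "plabic_graph ?G"
    unfolding plabic_graph_def using planar bdry_sub bdry_deg internal_deg black_sub by auto
qed

lemma rep_graph_of:
  "subt t p = Some s \<Longrightarrow> rep (graph_of t) (dn p) s"
proof (induction s arbitrary: p)
  case Leaf
  then show ?case by (auto intro!: rep_Leaf simp: set_bdry_graph Ar_graph pos_def)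
next
  case (Node c ts)
  let ?G = "graph_of t" and ?cs = "map (\<lambda>i. dn (p @ [i])) [0..<length ts]"
  have p: "p \<in> pos t" using Node by (simp add: pos_def)
  have "rep ?G (dn p) (Node (tgt ?G (dn p) \<in> black ?G) ts)"
  proof (rule rep_Node)
    show "tgt ?G (dn p) \<in> internal ?G" using p Node by (auto simp: internal_def set_bdry_graph)
    show "distinct (rev_arc ?G (dn p) # ?cs)" using p by (auto simp: distinct_map inj_on_def)
    show "set (rev_arc ?G (dn p) # ?cs) = outs ?G (tgt ?G (dn p))"
      using outs_graph_nd[OF Node.prems] p by simp
    show "map (rot ?G) (rev_arc ?G (dn p) # ?cs) = ?cs @ [rev_arc ?G (dn p)]"
      using star_graph[OF Node.prems] p by simp
    show "list_all2 (rep ?G) ?cs ts"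
      using Node.IH subt_snoc[OF Node.prems] by (auto simp: list_all2_conv_all_nth)
  qed (use p in \<open>simp add: Ar_graph\<close>)
  moreover have "tgt ?G (dn p) \<in> black ?G \<longleftrightarrow> c" using Node.prems by (auto simp: black_graph)
  ultimately show ?case by simp
qed

section \<open>A plabic tree is determined by its plane tree\<close>

text \<open>Counting starts after the arc that leads back, so \<open>rot\<close> acts as successor
  on indices, and the index one past the last child gives \<open>rev_arc G x\<close> again.\<close>

definition kid :: "plabic \<Rightarrow> nat \<Rightarrow> nat \<Rightarrow> nat" where
  "kid G x i = (rot G ^^ Suc i) (rev_arc G x)"

fun arc_at :: "plabic \<Rightarrow> nat \<Rightarrow> nat list \<Rightarrow> nat" where
  "arc_at G x [] = x"
| "arc_at G x (i # p) = arc_at G (kid G x i) p"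

lemma at_snoc: "arc_at G x (p @ [i]) = kid G (arc_at G x p) i"
  by (induction G x p rule: arc_at.induct) auto

lemma rot_kid: "rot G (kid G x i) = kid G x (Suc i)"
  by (simp add: kid_def)

lemma rep_node:
  assumes "rep G x (Node c ts)"
  shows "x \<in> Ar G" "tgt G x \<in> internal G" "c \<longleftrightarrow> tgt G x \<in> black G"
    "outs G (tgt G x) = insert (rev_arc G x) (kid G x ` {..<length ts})"
    "inj_on (kid G x) {..<length ts}" "rev_arc G x \<notin> kid G x ` {..<length ts}"
    "kid G x (length ts) = rev_arc G x"
    "i < length ts \<Longrightarrow> rep G (kid G x i) (ts ! i)"
proof -
  from assms obtain cs where x: "x \<in> Ar G" "tgt G x \<in> internal G" "c \<longleftrightarrow> tgt G x \<in> black G"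
    and cs: "distinct (rev_arc G x # cs)" "set (rev_arc G x # cs) = outs G (tgt G x)"
    "map (rot G) (rev_arc G x # cs) = cs @ [rev_arc G x]" "list_all2 (rep G) cs ts"
    by (cases rule: rep.cases) blast
  have len: "length cs = length ts" using cs(4) by (rule list_all2_lengthD)
  have k: "kid G x i = cs ! i" if "i < length ts" for i
    using funpow_chain[OF cs(3), of "Suc i"] that len by (simp add: kid_def)
  have "kid G x ` {..<length ts} = (!) cs ` {..<length ts}" using k by auto
  also have "\<dots> = set cs" using len by (auto simp: set_conv_nth)
  finally have im: "kid G x ` {..<length ts} = set cs" .
  show "x \<in> Ar G" "tgt G x \<in> internal G" "c \<longleftrightarrow> tgt G x \<in> black G" by fact+
  show "outs G (tgt G x) = insert (rev_arc G x) (kid G x ` {..<length ts})"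
    "rev_arc G x \<notin> kid G x ` {..<length ts}"
    using cs(1,2) im by auto
  show "inj_on (kid G x) {..<length ts}"
    using cs(1) len k by (auto simp: inj_on_def nth_eq_iff_index_eq)
  show "kid G x (length ts) = rev_arc G x"
    using funpow_cycle[OF cs(3)] len by (simp add: kid_def)
  show "i < length ts \<Longrightarrow> rep G (kid G x i) (ts ! i)"
    using list_all2_nthD[OF cs(4), of i] len k by simp
qed

lemma rep_leaf: "rep G x Leaf \<Longrightarrow> tgt G x \<in> set (bdry G)"
  by (cases rule: rep.cases) auto

context plabic_map
begin

text \<open>A boundary vertex has no arc but the one leading back, so the description of nodes
  extends to leaves with an empty list of children.\<close>

lemma rep_kids:
  assumes "rep G x t"
  shows "outs G (tgt G x) = insert (rev_arc G x) (kid G x ` {..<length (kids t)})"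
    "inj_on (kid G x) {..<length (kids t)}" "rev_arc G x \<notin> kid G x ` {..<length (kids t)}"
    "kid G x (length (kids t)) = rev_arc G x"
    "i < length (kids t) \<Longrightarrow> rep G (kid G x i) (kids t ! i)"
proof -
  have x: "x \<in> Ar G" using assms by (rule rep_in)
  show "outs G (tgt G x) = insert (rev_arc G x) (kid G x ` {..<length (kids t)})"
    "inj_on (kid G x) {..<length (kids t)}" "rev_arc G x \<notin> kid G x ` {..<length (kids t)}"
    "kid G x (length (kids t)) = rev_arc G x"
    "i < length (kids t) \<Longrightarrow> rep G (kid G x i) (kids t ! i)"
  proof -
    show "outs G (tgt G x) = insert (rev_arc G x) (kid G x ` {..<length (kids t)})"
    proof (cases t)
      case Leaf
      then show ?thesis using outs_bdry[of "rev_arc G x"] rep_leaf assms x by auto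
    next
      case (Node c ts)
      then show ?thesis using rep_node(4)[of G x c ts] assms by simp
    qed
    then have leaf: "outs G (tgt G x) = {rev_arc G x}" if "t = Leaf" using that by simp
    have "rot G (rev_arc G x) \<in> outs G (tgt G x)"
      using x by (simp add: rot_in src_rot)
    then have "rot G (rev_arc G x) = rev_arc G x" if "t = Leaf"
      using leaf[OF that] by blast
    then show "kid G x (length (kids t)) = rev_arc G x"
      using rep_node(7)[of G x] assms by (cases t) (simp_all add: kid_def)
    show "inj_on (kid G x) {..<length (kids t)}"
      using rep_node(5)[of G x] assms by (cases t) simp_all
    show "rev_arc G x \<notin> kid G x ` {..<length (kids t)}"
      using rep_node(6)[of G x] assms by (cases t) simp_all
    show "i < length (kids t) \<Longrightarrow> rep G (kid G x i) (kids t ! i)"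
      using rep_node(8)[of G x] assms by (cases t) simp_all
  qed
qed

lemma rep_tgt:
  assumes "rep G x t"
  shows "tgt G x \<in> set (bdry G) \<longleftrightarrow> t = Leaf" "tgt G x \<in> black G \<longleftrightarrow> (\<exists>ts. t = Node True ts)"
proof -
  have "(tgt G x \<in> set (bdry G) \<longleftrightarrow> t = Leaf) \<and> (tgt G x \<in> black G \<longleftrightarrow> (\<exists>ts. t = Node True ts))"
  proof (cases t)
    case Leaf
    then show ?thesis using rep_leaf assms black_sub by (auto simp: internal_def)
  next
    case (Node c ts)
    then show ?thesis using rep_node(2,3)[of G x c ts] assms by (auto simp: internal_def)
  qed
  then show "tgt G x \<in> set (bdry G) \<longleftrightarrow> t = Leaf" "tgt G x \<in> black G \<longleftrightarrow> (\<exists>ts. t = Node True ts)"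
    by blast+
qed

lemma rep_wf: "rep G x t \<Longrightarrow> wf_tree t"
proof (induction t arbitrary: x)
  case (Node c ts)
  note n = rep_node[OF Node.prems]
  have "ts \<noteq> []"
  proof
    assume "ts = []"
    then have "deg G (tgt G x) = 1" using n(4) by (simp add: deg_def out_degree_def)
    then show False using internal_deg n(2) by blast
  qed
  moreover have "wf_tree t" if "t \<in> set ts" for t
    using that Node.IH n(8) by (auto simp: in_set_conv_nth)
  ultimately show ?case by simp
qed simp

lemma rep_at: "rep G x t \<Longrightarrow> subt t p = Some s \<Longrightarrow> rep G (arc_at G x p) s"
  by (induction t p arbitrary: x rule: subt.induct) (auto split: if_splits dest: rep_kids(5))

end

context treelike_map
begin

lemma beyond_at:
  "rep G x t \<Longrightarrow> p \<in> pos t \<Longrightarrow> beyond G (arc_at G x p) \<subseteq> beyond G x \<and> (p \<noteq> [] \<longrightarrow> tgt G x \<notin> beyond G (arc_at G x p))"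
proof (induction p arbitrary: x t)
  case (Cons i p)
  have i: "i < length (kids t)" "p \<in> pos (kids t ! i)"
    using Cons.prems by (auto simp: pos_def split: if_splits)
  let ?y = "kid G x i"
  have r: "rep G ?y (kids t ! i)" using rep_kids(5)[OF Cons.prems(1) i(1)] .
  have x: "x \<in> Ar G" using Cons.prems(1) by (rule rep_in)
  have y: "?y \<in> outs G (tgt G x)" "?y \<noteq> rev_arc G x"
    using rep_kids(1)[OF Cons.prems(1)] rep_kids(3)[OF Cons.prems(1)] i(1) by (blast, force)
  show ?case
    using Cons.IH[OF r i(2)] beyond_child_sub[OF x y] src_notin[of ?y] y by auto
qed simp

text \<open>Two addresses that part at some index lie beyond different children of one vertex, and
  those sets are disjoint.\<close>

lemma inj_at: "rep G x t \<Longrightarrow> inj_on (\<lambda>p. tgt G (arc_at G x p)) (pos t)"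
proof (induction t arbitrary: x)
  case Leaf
  then show ?case by (subst pos_rec) simp
next
  case (Node c ts)
  note k = rep_kids[OF Node.prems, simplified]
  have *: "p = q" if p: "p \<in> pos (Node c ts)" and q: "q \<in> pos (Node c ts)"
    and e: "tgt G (arc_at G x p) = tgt G (arc_at G x q)" and "p \<noteq> []" "q \<noteq> []" for p q
  proof -
    obtain i p' j q' where pq: "p = i # p'" "q = j # q'"
      using \<open>p \<noteq> []\<close> \<open>q \<noteq> []\<close> by (cases p; cases q) auto
    then have i: "i < length ts" "p' \<in> pos (ts ! i)" and j: "j < length ts" "q' \<in> pos (ts ! j)"
      using p q by (auto simp: pos_def split: if_splits)
    have ij: "i = j"
    proof (rule ccontr)
      assume "i \<noteq> j"
      then have "kid G x i \<noteq> kid G x j" using k(2) i(1) j(1) by (auto simp: inj_on_def)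
      moreover have "kid G x i \<in> outs G (tgt G x)" "kid G x j \<in> outs G (tgt G x)" using k(1) i j by auto
      ultimately have "beyond G (kid G x i) \<inter> beyond G (kid G x j) = {}"
        using children_disj by auto
      then show False
        using beyond_at[OF k(5)[OF i(1)] i(2)] beyond_at[OF k(5)[OF j(1)] j(2)] e
          tgt_in_beyond[of G "arc_at G x p"] tgt_in_beyond[of G "arc_at G x q"] pq by auto
    qed
    have "inj_on (\<lambda>p. tgt G (arc_at G (kid G x i) p)) (pos (ts ! i))"
      using Node.IH[OF nth_mem[OF i(1)] k(5)[OF i(1)]] .
    then show ?thesis using i j e pq ij by (auto simp: inj_on_def)
  qed
  have nil: "p = []" if "p \<in> pos (Node c ts)" "tgt G (arc_at G x p) = tgt G x" for p
    using beyond_at[OF Node.prems that(1)] that(2) tgt_in_beyond[of G "arc_at G x p"] by auto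
  show ?case
  proof (rule inj_onI)
    fix p q assume "p \<in> pos (Node c ts)" "q \<in> pos (Node c ts)" "tgt G (arc_at G x p) = tgt G (arc_at G x q)"
    then show "p = q" using *[of p q] nil[of p] nil[of q] by (cases "p = []"; cases "q = []") auto
  qed
qed

end

section \<open>The isomorphism from the graph of the plane tree\<close>

definition vmap :: "plabic \<Rightarrow> nat \<Rightarrow> nat \<Rightarrow> nat" where
  "vmap G r v = (if v = 0 then src G r else tgt G (arc_at G r (list_decode (v - 1))))"

definition amap :: "plabic \<Rightarrow> nat \<Rightarrow> nat \<Rightarrow> nat" where
  "amap G r e = (if even e then arc_at G r (addr e) else rev_arc G (arc_at G r (addr e)))"

lemma vmap_simps [simp]: "vmap G r 0 = src G r" "vmap G r (nd p) = tgt G (arc_at G r p)"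
  by (simp_all add: vmap_def nd_def)

lemma amap_simps [simp]: "amap G r (dn p) = arc_at G r p" "amap G r (up p) = rev_arc G (arc_at G r p)"
  by (simp_all add: amap_def)

locale rooted_tree = treelike_map +
  fixes r :: nat and t :: plane_tree
  assumes root: "r \<in> Ar G" "src G r \<in> set (bdry G)" and rep: "rep G r t"
begin

abbreviation "T \<equiv> graph_of t"

lemma posE:
  assumes "p \<in> pos t"
  obtains s where "subt t p = Some s" "rep G (arc_at G r p) s"
  using assms rep_at[OF rep] by (auto simp: pos_def)

lemma at_in: "p \<in> pos t \<Longrightarrow> arc_at G r p \<in> Ar G"
  by (erule posE) (rule rep_in)

lemma pos_snocE:
  assumes "p \<in> pos t" "p \<noteq> []"
  obtains q i s where "p = q @ [i]" "subt t q = Some s" "rep G (arc_at G r q) s" "i < length (kids s)"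
proof -
  obtain q i where p: "p = q @ [i]" using assms(2) by (metis append_butlast_last_id)
  then obtain s where "subt t q = Some s" "rep G (arc_at G r q) s" using pos_snocD assms posE by metis
  then show ?thesis using that p pos_snoc_iff assms(1) by blast
qed

lemma vmap_par: "p \<in> pos t \<Longrightarrow> vmap G r (par p) = src G (arc_at G r p)"
proof (cases "p = []")
  case False
  assume "p \<in> pos t"
  from pos_snocE[OF this False] obtain q i s where q: "p = q @ [i]" "subt t q = Some s"
    "rep G (arc_at G r q) s" "i < length (kids s)" .
  have "kid G (arc_at G r q) i \<in> outs G (tgt G (arc_at G r q))"
    using rep_kids(1)[OF q(3)] q(4) by auto
  then show ?thesis using q(1) by (simp add: at_snoc)
qed simp

lemma src_root_notin: "p \<in> pos t \<Longrightarrow> tgt G (arc_at G r p) \<noteq> src G r"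
  using beyond_at[OF rep, of p] src_notin[OF root(1)] tgt_in_beyond[of G "arc_at G r p"] by auto

lemma vmap_inj: "inj_on (vmap G r) (Vs T)"
  unfolding Vs_graph inj_on_insert
proof
  show "inj_on (vmap G r) (nd ` pos t)"
    using inj_at[OF rep] by (auto simp: inj_on_def)
  show "vmap G r 0 \<notin> vmap G r ` (nd ` pos t - {0})"
  proof
    assume "vmap G r 0 \<in> vmap G r ` (nd ` pos t - {0})"
    then obtain p where "p \<in> pos t" "vmap G r 0 = vmap G r (nd p)" by blast
    then show False using src_root_notin[of p] by simp
  qed
qed

lemma vmap_src: "e \<in> Ar T \<Longrightarrow> src G (amap G r e) = vmap G r (src T e)"
  by (erule Ar_graph_cases) (auto simp: vmap_par at_in)

lemma vmap_tgt: "e \<in> Ar T \<Longrightarrow> tgt G (amap G r e) = vmap G r (tgt T e)"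
  by (erule Ar_graph_cases) (auto simp: vmap_par at_in)

lemma amap_in: "e \<in> Ar T \<Longrightarrow> amap G r e \<in> Ar G"
  by (erule Ar_graph_cases) (auto simp: at_in)

lemma amap_rev: "e \<in> Ar T \<Longrightarrow> rev_arc G (amap G r e) = amap G r (rev_arc T e)"
  by (erule Ar_graph_cases) (auto simp: at_in)

lemma rot_root: "rot G r = r"
proof -
  have "rot G r \<in> outs G (src G r)" using root(1) by (simp add: rot_in src_rot)
  then show ?thesis unfolding outs_bdry[OF root] by simp
qed

lemma amap_rot:
  assumes "e \<in> Ar T"
  shows "rot G (amap G r e) = amap G r (rot T e)"
  using assms
proof (cases rule: Ar_graph_cases)
  case (1 p)
  show ?thesis
  proof (cases "p = []")
    case True
    then show ?thesis using 1 rot_root by (simp add: rot_dn sib_def)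
  next
    case False
    from pos_snocE[OF 1(2) False] obtain q i s where q: "p = q @ [i]" "subt t q = Some s"
      "rep G (arc_at G r q) s" "i < length (kids s)" .
    have *: "rot G (amap G r e) = kid G (arc_at G r q) (Suc i)" using 1 q by (simp add: at_snoc rot_kid)
    have sib: "rot T e = sib t (q @ [i])" using 1 q by (simp add: rot_dn)
    show ?thesis
    proof (cases "Suc i < length (kids s)")
      case True
      then show ?thesis using * sib pos_snoc_iff[OF q(2), of "Suc i"] by (simp add: sib_def at_snoc)
    next
      case False
      then have "Suc i = length (kids s)" using q(4) by simp
      then show ?thesis using * sib pos_snoc_iff[OF q(2), of "Suc i"] rep_kids(4)[OF q(3)]
        by (simp add: sib_def)
    qed
  qed
next
  case (2 p)
  obtain s where s: "subt t p = Some s" "rep G (arc_at G r p) s" using posE[OF 2(2)] .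
  have *: "rot G (amap G r e) = kid G (arc_at G r p) 0" using 2 by (simp add: kid_def)
  have fk: "rot T e = fst_kid t p" using 2 by (simp add: rot_up)
  show ?thesis
  proof (cases "kids s = []")
    case True
    then show ?thesis using * fk pos_snoc_iff[OF s(1), of 0] rep_kids(4)[OF s(2)] by (simp add: fst_kid_def)
  next
    case False
    then show ?thesis using * fk pos_snoc_iff[OF s(1), of 0] by (simp add: fst_kid_def at_snoc)
  qed
qed

lemma amap_inj: "inj_on (amap G r) (Ar T)"
proof -
  have at_inj: "p = q" if "p \<in> pos t" "q \<in> pos t" "arc_at G r p = arc_at G r q" for p q
    using inj_at[OF rep] that by (auto simp: inj_on_def)
  have no: False if p: "p \<in> pos t" and q: "q \<in> pos t" and e: "arc_at G r p = rev_arc G (arc_at G r q)" for p q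
  proof -
    \<comment> \<open>If the arc at \<open>p'\<close> is the reverse of the arc at
      \<open>q'\<close>, then \<open>p'\<close> is a child of \<open>q'\<close>. Applied in both
      directions this is absurd, so no edge is reached twice.\<close>
    have par: "\<exists>i. p' = q' @ [i]" if p': "p' \<in> pos t" and q': "q' \<in> pos t"
      and e': "arc_at G r p' = rev_arc G (arc_at G r q')" for p' q'
    proof -
      have st: "src G (arc_at G r p') = tgt G (arc_at G r q')" using e' at_in[OF q'] by simp
      show ?thesis
      proof (cases "p' = []")
        case True
        then show ?thesis using src_root_notin[OF q'] st by simp
      next
        case False
        then obtain w i where w: "p' = w @ [i]" by (metis append_butlast_last_id)
        then have wp: "w \<in> pos t" using p' pos_snocD by blast
        have "tgt G (arc_at G r w) = tgt G (arc_at G r q')" using vmap_par[OF p'] w st by simp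
        then have "w = q'" using inj_at[OF rep] wp q' by (auto simp: inj_on_def)
        then show ?thesis using w by blast
      qed
    qed
    have "arc_at G r q = rev_arc G (arc_at G r p)" using e by simp
    then show False using par[OF p q e] par[OF q p] by auto
  qed
  show ?thesis
  proof (rule inj_onI)
    fix d e assume d: "d \<in> Ar T" and e: "e \<in> Ar T" and eq: "amap G r d = amap G r e"
    from d show "d = e"
    proof (cases rule: Ar_graph_cases)
      case d: (1 p)
      from e show ?thesis
      proof (cases rule: Ar_graph_cases)
        case (1 q)
        then show ?thesis using at_inj[of p q] d eq by simp
      next
        case (2 q)
        then show ?thesis using no[of p q] d eq by simp
      qed
    next
      case d: (2 p)
      from e show ?thesis
      proof (cases rule: Ar_graph_cases)
        case (1 q)
        then show ?thesis using no[of q p] d eq by simp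
      next
        case (2 q)
        then show ?thesis using at_inj[of p q] d eq by (simp add: arev_eq_iff)
      qed
    qed
  qed
qed

text \<open>Makes the image closed under adjacency; connectedness then gives surjectivity.\<close>

lemma outs_sub: "v \<in> Vs T \<Longrightarrow> outs G (vmap G r v) \<subseteq> amap G r ` Ar T"
proof -
  assume "v \<in> Vs T"
  then consider "v = 0" | p where "v = nd p" "p \<in> pos t" by auto
  then show ?thesis
  proof cases
    case 1
    have "r = amap G r (dn [])" by simp
    then show ?thesis using 1 outs_bdry[OF root] by (auto simp: Ar_graph simp del: amap_simps)
  next
    case 2
    obtain s where s: "subt t p = Some s" "rep G (arc_at G r p) s" using posE[OF 2(2)] .
    have "rev_arc G (arc_at G r p) \<in> amap G r ` Ar T"
      using 2 by (intro image_eqI[of _ _ "up p"]) (auto simp: Ar_graph)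
    moreover have "kid G (arc_at G r p) i \<in> amap G r ` Ar T" if "i < length (kids s)" for i
      using that pos_snoc_iff[OF s(1)]
      by (intro image_eqI[of _ _ "dn (p @ [i])"]) (auto simp: Ar_graph at_snoc)
    ultimately show ?thesis using rep_kids(1)[OF s(2)] 2 by auto
  qed
qed

lemma wfT: "wf_digraph (ugraph T)"
  using plabic_map.fin[OF plabic_graph_map[OF plabic_graph_graph_of(1)[OF rep_wf[OF rep]]]]
  by (rule fin_digraph.axioms(1))

lemma vmap_surj: "vmap G r ` Vs T = Vs G"
proof
  show "vmap G r ` Vs T \<subseteq> Vs G" using root at_in by auto
  show "Vs G \<subseteq> vmap G r ` Vs T"
  proof (rule connected_closed[of "src G r"])
    fix e assume e: "e \<in> Ar G" "src G e \<in> vmap G r ` Vs T"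
    then obtain v where v: "v \<in> Vs T" "src G e = vmap G r v" by blast
    then have "e \<in> amap G r ` Ar T" using outs_sub[OF v(1)] e(1) by (auto simp del: Vs_graph)
    then obtain d where d: "d \<in> Ar T" "e = amap G r d" by blast
    have "tgt T d \<in> Vs T" by (rule wf_digraph.head_in_verts[OF wfT d(1)])
    then show "tgt G e \<in> vmap G r ` Vs T" using vmap_tgt[OF d(1)] d(2) by auto
  qed (use root in auto)
qed

lemma amap_surj: "amap G r ` Ar T = Ar G"
proof
  show "amap G r ` Ar T \<subseteq> Ar G" using amap_in by auto
  show "Ar G \<subseteq> amap G r ` Ar T"
  proof
    fix e assume e: "e \<in> Ar G"
    then have "src G e \<in> vmap G r ` Vs T" unfolding vmap_surj by simp
    then obtain v where v: "v \<in> Vs T" "src G e = vmap G r v" by blast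
    then show "e \<in> amap G r ` Ar T" using outs_sub[OF v(1)] e by (auto simp del: Vs_graph)
  qed
qed

lemma vmap_bdry_black:
  assumes "v \<in> Vs T"
  shows "vmap G r v \<in> set (bdry G) \<longleftrightarrow> v \<in> set (bdry T)" "vmap G r v \<in> black G \<longleftrightarrow> v \<in> black T"
proof -
  have "(vmap G r v \<in> set (bdry G) \<longleftrightarrow> v \<in> set (bdry T)) \<and> (vmap G r v \<in> black G \<longleftrightarrow> v \<in> black T)"
  proof (cases "v = 0")
    case True
    then show ?thesis using root black_sub by (auto simp: set_bdry_graph black_graph internal_def)
  next
    case False
    then obtain p where p: "v = nd p" "p \<in> pos t" using assms by auto
    obtain s where s: "subt t p = Some s" "rep G (arc_at G r p) s" using posE[OF p(2)] .
    have "v \<in> set (bdry T) \<longleftrightarrow> s = Leaf" using p s(1) by (auto simp: set_bdry_graph)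
    moreover have "v \<in> black T \<longleftrightarrow> (\<exists>ts. s = Node True ts)" using p s(1) by (auto simp: black_graph)
    ultimately show ?thesis using rep_tgt[OF s(2)] p(1) by simp
  qed
  then show "vmap G r v \<in> set (bdry G) \<longleftrightarrow> v \<in> set (bdry T)" "vmap G r v \<in> black G \<longleftrightarrow> v \<in> black T"
    by blast+
qed

lemma contour_G: "contour G r (map (amap G r) (tl (walk t [])))"
proof -
  have c: "distinct (walk t [])" "set (walk t []) = Ar T"
    "map (face_succ T) (walk t []) = tl (walk t []) @ [dn []]"
    using contour_graph[of t] unfolding contour_def walk_root[symmetric] by auto
  have w: "r # map (amap G r) (tl (walk t [])) = map (amap G r) (walk t [])"
    by (subst (2) walk_root) simp
  have "face_succ G (amap G r e) = amap G r (face_succ T e)" if "e \<in> Ar T" for e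
  proof -
    have "rev_arc T e \<in> Ar T"
      using that by (rule Ar_graph_cases) (auto simp: Ar_graph)
    then show ?thesis using that by (simp add: face_succ_def amap_rev amap_rot)
  qed
  then have "map (face_succ G) (map (amap G r) (walk t [])) = map (amap G r) (map (face_succ T) (walk t []))"
    using c(2) by simp
  also have "\<dots> = map (amap G r) (tl (walk t [])) @ [r]" unfolding c(3) by simp
  finally show ?thesis unfolding contour_def w
    using c amap_inj amap_surj by (simp add: distinct_map)
qed

text \<open>Vertices, arcs and colours are matched by the tree alone. The labels are matched by the
  clockwise condition: they follow the contour starting at \<open>r\<close>, which is how
  \<open>graph_of\<close> assigns them.\<close>

lemma plabic_iso_graph_of:
  assumes "boundary_clockwise G" "distinct (bdry G)" "src G r = bdry G ! 0"
  shows "plabic_iso T G"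
proof -
  have ar: "set (walk t []) = Ar T"
    using contour_graph[of t] unfolding contour_def walk_root[symmetric] by auto
  have w: "r # map (amap G r) (tl (walk t [])) = map (amap G r) (walk t [])"
    by (subst (2) walk_root) simp
  have ne: "bdry G \<noteq> []" using root(2) by auto
  have "bdry G = map (src G) (filter (\<lambda>e. src G e \<in> set (bdry G)) (map (amap G r) (walk t [])))"
    using boundary_clockwise_iff[OF contour_G assms(3) ne assms(2)] assms(1) w by simp
  also have "\<dots> = map (\<lambda>e. src G (amap G r e)) (filter (\<lambda>e. src G (amap G r e) \<in> set (bdry G)) (walk t []))"
    by (simp add: filter_map o_def)
  also have "filter (\<lambda>e. src G (amap G r e) \<in> set (bdry G)) (walk t []) = filter (bd_arc t) (walk t [])"
  proof (rule filter_cong)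
    fix e assume "e \<in> set (walk t [])"
    then have e: "e \<in> Ar T" using ar by simp
    have "src T e \<in> Vs T" by (rule wf_digraph.tail_in_verts[OF wfT e])
    then show "src G (amap G r e) \<in> set (bdry G) \<longleftrightarrow> bd_arc t e"
      using vmap_bdry_black(1)[of "src T e"] vmap_src[OF e] src_bdry[OF e] by simp
  qed simp
  also have "map (\<lambda>e. src G (amap G r e)) (filter (bd_arc t) (walk t [])) =
    map (\<lambda>e. vmap G r (src T e)) (filter (bd_arc t) (walk t []))"
    by (rule map_cong) (use ar vmap_src in auto)
  also have "\<dots> = map (vmap G r) (bdry T)"
    by (simp add: bdry_graph graph_of_def)
  finally have bd: "bdry G = map (vmap G r) (bdry T)" .
  have "black G = vmap G r ` black T"
  proof -
    have "black G \<subseteq> Vs G" using black_sub by (auto simp: internal_def)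
    then have GT: "black G \<subseteq> vmap G r ` Vs T" unfolding vmap_surj .
    have TT: "black T \<subseteq> Vs T" by (auto simp: black_graph pos_def)
    show ?thesis
    proof (intro equalityI subsetI)
      fix v assume v: "v \<in> black G"
      then obtain w where "w \<in> Vs T" "v = vmap G r w" using GT by blast
      then show "v \<in> vmap G r ` black T" using v vmap_bdry_black(2)[of w] by blast
    next
      fix v assume "v \<in> vmap G r ` black T"
      then obtain w where "w \<in> black T" "v = vmap G r w" by blast
      then show "v \<in> black G" using TT vmap_bdry_black(2)[of w] by blast
    qed
  qed
  moreover have "bij_betw (vmap G r) (Vs T) (Vs G)" "bij_betw (amap G r) (Ar T) (Ar G)"
    using vmap_inj vmap_surj amap_inj amap_surj by (simp_all only: bij_betw_def)
  moreover have "\<forall>a\<in>Ar T. src G (amap G r a) = vmap G r (src T a) \<and>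
      tgt G (amap G r a) = vmap G r (tgt T a) \<and> rev_arc G (amap G r a) = amap G r (rev_arc T a) \<and>
      rot G (amap G r a) = amap G r (rot T a)"
    using vmap_src vmap_tgt amap_rev amap_rot by blast
  ultimately show ?thesis unfolding plabic_iso_def using bd by blast
qed

end

section \<open>Normal forms of plane trees\<close>

text \<open>The list that a child contributes to a parent of colour \<open>c\<close>. Between
  reduced trees and nonempty lists of reduced trees not rooted in \<open>c\<close>,
  \<open>dissolve c\<close> and \<open>mk c\<close> are inverse to each other.\<close>

fun dissolve :: "bool \<Rightarrow> plane_tree \<Rightarrow> plane_tree list" where
  "dissolve c Leaf = [Leaf]"
| "dissolve c (Node d ts) = (if c = d then ts else [Node d ts])"

definition mk :: "bool \<Rightarrow> plane_tree list \<Rightarrow> plane_tree" where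
  "mk c ts = (if length ts = 1 then hd ts else Node c ts)"

fun nf :: "plane_tree \<Rightarrow> plane_tree" where
  "nf Leaf = Leaf"
| "nf (Node c ts) = mk c (concat (map (\<lambda>t. dissolve c (nf t)) ts))"

definition rooted :: "bool \<Rightarrow> plane_tree \<Rightarrow> bool" where
  "rooted c t \<longleftrightarrow> (\<exists>ts. t = Node c ts)"

fun reduced :: "plane_tree \<Rightarrow> bool" where
  "reduced Leaf = True"
| "reduced (Node c ts) = (length ts \<ge> 2 \<and> (\<forall>t\<in>set ts. reduced t \<and> \<not> rooted c t))"

lemma rooted_simps [simp]: "\<not> rooted c Leaf" "rooted c (Node d ts) \<longleftrightarrow> c = d"
  by (auto simp: rooted_def)

lemma dissolve_not_rooted: "\<not> rooted c t \<Longrightarrow> dissolve c t = [t]"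
  by (cases t) auto

lemma reduced_dissolve:
  assumes "reduced t"
  shows "\<forall>s\<in>set (dissolve c t). reduced s \<and> \<not> rooted c s" "dissolve c t \<noteq> []"
  using assms by (cases t; auto)+

lemma reduced_mk:
  assumes "\<forall>t\<in>set ts. reduced t \<and> \<not> rooted c t" "ts \<noteq> []"
  shows "reduced (mk c ts)"
proof (cases "length ts = 1")
  case True
  then show ?thesis using assms by (cases ts) (auto simp: mk_def)
next
  case False
  then have "length ts \<ge> 2" using assms(2) by (cases ts) (auto simp: Suc_le_eq)
  then show ?thesis using assms(1) by (simp add: mk_def)
qed

lemma dissolve_mk:
  assumes "\<forall>t\<in>set ts. \<not> rooted c t"
  shows "dissolve c (mk c ts) = ts"
proof (cases "length ts = 1")
  case True
  then obtain t where "ts = [t]" by (auto simp: length_Suc_conv)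
  then show ?thesis using assms by (simp add: mk_def dissolve_not_rooted)
qed (simp add: mk_def)

lemma reduced_flat:
  assumes "\<forall>t\<in>set ts. reduced (nf t)"
  shows "\<forall>s\<in>set (concat (map (\<lambda>t. dissolve c (nf t)) ts)). reduced s \<and> \<not> rooted c s"
  using assms reduced_dissolve(1) by fastforce

lemma reduced_nf: "wf_tree t \<Longrightarrow> reduced (nf t)"
proof (induction t)
  case (Node c ts)
  then have r: "\<forall>t\<in>set ts. reduced (nf t)" and ne: "ts \<noteq> []" by auto
  have "concat (map (\<lambda>t. dissolve c (nf t)) ts) \<noteq> []"
    using r ne reduced_dissolve(2) by (cases ts) auto
  then show ?case using reduced_mk[OF reduced_flat[OF r]] by simp
qed simp

lemma nf_reduced: "reduced t \<Longrightarrow> nf t = t"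
proof (induction t)
  case (Node c ts)
  then have "map (\<lambda>t. dissolve c (nf t)) ts = map (\<lambda>t. [t]) ts"
    using dissolve_not_rooted by (auto intro!: map_cong)
  then have "concat (map (\<lambda>t. dissolve c (nf t)) ts) = concat (map (\<lambda>t. [t]) ts)"
    by (rule arg_cong)
  also have "\<dots> = ts" by (induction ts) auto
  finally show ?case using Node.prems by (simp add: mk_def)
qed simp

lemma reduced_wf: "reduced t \<Longrightarrow> wf_tree t"
  by (induction t) auto

lemma dissolve_nf_Node:
  assumes "\<forall>t\<in>set ts. wf_tree t"
  shows "dissolve c (nf (Node c ts)) = concat (map (\<lambda>t. dissolve c (nf t)) ts)"
  using dissolve_mk reduced_flat[of ts c] reduced_nf assms by simp

lemma nf_Node_cong: "map nf ts = map nf ts' \<Longrightarrow> nf (Node c ts) = nf (Node c ts')"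
proof -
  assume "map nf ts = map nf ts'"
  then have "map (dissolve c) (map nf ts) = map (dissolve c) (map nf ts')" by simp
  then have "map (\<lambda>t. dissolve c (nf t)) ts = map (\<lambda>t. dissolve c (nf t)) ts'"
    unfolding map_map o_def .
  then show ?thesis by simp
qed

text \<open>The effect of a contraction on the tree; \<open>nf_single\<close> is the counterpart for
  a removal.\<close>

lemma nf_merge:
  assumes "\<forall>t\<in>set ts. wf_tree t"
  shows "nf (Node c (us @ Node c ts # vs)) = nf (Node c (us @ ts @ vs))"
  using dissolve_nf_Node[OF assms, of c] by (simp del: nf.simps(2) add: nf.simps(2)[of c "us @ _"])

lemma nf_single:
  assumes "wf_tree t"
  shows "nf (Node c [t]) = nf t"
proof (cases "nf t")
  case (Node d ss)
  then show ?thesis using reduced_nf[OF assms] by (auto simp: mk_def)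
qed (simp add: mk_def)

text \<open>The two ways of failing to be reduced are the situations in which a removal or a
  contraction applies.\<close>

lemma not_reducedE:
  assumes "wf_tree t" "\<not> reduced t"
  obtains p c ts where "subt t p = Some (Node c ts)"
    "length ts = 1 \<or> (\<exists>i<length ts. \<exists>ss. ts ! i = Node c ss)"
proof -
  have "\<exists>p c ts. subt t p = Some (Node c ts) \<and> (length ts = 1 \<or> (\<exists>i<length ts. \<exists>ss. ts ! i = Node c ss))"
    using assms
  proof (induction t)
    case (Node c ts)
    show ?case
    proof (cases "\<exists>s\<in>set ts. \<not> reduced s")
      case True
      then obtain i where i: "i < length ts" "\<not> reduced (ts ! i)" by (auto simp: in_set_conv_nth)
      then obtain p d us where "subt (ts ! i) p = Some (Node d us)"
        "length us = 1 \<or> (\<exists>j<length us. \<exists>ss. us ! j = Node d ss)"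
        using Node.IH[of "ts ! i"] Node.prems by force
      then show ?thesis using i by (intro exI[of _ "i # p"]) auto
    next
      case False
      then have "length ts < 2 \<or> (\<exists>s\<in>set ts. rooted c s)" using Node.prems(2) by auto
      moreover have "ts \<noteq> []" using Node.prems by simp
      moreover have "\<exists>i<length ts. \<exists>ss. ts ! i = Node c ss" if "\<exists>s\<in>set ts. rooted c s"
        using that unfolding rooted_def by (metis in_set_conv_nth)
      moreover have "length ts = 1" if "length ts < 2" "ts \<noteq> []"
        using that by (cases ts) auto
      ultimately have "length ts = 1 \<or> (\<exists>i<length ts. \<exists>ss. ts ! i = Node c ss)" by blast
      then show ?thesis by (intro exI[of _ "[]"]) auto
    qed
  qed simp
  then show ?thesis using that by blast
qed

section \<open>The plane tree of a plabic tree\<close>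

text \<open>The nonempty boundary supplies the root. For such graphs this agrees with
  \<open>plabic_tree\<close>, by \<open>plabic_tree_is_ptree\<close> and
  \<open>is_ptree_plabic_tree\<close>.\<close>

definition is_ptree :: "plabic \<Rightarrow> bool" where
  "is_ptree G \<longleftrightarrow> plabic_graph G \<and> bdry G \<noteq> [] \<and> card (Vs G) = card (Ar G) div 2 + 1"

definition is_root :: "plabic \<Rightarrow> nat \<Rightarrow> bool" where
  "is_root G r \<longleftrightarrow> r \<in> Ar G \<and> src G r = bdry G ! 0"

definition tree_of :: "plabic \<Rightarrow> plane_tree" where
  "tree_of G = (THE t. \<exists>r. is_root G r \<and> rep G r t)"

lemma (in plabic_map) root_ex:
  assumes "bdry G \<noteq> []"
  shows "\<exists>r. is_root G r"
proof -
  have "bdry G ! 0 \<in> Vs G" using assms bdry_sub by auto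
  then show ?thesis using outs_nonempty unfolding is_root_def by fastforce
qed

lemma (in plabic_map) root_unique:
  assumes "bdry G \<noteq> []" "is_root G r" "is_root G s"
  shows "r = s"
  using assms outs_bdry[of r] by (auto simp: is_root_def)

lemma (in plabic_map) tree_ofI:
  assumes "bdry G \<noteq> []" "is_root G r" "rep G r t"
  shows "tree_of G = t"
  unfolding tree_of_def
  by (rule the_equality) (use assms root_unique rep_unique in blast)+

lemma is_ptree_treelike: "is_ptree G \<Longrightarrow> treelike_map G"
  unfolding is_ptree_def treelike_map_def treelike_map_axioms_def
  using plabic_graph_map plabic_map.treelikeI_card by auto

lemma treelike_root:
  assumes "treelike_map G" "bdry G \<noteq> []"
  obtains r where "is_root G r" "rooted_tree G r (tree_of G)"
proof -
  interpret treelike_map G by fact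
  obtain r where r: "is_root G r" using root_ex assms(2) by auto
  then have ra: "r \<in> Ar G" "src G r \<in> set (bdry G)" using assms(2) by (auto simp: is_root_def)
  obtain t where t: "rep G r t" using rep_ex[OF ra(1)] by auto
  have "rooted_tree G r (tree_of G)"
    unfolding tree_ofI[OF assms(2) r t] by unfold_locales (use ra t in auto)
  then show ?thesis using that r by blast
qed

text \<open>An acyclic graph has a plane tree, whose tour is a contour; with a single face, Euler's
  formula gives the count.\<close>

lemma plabic_tree_is_ptree:
  assumes "plabic_tree G" "bdry G \<noteq> []"
  shows "is_ptree G"
proof -
  have pg: "plabic_graph G" using assms by (simp add: plabic_tree_def)
  interpret plabic_map G by (rule plabic_graph_map[OF pg])
  have "treelike G" using assms acyclic_iff_treelike by (auto simp: plabic_tree_def)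
  then have tm: "treelike_map G" by unfold_locales
  obtain r where "rooted_tree G r (tree_of G)" using treelike_root[OF tm assms(2)] .
  then interpret rooted_tree G r "tree_of G" .
  have "card (Vs G) = card (Ar G) div 2 + 1"
    using planar_card[OF _ contour_G] pg by (simp add: plabic_graph_def)
  then show ?thesis using pg assms by (simp add: is_ptree_def)
qed

lemma is_ptree_plabic_tree:
  assumes "is_ptree G"
  shows "plabic_tree G"
proof -
  interpret treelike_map G by (rule is_ptree_treelike[OF assms])
  show ?thesis using assms tl acyclic_iff_treelike by (auto simp: plabic_tree_def is_ptree_def)
qed

lemma wf_tree_of:
  assumes "is_ptree G"
  shows "wf_tree (tree_of G)"
proof -
  obtain r where "rooted_tree G r (tree_of G)"
    using treelike_root[OF is_ptree_treelike[OF assms]] assms by (auto simp: is_ptree_def)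
  then interpret rooted_tree G r "tree_of G" .
  show ?thesis by (rule rep_wf[OF rep])
qed

lemma bdry_graph_ne: "bdry (graph_of t) \<noteq> []" and bdry_graph_0: "bdry (graph_of t) ! 0 = 0"
  unfolding bdry_graph by (subst walk_root, simp add: bd_arc_def)+

lemma is_ptree_graph_of:
  assumes "wf_tree t"
  shows "is_ptree (graph_of t)" "tree_of (graph_of t) = t"
proof -
  show p: "is_ptree (graph_of t)"
    using plabic_graph_graph_of[OF assms] bdry_graph_ne by (simp add: is_ptree_def)
  interpret treelike_map "graph_of t" by (rule is_ptree_treelike[OF p])
  show "tree_of (graph_of t) = t"
    by (rule tree_ofI[OF bdry_graph_ne _ rep_graph_of[of t "[]"]])
      (simp_all add: is_root_def Ar_graph bdry_graph_0)
qed

lemma step_graph_of: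
  assumes "is_ptree G"
  shows "plabic_step (graph_of (tree_of G)) G"
proof -
  have pg: "plabic_graph G" "bdry G \<noteq> []" using assms by (auto simp: is_ptree_def)
  obtain r where r: "is_root G r" "rooted_tree G r (tree_of G)"
    using treelike_root[OF is_ptree_treelike[OF assms] pg(2)] .
  then interpret rooted_tree G r "tree_of G" by simp
  have "plabic_iso (graph_of (tree_of G)) G"
    using plabic_iso_graph_of pg r(1) by (simp add: plabic_graph_def is_root_def)
  then show ?thesis
    using pg(1) plabic_graph_graph_of(1)[OF wf_tree_of[OF assms]] by (simp add: plabic_step_def)
qed

section \<open>Isomorphisms and square moves\<close>

lemma rep_iso:
  assumes G: "plabic_map G" and H: "plabic_map H"
    and f: "bij_betw f (Vs G) (Vs H)" and g: "bij_betw g (Ar G) (Ar H)"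
    and c: "\<And>e. e \<in> Ar G \<Longrightarrow> src H (g e) = f (src G e)" "\<And>e. e \<in> Ar G \<Longrightarrow> tgt H (g e) = f (tgt G e)"
      "\<And>e. e \<in> Ar G \<Longrightarrow> rev_arc H (g e) = g (rev_arc G e)" "\<And>e. e \<in> Ar G \<Longrightarrow> rot H (g e) = g (rot G e)"
    and b: "black H = f ` black G" "bdry H = map f (bdry G)"
  shows "rep G x t \<Longrightarrow> rep H (g x) t"
proof -
  interpret G: plabic_map G by (rule G)
  interpret H: plabic_map H by (rule H)
  have bsub: "black G \<subseteq> Vs G" using G.black_sub by (auto simp: internal_def)
  have finj: "f v = f w \<longleftrightarrow> v = w" if "v \<in> Vs G" "w \<in> Vs G" for v w
    using f that by (auto simp: bij_betw_def inj_on_def)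
  have gin: "g e \<in> Ar H" if "e \<in> Ar G" for e using g that by (auto simp: bij_betw_def)
  have outs: "outs H (f v) = g ` outs G v" if v: "v \<in> Vs G" for v
  proof
    show "outs H (f v) \<subseteq> g ` outs G v"
    proof
      fix e assume e: "e \<in> outs H (f v)"
      then obtain d where d: "d \<in> Ar G" "e = g d" using g by (auto simp: bij_betw_def)
      then have "src G d = v" using e c(1) finj[of "src G d" v] v by auto
      then show "e \<in> g ` outs G v" using d by auto
    qed
  qed (use c(1) gin in auto)
  show "rep G x t \<Longrightarrow> rep H (g x) t"
  proof (induction x t rule: rep.induct)
    case (rep_Leaf x)
    then show ?case using gin c b by (auto intro!: rep.rep_Leaf)
  next
    case (rep_Node x cs ts)
    have x: "x \<in> Ar G" by fact
    have v: "tgt G x \<in> Vs G" using x by simp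
    have sub: "set (rev_arc G x # cs) \<subseteq> Ar G" using rep_Node.hyps(4) by (simp only:) auto
    have *: "map g (rev_arc G x # cs) = rev_arc H (g x) # map g cs" using c(3) x by simp
    have "rep H (g x) (Node (tgt H (g x) \<in> black H) ts)"
    proof (rule rep.rep_Node)
      show "tgt H (g x) \<in> internal H"
      proof -
        have "f (tgt G x) \<notin> f ` set (bdry G)"
        proof
          assume "f (tgt G x) \<in> f ` set (bdry G)"
          then obtain w where "w \<in> set (bdry G)" "f (tgt G x) = f w" by blast
          then show False using rep_Node.hyps(2) finj[OF v, of w] G.bdry_sub by (auto simp: internal_def)
        qed
        then show ?thesis using H.head_in_verts[OF gin[OF x]] c(2)[OF x] b by (simp add: internal_def)
      qed
      show "distinct (rev_arc H (g x) # map g cs)"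
        unfolding *[symmetric] distinct_map
        using rep_Node.hyps(3) inj_on_subset[OF bij_betw_imp_inj_on[OF g] sub] by blast
      show "set (rev_arc H (g x) # map g cs) = outs H (tgt H (g x))"
        unfolding *[symmetric] set_map rep_Node.hyps(4) using outs[OF v] c(2)[OF x] by simp
      have "map (rot H) (map g (rev_arc G x # cs)) = map g (map (rot G) (rev_arc G x # cs))"
        using c(4) sub by auto
      then show "map (rot H) (rev_arc H (g x) # map g cs) = map g cs @ [rev_arc H (g x)]"
        unfolding * rep_Node.hyps(5) using c(3)[OF x] by simp
      show "list_all2 (rep H) (map g cs) ts"
        using rep_Node.IH by (simp add: list_all2_conv_all_nth)
    qed (use gin x in simp)
    moreover have "tgt H (g x) \<in> black H \<longleftrightarrow> tgt G x \<in> black G"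
      using c(2)[OF x] b(1) finj v bsub by auto
    ultimately show ?case by simp
  qed
qed

lemma iso_invariant:
  assumes G: "is_ptree G" and H: "plabic_graph H" and i: "plabic_iso G H"
  shows "is_ptree H" "tree_of H = tree_of G"
proof -
  obtain f g where f: "bij_betw f (Vs G) (Vs H)" and g: "bij_betw g (Ar G) (Ar H)"
    and c: "\<And>e. e \<in> Ar G \<Longrightarrow> src H (g e) = f (src G e)" "\<And>e. e \<in> Ar G \<Longrightarrow> tgt H (g e) = f (tgt G e)"
      "\<And>e. e \<in> Ar G \<Longrightarrow> rev_arc H (g e) = g (rev_arc G e)" "\<And>e. e \<in> Ar G \<Longrightarrow> rot H (g e) = g (rot G e)"
    and b: "black H = f ` black G" "bdry H = map f (bdry G)"
    using i unfolding plabic_iso_def by blast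
  have ne: "bdry G \<noteq> []" "bdry H \<noteq> []" using G b by (auto simp: is_ptree_def)
  show pH: "is_ptree H"
    using G H ne bij_betw_same_card[OF f] bij_betw_same_card[OF g] by (simp add: is_ptree_def)
  interpret G: treelike_map G by (rule is_ptree_treelike[OF G])
  interpret H: treelike_map H by (rule is_ptree_treelike[OF pH])
  obtain r where r: "is_root G r" "rooted_tree G r (tree_of G)"
    using treelike_root[OF is_ptree_treelike[OF G] ne(1)] .
  have rp: "rep G r (tree_of G)" using r(2) by (rule rooted_tree.rep)
  have "rep H (g r) (tree_of G)"
    by (rule rep_iso[OF G.plabic_map_axioms H.plabic_map_axioms f g])
      (erule c | rule b | rule rp)+
  moreover have "is_root H (g r)"
    using r(1) c(1) b(2) ne g by (auto simp: is_root_def bij_betw_def)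
  ultimately show "tree_of H = tree_of G" using H.tree_ofI[OF ne(2)] by blast
qed

lemma contour_cyclic: "contour G r ps \<Longrightarrow> cyclic_on (face_succ G) (Ar G)"
  using cyclic_on_list[of "face_succ G" r ps] by (simp add: contour_def)

text \<open>The face walk of a tree runs through every arc, so the four arcs of the square would
  include the root arc, whose tail has degree 1 instead of 3.\<close>

lemma no_square_move:
  assumes G: "is_ptree G"
  shows "\<not> square_move G H"
proof
  assume "square_move G H"
  then obtain a where a: "a \<in> Ar G" and cyc: "(face_succ G ^^ 4) a = a"
    and w: "\<forall>i<4. deg G (src G ((face_succ G ^^ i) a)) = 3"
    by (auto simp: square_move_def Let_def)
  have pg: "plabic_graph G" "bdry G \<noteq> []" using G by (auto simp: is_ptree_def)
  obtain r where r: "rooted_tree G r (tree_of G)"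
    using treelike_root[OF is_ptree_treelike[OF G] pg(2)] .
  then interpret rooted_tree G r "tree_of G" .
  have "cyclic_on (face_succ G) (Ar G)"
    by (rule contour_cyclic[OF contour_G])
  then have "Ar G = orbit (face_succ G) a" using a by (rule orbit_cyclic_eq3[symmetric])
  also have "\<dots> = (\<lambda>i. (face_succ G ^^ i) a) ` {..<4}"
    using orbit_altdef_bounded[OF cyc] by auto
  finally have ar: "Ar G = (\<lambda>i. (face_succ G ^^ i) a) ` {..<4}" .
  have "src G r \<in> set (bdry G)" "r \<in> Ar G" using root by auto
  then obtain i where "i < 4" "r = (face_succ G ^^ i) a" using ar by auto
  then have "deg G (src G r) = 3" using w by simp
  then show False using bdry_deg[OF root(2)] by simp
qed

section \<open>Deleting an edge from the contour\<close>

lemma delete_cycle: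
  assumes dist: "distinct (r # ps)" and d: "d \<in> set ps" and f: "map f (r # ps) = ps @ [r]"
  shows "map (\<lambda>e. if f e = d then f d else f e) (r # remove1 d ps) = remove1 d ps @ [r]"
proof -
  obtain us vs where ps: "ps = us @ d # vs" using d by (auto simp: in_set_conv_decomp)
  define h where "h y = (if y = d then f d else y)" for y
  have *: "map (\<lambda>e. if f e = d then f d else f e) xs = map h (map f xs)" for xs
    by (simp add: h_def)
  have nd: "d \<notin> set us" "d \<notin> set vs" "d \<noteq> r" using dist ps by auto
  have rm: "remove1 d ps = us @ vs" unfolding ps using nd by (simp add: remove1_append)
  have "take (Suc (length us)) (map f (r # ps)) = take (Suc (length us)) (ps @ [r])"
    unfolding f ..
  then have 1: "map f (r # us) = us @ [d]" unfolding ps by simp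
  have "drop (Suc (length us)) (map f (r # ps)) = drop (Suc (length us)) (ps @ [r])"
    unfolding f ..
  then have 2: "map f (d # vs) = vs @ [r]" unfolding ps by simp
  have h: "map h xs = xs" if "d \<notin> set xs" for xs using that by (intro map_idI) (auto simp: h_def)
  have 3: "map h (map f (r # us)) = us @ [f d]"
    unfolding 1 using h[OF nd(1)] by (simp add: h_def)
  have 4: "f d # map f vs = vs @ [r]" using 2 by simp
  then have "map f vs = tl (vs @ [r])" by (metis list.sel(3))
  moreover have "d \<notin> set (tl (vs @ [r]))" using nd by (auto dest: list.set_sel(2)[rotated])
  ultimately have 5: "map h (map f vs) = map f vs" using h by simp
  have "map h (map f (r # us @ vs)) = map h (map f (r # us)) @ map h (map f vs)" by simp
  also have "\<dots> = us @ (f d # map f vs)" unfolding 3 5 by simp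
  finally show ?thesis unfolding * rm 4 by simp
qed

text \<open>The arcs are cut out one after the other. By \<open>nx\<close> neither follows the other
  on the contour, so the two redirections do not interfere.\<close>

lemma contour_delete:
  assumes c: "contour G r ps" and ds: "d1 \<in> Ar G" "d2 \<in> Ar G" "d1 \<noteq> d2" "r \<noteq> d1" "r \<noteq> d2"
    and nx: "face_succ G d1 \<noteq> d2" "face_succ G d2 \<noteq> d1"
    and ar: "Ar H = Ar G - {d1, d2}"
    and fs: "\<And>e. e \<in> Ar H \<Longrightarrow> face_succ H e = (if face_succ G e = d1 then face_succ G d1
      else if face_succ G e = d2 then face_succ G d2 else face_succ G e)"
  shows "contour H r (filter (\<lambda>e. e \<noteq> d1 \<and> e \<noteq> d2) ps)"
proof -
  let ?f = "face_succ G"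
  have cs: "distinct (r # ps)" "set (r # ps) = Ar G" "map ?f (r # ps) = ps @ [r]"
    using c by (auto simp: contour_def)
  define f1 where "f1 e = (if ?f e = d1 then ?f d1 else ?f e)" for e
  have d: "d1 \<in> set ps" "d2 \<in> set ps" using ds cs(2) by auto
  have m1: "map f1 (r # remove1 d1 ps) = remove1 d1 ps @ [r]"
    using delete_cycle[OF cs(1) d(1) cs(3)] unfolding f1_def by simp
  have dist1: "distinct (r # remove1 d1 ps)" using cs(1) by (auto dest: notin_set_remove1)
  have d2': "d2 \<in> set (remove1 d1 ps)" using d ds(3) by simp
  have m2: "map (\<lambda>e. if f1 e = d2 then f1 d2 else f1 e) (r # remove1 d2 (remove1 d1 ps)) =
    remove1 d2 (remove1 d1 ps) @ [r]"
    by (rule delete_cycle[OF dist1 d2' m1])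
  have rm: "remove1 d2 (remove1 d1 ps) = filter (\<lambda>e. e \<noteq> d1 \<and> e \<noteq> d2) ps"
    using cs(1) by (auto simp: distinct_remove1_removeAll removeAll_filter_not_eq intro: filter_cong)
  let ?q = "filter (\<lambda>e. e \<noteq> d1 \<and> e \<noteq> d2) ps"
  have set: "set (r # ?q) = Ar H" using cs(2) ar ds by auto
  have "face_succ H e = (if f1 e = d2 then f1 d2 else f1 e)" if "e \<in> Ar H" for e
    using fs[OF that] nx by (auto simp: f1_def)
  then have "map (face_succ H) (r # ?q) = map (\<lambda>e. if f1 e = d2 then f1 d2 else f1 e) (r # ?q)"
    using set by (intro map_cong) auto
  then have "map (face_succ H) (r # ?q) = ?q @ [r]" using m2 unfolding rm by (rule trans)
  moreover have "distinct (r # ?q)" using cs(1) by simp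
  ultimately show ?thesis using set unfolding contour_def by blast
qed

text \<open>The common core of contraction and removal: one internal vertex and two arcs disappear,
  which keeps V = E + 1 and leaves a contour by \<open>fs\<close>. Tails change only between
  internal vertices (\<open>srcH\<close>), so the boundary tails along the contour, and with them
  the clockwise order, stay the same.\<close>

lemma is_ptree_delete:
  assumes G: "is_ptree G" and finH: "fin_digraph (ugraph H)"
    and bidH: "bidirected_digraph (ugraph H) (rev_arc H)"
    and outH: "\<And>e. e \<notin> Ar H \<Longrightarrow> rot H e = e"
    and cycH: "\<And>w. w \<in> Vs H \<Longrightarrow> cyclic_on (rot H) (outs H w)"
    and ds: "d1 \<in> Ar G" "d2 \<in> Ar G" "d1 \<noteq> d2"
    and nx: "face_succ G d1 \<noteq> d2" "face_succ G d2 \<noteq> d1"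
    and ar: "Ar H = Ar G - {d1, d2}"
    and fs: "\<And>e. e \<in> Ar H \<Longrightarrow> face_succ H e = (if face_succ G e = d1 then face_succ G d1
      else if face_succ G e = d2 then face_succ G d2 else face_succ G e)"
    and vs: "Vs H = Vs G - {v}" "v \<in> internal G"
    and bd: "bdry H = bdry G" and bl: "black H = black G - {v}"
    and srcd: "src G d1 \<notin> set (bdry G)" "src G d2 \<notin> set (bdry G)"
    and srcH: "\<And>e. e \<in> Ar H \<Longrightarrow>
      src H e = src G e \<or> (src H e \<notin> set (bdry G) \<and> src G e \<notin> set (bdry G))"
    and degH: "\<And>w. w \<in> internal H \<Longrightarrow> deg H w \<noteq> 1"
  shows "is_ptree H"
proof -
  have pg: "plabic_graph G" "bdry G \<noteq> []" using G by (auto simp: is_ptree_def)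
  obtain r where r: "is_root G r" "rooted_tree G r (tree_of G)"
    using treelike_root[OF is_ptree_treelike[OF G] pg(2)] .
  interpret rooted_tree G r "tree_of G" by (rule r(2))
  define ps where "ps = map (amap G r) (tl (walk (tree_of G) []))"
  have c: "contour G r ps" unfolding ps_def by (rule contour_G)
  have rn: "r \<noteq> d1" "r \<noteq> d2" using root srcd by auto
  define qs where "qs = filter (\<lambda>e. e \<noteq> d1 \<and> e \<noteq> d2) ps"
  have cH: "contour H r qs"
    unfolding qs_def by (rule contour_delete[OF c ds rn nx ar fs])
  have int: "internal H = internal G - {v}" using vs bd by (auto simp: internal_def)
  have count: "card (Vs H) = card (Ar H) div 2 + 1"
  proof -
    have "card (Vs H) = card (Vs G) - 1" using vs by (simp add: internal_def)
    moreover have "card (Ar H) = card (Ar G) - 2" unfolding ar using ds by (subst card_Diff_subset) auto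
    moreover have "card {d1, d2} \<le> card (Ar G)" using ds by (intro card_mono) auto
    moreover have "card (Vs G) = card (Ar G) div 2 + 1" using G by (simp add: is_ptree_def)
    ultimately show ?thesis using ds(3) by auto
  qed
  have planar: "planar_map H"
    by (rule planar_mapI[OF finH bidH rot_permutesI[OF finH cycH outH] cycH cH count])
  have Q: "src H e \<in> set (bdry G) \<longleftrightarrow> src G e \<in> set (bdry G)" if "e \<in> Ar H" for e
    using srcH[OF that] by auto
  have outsb: "outs H w = outs G w" if w: "w \<in> set (bdry G)" for w
    using srcH srcd w ar by (auto; metis)
  have pm: "plabic_map H"
    unfolding plabic_map_def
  proof (intro conjI allI impI)
    show "Digraph_Component.connected (ugraph H)" using planar by (simp add: planar_map_def)
    show "rot H permutes Ar H" by (rule rot_permutesI[OF finH cycH outH])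
    show "set (bdry H) \<subseteq> Vs H" using bdry_sub vs bd by (auto simp: internal_def)
    show "black H \<subseteq> internal H" using bl black_sub int by auto
    fix w assume "w \<in> set (bdry H)"
    then show "deg H w = 1" using outsb[of w] bdry_deg[of w] bd by (simp add: deg_def out_degree_def)
  qed (use finH bidH cycH degH in auto)
  interpret H: plabic_map H by (rule pm)
  have rH: "src H r = bdry H ! 0"
  proof -
    have "r \<in> Ar H" using ar root(1) rn by auto
    then have "src H r = src G r" using srcH root(2) by auto
    then show ?thesis using r(1) bd by (simp add: is_root_def)
  qed
  have d: "distinct (bdry G)" "boundary_clockwise G" using pg by (auto simp: plabic_graph_def)
  have seteq: "set (r # ps) = Ar G" "set (r # qs) = Ar H" using c cH by (auto simp: contour_def)
  have "map (src H) (filter (\<lambda>e. src H e \<in> set (bdry H)) (r # qs)) =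
    map (src G) (filter (\<lambda>e. src G e \<in> set (bdry G)) (r # ps))"
  proof -
    have "filter (\<lambda>e. src H e \<in> set (bdry H)) (r # qs) = filter (\<lambda>e. src G e \<in> set (bdry G)) (r # qs)"
      by (rule filter_cong) (use Q bd seteq in auto)
    also have "\<dots> = filter (\<lambda>e. src G e \<in> set (bdry G)) (r # ps)"
      unfolding qs_def using srcd by (auto simp: filter_filter intro!: filter_cong)
    finally have eq: "filter (\<lambda>e. src H e \<in> set (bdry H)) (r # qs) =
      filter (\<lambda>e. src G e \<in> set (bdry G)) (r # ps)" .
    have "src H e = src G e" if "e \<in> set (filter (\<lambda>e. src H e \<in> set (bdry H)) (r # qs))" for e
    proof -
      have "e \<in> Ar H" "src H e \<in> set (bdry H)" using that seteq(2) by (simp_all only: set_filter mem_Collect_eq)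
      then show ?thesis using srcH bd by auto
    qed
    then have "map (src H) (filter (\<lambda>e. src H e \<in> set (bdry H)) (r # qs)) =
      map (src G) (filter (\<lambda>e. src H e \<in> set (bdry H)) (r # qs))"
      by (intro map_cong[OF refl])
    then show ?thesis unfolding eq .
  qed
  also have "\<dots> = bdry G"
    using boundary_clockwise_iff[OF c _ pg(2) d(1)] d(2) r(1) by (simp add: is_root_def)
  finally have "boundary_clockwise H"
    using H.boundary_clockwise_iff[OF cH rH] pg(2) d(1) bd by simp
  then show ?thesis
    unfolding is_ptree_def plabic_graph_def
    using planar pg(2) d(1) bd H.bdry_sub H.bdry_deg H.internal_deg H.black_sub count by auto
qed

lemma list_all2_choice:
  assumes "list_all2 (\<lambda>c t. \<exists>t'. R c t' \<and> P t' t) cs ts"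
  obtains ts' where "list_all2 R cs ts'" "list_all2 P ts' ts"
proof -
  have "\<exists>ts'. list_all2 R cs ts' \<and> list_all2 P ts' ts"
    using assms by (induction cs ts rule: list_all2_induct) (blast intro: list_all2_Cons[THEN iffD2])+
  then show ?thesis using that by blast
qed

lemma list_all2_map_eq: "list_all2 (\<lambda>s t. f s = f t) ss ts \<longleftrightarrow> map f ss = map f ts"
  by (induction ss arbitrary: ts) (auto simp: list_all2_Cons1 Cons_eq_map_conv)

section \<open>Contraction\<close>

text \<open>The cycle of \<open>d'\<close> is inserted in place of \<open>d\<close>. An entry that
  led to \<open>d\<close> now leads to the successor of \<open>d'\<close>, and one that led back to
  \<open>d'\<close> now leads to the successor of \<open>d\<close>.\<close>

lemma splice_cycle:
  assumes f: "map f (y # us @ d # vs) = us @ d # vs @ [y]" and f': "map f (d' # bs) = bs @ [d']"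
    and bs: "bs \<noteq> []"
    and nd: "d \<notin> set (us @ bs @ vs @ [y])" "d' \<notin> set (us @ bs @ vs @ [y])" "d \<noteq> d'"
    and h: "\<And>e. e \<in> set (y # us @ bs @ vs) \<Longrightarrow>
      h e = (if f e = d then f d' else if f e = d' then f d else f e)"
  shows "map h (y # us @ bs @ vs) = us @ bs @ vs @ [y]"
proof -
  define k where "k z = (if z = d then f d' else if z = d' then f d else z)" for z
  have *: "map h xs = map k (map f xs)" if "set xs \<subseteq> set (y # us @ bs @ vs)" for xs
  proof -
    have "h e = k (f e)" if "e \<in> set (y # us @ bs @ vs)" for e using h[OF that] by (simp add: k_def)
    then show ?thesis using that by (auto intro!: map_cong)
  qed
  have k: "map k xs = xs" if "d \<notin> set xs" "d' \<notin> set xs" for xs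
    using that by (intro map_idI) (auto simp: k_def)
  have "take (Suc (length us)) (map f (y # us @ d # vs)) = take (Suc (length us)) (us @ d # vs @ [y])"
    unfolding f ..
  then have 1: "map f (y # us) = us @ [d]" by simp
  have "drop (Suc (length us)) (map f (y # us @ d # vs)) = drop (Suc (length us)) (us @ d # vs @ [y])"
    unfolding f ..
  then have 2: "f d # map f vs = vs @ [y]" by simp
  have 3: "f d' # map f bs = bs @ [d']" using f' by simp
  obtain b bs' where b: "bs = b # bs'" using bs by (cases bs) auto
  have fb: "f d' = b" "map f bs = bs' @ [d']" using 3 b by auto
  obtain z zs where z: "vs @ [y] = z # zs" by (cases "vs @ [y]") auto
  have fz: "f d = z" "map f vs = zs" using 2 z by auto
  have "set zs \<subseteq> set (vs @ [y])" using z by auto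
  then have zs: "d \<notin> set zs" "d' \<notin> set zs" using nd by auto
  have "map h (y # us @ bs @ vs) = map k (map f (y # us)) @ map k (map f bs) @ map k (map f vs)"
    using *[of "y # us @ bs @ vs"] by simp
  also have "map k (map f (y # us)) = us @ [b]"
    unfolding 1 using k[of us] nd fb by (simp add: k_def)
  also have "map k (map f bs) = bs' @ [z]"
    unfolding fb(2) using k[of bs'] nd fz b by (simp add: k_def)
  also have "map k (map f vs) = zs" unfolding fz(2) by (rule k[OF zs])
  finally show ?thesis using b z by simp
qed

locale contraction = plabic_map +
  fixes a :: nat
  assumes a: "a \<in> Ar G" and uv: "src G a \<noteq> tgt G a"
    and int: "src G a \<in> internal G" "tgt G a \<in> internal G"
    and col: "src G a \<in> black G \<longleftrightarrow> tgt G a \<in> black G"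
begin

abbreviation "a' \<equiv> rev_arc G a"
abbreviation "H \<equiv> contract G a"
abbreviation "u \<equiv> src G a"
abbreviation "v \<equiv> tgt G a"

lemma H_simps:
  "Vs H = Vs G - {v}" "Ar H = Ar G - {a, a'}"
  "src H e = (if src G e = v then u else src G e)" "tgt H e = (if tgt G e = v then u else tgt G e)"
  "rev_arc H e = (if e = a \<or> e = a' then e else rev_arc G e)"
  "rot H e = (if e = a \<or> e = a' then e else if rot G e = a then rot G a'
     else if rot G e = a' then rot G a else rot G e)"
  "black H = black G - {v}" "bdry H = bdry G" "internal H = internal G - {v}"
  by (auto simp: contract_def Let_def internal_def)

lemma a': "a' \<in> Ar G" "a' \<noteq> a" "src G a' = v" "tgt G a' = u"
  using a arev_neq by auto

text \<open>Seen from the root, the contracted edge may point either way, so \<open>d\<close> stands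
  for whichever of its two arcs leads away from the root.\<close>

lemma pairE:
  assumes "d = a \<or> d = a'"
  obtains d' where "d' = rev_arc G d" "{d, d'} = {a, a'}" "d \<in> Ar G" "d' \<in> Ar G" "d \<noteq> d'"
    "{src G d, tgt G d} = {u, v}" "src G d' = tgt G d" "tgt G d \<in> internal G" "src G d \<noteq> tgt G d"
    "src G d \<in> black G \<longleftrightarrow> tgt G d \<in> black G"
  using assms that[of "rev_arc G d"] a a' uv int col by (auto simp: insert_commute)

lemma deg_ge2:
  assumes "w \<in> internal G" shows "card (outs G w) \<ge> 2"
proof -
  have "w \<in> Vs G" using assms by (simp add: internal_def)
  then have "card (outs G w) \<noteq> 0" using outs_nonempty by (simp add: finite_out_arcs)
  moreover have "card (outs G w) \<noteq> 1" using internal_deg[OF assms] by (simp add: deg_def out_degree_def)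
  ultimately show ?thesis by linarith
qed

lemma outs_H: "outs H u = outs G u \<union> outs G v - {a, a'}" "w \<noteq> u \<Longrightarrow> w \<noteq> v \<Longrightarrow> outs H w = outs G w"
  using uv a' by (auto simp: H_simps)

lemma splice_star:
  assumes d: "d = a \<or> d = a'" and d': "d' = rev_arc G d"
    and y: "distinct (y # us @ d # vs)" "set (y # us @ d # vs) = outs G (src G d)"
      "map (rot G) (y # us @ d # vs) = us @ d # vs @ [y]"
    and b: "distinct (d' # bs)" "set (d' # bs) = outs G (tgt G d)" "map (rot G) (d' # bs) = bs @ [d']"
  shows "distinct (y # us @ bs @ vs)" "set (y # us @ bs @ vs) = outs H u"
    "map (rot H) (y # us @ bs @ vs) = us @ bs @ vs @ [y]" "bs \<noteq> []"
proof -
  obtain d'' where D: "d'' = rev_arc G d" "{d, d''} = {a, a'}" "d \<in> Ar G" "d'' \<in> Ar G" "d \<noteq> d''"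
    "{src G d, tgt G d} = {u, v}" "src G d'' = tgt G d" "tgt G d \<in> internal G" "src G d \<noteq> tgt G d"
    using pairE[OF d] by metis
  have dd: "d'' = d'" using D(1) d' by simp
  have disj: "outs G (src G d) \<inter> outs G (tgt G d) = {}" using D(9) by auto
  have dj: "set (y # us @ d # vs) \<inter> set (d' # bs) = {}" unfolding y(2) b(2) by (rule disj)
  show dist: "distinct (y # us @ bs @ vs)" using y(1) b(1) dj by auto
  show bs: "bs \<noteq> []"
  proof
    assume "bs = []"
    then have "outs G (tgt G d) = {d'}" using b(2) by simp
    then show False using deg_ge2[OF D(8)] by simp
  qed
  have "outs G u \<union> outs G v = outs G (src G d) \<union> outs G (tgt G d)"
    using D(6) by (auto simp: doubleton_eq_iff)
  also have "\<dots> = set (y # us @ d # vs) \<union> set (d' # bs)" unfolding y(2) b(2) ..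
  finally have "outs H u = (set (y # us @ d # vs) \<union> set (d' # bs)) - {d, d'}"
    unfolding outs_H(1) using D(2) dd by auto
  also have "\<dots> = set (y # us @ bs @ vs)" using y(1) b(1) dj by auto
  finally show seteq: "set (y # us @ bs @ vs) = outs H u" ..
  show "map (rot H) (y # us @ bs @ vs) = us @ bs @ vs @ [y]"
  proof (rule splice_cycle[OF y(3) b(3) bs])
    show "d \<notin> set (us @ bs @ vs @ [y])" "d' \<notin> set (us @ bs @ vs @ [y])" "d \<noteq> d'"
      using y(1) b(1) dj by auto
    fix e assume "e \<in> set (y # us @ bs @ vs)"
    then have "e \<noteq> a" "e \<noteq> a'" unfolding seteq by (auto simp: H_simps)
    then show "rot H e = (if rot G e = d then rot G d' else if rot G e = d' then rot G d else rot G e)"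
      using d D(2) dd a'(2) by (auto simp: H_simps doubleton_eq_iff)
  qed
qed

lemma rot_neq: "rot G a \<noteq> a" "rot G a' \<noteq> a'"
proof -
  have "rot G d \<noteq> d" if "d \<in> Ar G" "src G d \<in> internal G" for d
  proof
    assume "rot G d = d"
    then have "orbit (rot G) d = {d}" by (simp add: orbit_eq_singleton_iff)
    moreover have "orbit (rot G) d = outs G (src G d)"
      by (rule orbit_cyclic_eq3[OF rot_cyclic]) (use that in auto)
    ultimately show False using deg_ge2[OF that(2)] by simp
  qed
  then show "rot G a \<noteq> a" "rot G a' \<noteq> a'" using a a' int by auto
qed

lemma is_ptree_contract:
  assumes "is_ptree G"
  shows "is_ptree H"
proof (rule is_ptree_delete[OF assms, where v = v and ?d1.0 = a and ?d2.0 = a'])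
  have uH: "u \<in> Vs H" using uv a by (auto simp: H_simps)
  have wfH: "wf_digraph (ugraph H)"
    by unfold_locales (use uH in \<open>auto simp: H_simps\<close>)
  show "fin_digraph (ugraph H)"
    using wfH by (simp add: fin_digraph_def fin_digraph_axioms_def H_simps)
  have revH: "rev_arc G e \<noteq> a" "rev_arc G e \<noteq> a'" if "e \<noteq> a" "e \<noteq> a'" for e
    using that by (metis arev_arev, simp add: arev_eq_iff)
  show "bidirected_digraph (ugraph H) (rev_arc H)"
  proof (rule wf_digraph.bidirected_digraphI[OF wfH])
    fix e assume "e \<notin> Ar H"
    then show "rev_arc H e = e" using arev_eq[of e] by (auto simp: H_simps)
  next
    fix e assume e: "e \<in> Ar H"
    then show "rev_arc H e \<noteq> e" "rev_arc H (rev_arc H e) = e" "src H (rev_arc H e) = tgt H e"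
      using arev_neq[of e] revH[of e] by (auto simp: H_simps)
  qed
  show "rot H e = e" if "e \<notin> Ar H" for e
  proof (cases "e = a \<or> e = a'")
    case False
    then have "e \<notin> Ar G" using that by (auto simp: H_simps)
    then have "rot G e = e" using rot_permutes by (simp add: permutes_not_in)
    then show ?thesis using False by (simp add: H_simps)
  qed (auto simp: H_simps)
  have spl: "cyclic_on (rot H) (outs H u) \<and> card (outs H u) \<ge> 2"
  proof -
    have "rot G a \<in> outs G u" using a by (simp add: rot_in src_rot)
    then obtain cs where cs: "distinct (rot G a # cs)" "set (rot G a # cs) = outs G u"
      "map (rot G) (rot G a # cs) = cs @ [rot G a]"
      using cyclic_on_ex_list[OF rot_cyclic[of u]] int by (auto simp: internal_def)
    have "a \<in> set (rot G a # cs)" unfolding cs(2) using a by simp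
    then have "a \<in> set cs" using rot_neq(1) by auto
    then obtain us vs where sp: "cs = us @ a # vs" by (auto simp: in_set_conv_decomp)
    obtain bs where bs: "distinct (a' # bs)" "set (a' # bs) = outs G v"
      "map (rot G) (a' # bs) = bs @ [a']"
      using cyclic_on_ex_list[OF rot_cyclic[of v], of a'] int a' by (auto simp: internal_def)
    have 1: "distinct (rot G a # us @ bs @ vs)" "set (rot G a # us @ bs @ vs) = outs H u"
      "map (rot H) (rot G a # us @ bs @ vs) = us @ bs @ vs @ [rot G a]" "bs \<noteq> []"
      using splice_star[of a a' "rot G a" us vs bs] cs bs sp by simp_all
    have "card (outs H u) = length (rot G a # us @ bs @ vs)"
      using distinct_card[OF 1(1)] unfolding 1(2) .
    then show ?thesis using cyclic_on_list[of "rot H" "rot G a" "us @ bs @ vs"] 1 by (cases bs) auto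
  qed
  show "cyclic_on (rot H) (outs H w)" if w: "w \<in> Vs H" for w
  proof (cases "w = u")
    case False
    have wv: "w \<noteq> v" "w \<in> Vs G" using w by (auto simp: H_simps)
    have "rot H e = rot G e" if "e \<in> outs G w" for e
    proof -
      have "src G (rot G e) = w" using that by (auto simp: src_rot)
      then have "rot G e \<noteq> a" "rot G e \<noteq> a'" using False wv a' by auto
      moreover have "e \<noteq> a" "e \<noteq> a'" using that False wv a' by auto
      ultimately show ?thesis by (simp add: H_simps)
    qed
    then have "cyclic_on (rot H) (outs G w) = cyclic_on (rot G) (outs G w)" by (rule cyclic_cong)
    then show ?thesis using rot_cyclic[OF wv(2)] outs_H(2)[OF False wv(1)] by simp
  qed (use spl in simp)
  show "a \<in> Ar G" "a' \<in> Ar G" "a \<noteq> a'" using a a' by auto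
  show "face_succ G a \<noteq> a'" "face_succ G a' \<noteq> a" using rot_neq by (auto simp: face_succ_def)
  show "face_succ H e = (if face_succ G e = a then face_succ G a
      else if face_succ G e = a' then face_succ G a' else face_succ G e)" if "e \<in> Ar H" for e
    using that revH[of e] by (auto simp: face_succ_def H_simps)
  show "src H e = src G e \<or> (src H e \<notin> set (bdry G) \<and> src G e \<notin> set (bdry G))" if "e \<in> Ar H" for e
    using int by (auto simp: H_simps internal_def)
  show "deg H w \<noteq> 1" if w: "w \<in> internal H" for w
    using spl outs_H(2)[of w] internal_deg[of w] w
    by (cases "w = u") (auto simp: deg_def out_degree_def H_simps)
qed (use int a' in \<open>auto simp: H_simps internal_def\<close>)

lemma card_contract: "card (Ar H) < card (Ar G)"
  unfolding H_simps(2) using a by (intro psubset_card_mono) auto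

text \<open>The two arcs of the contracted edge have no tree in \<open>H\<close>. For them the
  induction records instead the cycle of child arcs at the head and their new subtrees, which the
  parent splices into its own list of children.\<close>

lemma rep_contract:
  assumes "rep G x t"
  shows "(x \<noteq> a \<and> x \<noteq> a' \<longrightarrow> (\<exists>t'. rep H x t' \<and> nf t' = nf t)) \<and>
    (x = a \<or> x = a' \<longrightarrow> (\<exists>cs ts ts'. distinct (rev_arc G x # cs) \<and> set (rev_arc G x # cs) = outs G (tgt G x) \<and>
       map (rot G) (rev_arc G x # cs) = cs @ [rev_arc G x] \<and> t = Node (tgt G x \<in> black G) ts \<and>
       list_all2 (rep H) cs ts' \<and> map nf ts' = map nf ts))"
  using assms
proof (induction x t rule: rep.induct)
  case (rep_Leaf x)
  then have "x \<noteq> a" "x \<noteq> a'" "tgt G x \<noteq> v" using int a' by (auto simp: internal_def)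
  then have "rep H x Leaf" using rep_Leaf by (intro rep.rep_Leaf) (auto simp: H_simps)
  then show ?case using \<open>x \<noteq> a\<close> \<open>x \<noteq> a'\<close> by blast
next
  case (rep_Node x cs ts)
  let ?y = "rev_arc G x"
  note xA = rep_Node.hyps(1) and xint = rep_Node.hyps(2) and cs = rep_Node.hyps(3-5)
  define Q where "Q c t \<longleftrightarrow> rep G c t \<and> (c \<noteq> a \<and> c \<noteq> a' \<longrightarrow> (\<exists>t'. rep H c t' \<and> nf t' = nf t)) \<and>
    (c = a \<or> c = a' \<longrightarrow> (\<exists>cs ts ts'. distinct (rev_arc G c # cs) \<and> set (rev_arc G c # cs) = outs G (tgt G c) \<and>
       map (rot G) (rev_arc G c # cs) = cs @ [rev_arc G c] \<and> t = Node (tgt G c \<in> black G) ts \<and>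
       list_all2 (rep H) cs ts' \<and> map nf ts' = map nf ts))" for c t
  have IH: "list_all2 Q cs ts" using rep_Node.IH unfolding Q_def by simp
  have sub: "\<exists>ts'. list_all2 (rep H) ds ts' \<and> map nf ts' = map nf us"
    if "list_all2 Q ds us" "a \<notin> set ds" "a' \<notin> set ds" for ds us
  proof -
    have "list_all2 (\<lambda>c t. \<exists>t'. rep H c t' \<and> nf t' = nf t) ds us"
      by (rule list.rel_mono_strong[OF that(1)]) (use that(2,3) in \<open>auto simp: Q_def\<close>)
    then obtain ts' where "list_all2 (rep H) ds ts'" "list_all2 (\<lambda>s t. nf s = nf t) ts' us"
      by (rule list_all2_choice)
    then show ?thesis unfolding list_all2_map_eq by blast
  qed
  have inc: "set cs \<subseteq> outs G (tgt G x)" unfolding cs(2)[symmetric] by auto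
  show ?case
  proof (cases "x = a \<or> x = a'")
    case True
    then have nin: "a \<notin> set cs" "a' \<notin> set cs"
      using cs(1) inc uv a a' by auto
    obtain ts' where "list_all2 (rep H) cs ts'" "map nf ts' = map nf ts"
      using sub[OF IH nin] by blast
    then show ?thesis using True cs by blast
  next
    case False
    then have yn: "?y \<noteq> a" "?y \<noteq> a'" by (metis arev_arev, simp add: arev_eq_iff)
    have xH: "x \<in> Ar H" using False xA by (simp add: H_simps)
    have yH: "rev_arc H x = ?y" using False by (simp add: H_simps)
    have "\<exists>t'. rep H x t' \<and> nf t' = nf (Node (tgt G x \<in> black G) ts)"
    proof (cases "a \<in> set cs \<or> a' \<in> set cs")
      case nin: False
      obtain ts' where ts': "list_all2 (rep H) cs ts'" "map nf ts' = map nf ts"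
        using sub[OF IH] nin by blast
      have nn: "a \<notin> set (?y # cs)" "a' \<notin> set (?y # cs)" using nin yn by auto
      have w: "tgt G x \<noteq> u" "tgt G x \<noteq> v" using nn unfolding cs(2) using a a' by auto
      have tH: "tgt H x = tgt G x" using w by (simp add: H_simps)
      have "rep H x (Node (tgt H x \<in> black H) ts')"
      proof (rule rep.rep_Node[OF xH])
        show "tgt H x \<in> internal H" using xint w by (simp add: H_simps)
        show "distinct (rev_arc H x # cs)" unfolding yH by (rule cs(1))
        show "set (rev_arc H x # cs) = outs H (tgt H x)"
          unfolding yH tH using cs(2) outs_H(2)[OF w] by simp
        have "rot H e = rot G e" if e: "e \<in> set (?y # cs)" for e
        proof -
          have "rot G e \<in> set (map (rot G) (?y # cs))" using e by (simp only: set_map) (rule imageI)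
          then have "rot G e \<in> set (?y # cs)" unfolding cs(3) by auto
          then show ?thesis using nn e by (auto simp: H_simps)
        qed
        then have "map (rot H) (?y # cs) = map (rot G) (?y # cs)" by (intro map_cong) auto
        then show "map (rot H) (rev_arc H x # cs) = cs @ [rev_arc H x]" unfolding yH cs(3)[symmetric] .
      qed (rule ts'(1))
      moreover have "tgt H x \<in> black H \<longleftrightarrow> tgt G x \<in> black G" unfolding tH using w by (simp add: H_simps)
      ultimately have "rep H x (Node (tgt G x \<in> black G) ts')" by simp
      then show ?thesis using nf_Node_cong[OF ts'(2)] by blast
    next
      case True
      then obtain d where d: "d = a \<or> d = a'" "d \<in> set cs" by blast
      obtain d' where D: "d' = rev_arc G d" "{d, d'} = {a, a'}" "d \<in> Ar G" "d' \<in> Ar G" "d \<noteq> d'"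
        "{src G d, tgt G d} = {u, v}" "src G d' = tgt G d" "tgt G d \<in> internal G" "src G d \<noteq> tgt G d"
        "src G d \<in> black G \<longleftrightarrow> tgt G d \<in> black G"
        using pairE[OF d(1)] by metis
      have td: "tgt G x = src G d" using d(2) inc by auto
      have d'n: "d' \<notin> set cs" using inc D(7,9) td by auto
      obtain us vs where csp: "cs = us @ d # vs" using d(2) by (auto simp: in_set_conv_decomp)
      obtain ts1 s ts2 where tsp: "ts = ts1 @ s # ts2" and IH1: "list_all2 Q us ts1"
        and IHd: "Q d s" and IH2: "list_all2 Q vs ts2"
        using IH unfolding csp list_all2_append1 list_all2_Cons1 by blast
      have nin: "a \<notin> set us" "a' \<notin> set us" "a \<notin> set vs" "a' \<notin> set vs"
        using cs(1) d'n D(2) d(1) unfolding csp by auto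
      obtain ts1' where t1: "list_all2 (rep H) us ts1'" "map nf ts1' = map nf ts1"
        using sub[OF IH1 nin(1,2)] by blast
      obtain ts2' where t2: "list_all2 (rep H) vs ts2'" "map nf ts2' = map nf ts2"
        using sub[OF IH2 nin(3,4)] by blast
      obtain bs ss ss' where b: "distinct (d' # bs)" "set (d' # bs) = outs G (tgt G d)"
        "map (rot G) (d' # bs) = bs @ [d']" and s: "s = Node (tgt G d \<in> black G) ss"
        and bss: "list_all2 (rep H) bs ss'" "map nf ss' = map nf ss"
        using IHd d(1) unfolding D(1) Q_def by blast
      have y: "distinct (?y # us @ d # vs)" "set (?y # us @ d # vs) = outs G (src G d)"
        "map (rot G) (?y # us @ d # vs) = us @ d # vs @ [?y]"
        using cs unfolding csp td by simp_all
      note spl = splice_star[OF d(1) D(1) y b]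
      have tH: "tgt H x = u" using td D(6) by (auto simp: H_simps doubleton_eq_iff)
      have "rep H x (Node (tgt H x \<in> black H) (ts1' @ ss' @ ts2'))"
      proof (rule rep.rep_Node[OF xH])
        show "tgt H x \<in> internal H" unfolding tH using int uv by (simp add: H_simps)
        show "distinct (rev_arc H x # us @ bs @ vs)" unfolding yH by (rule spl(1))
        show "set (rev_arc H x # us @ bs @ vs) = outs H (tgt H x)" unfolding yH tH by (rule spl(2))
        show "map (rot H) (rev_arc H x # us @ bs @ vs) = (us @ bs @ vs) @ [rev_arc H x]"
          unfolding yH using spl(3) by simp
        show "list_all2 (rep H) (us @ bs @ vs) (ts1' @ ss' @ ts2')"
          by (intro list_all2_appendI t1(1) t2(1) bss(1))
      qed
      moreover have "nf (Node (tgt H x \<in> black H) (ts1' @ ss' @ ts2')) = nf (Node (tgt G x \<in> black G) ts)"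
      proof -
        let ?c = "tgt G x \<in> black G"
        have c1: "tgt H x \<in> black H \<longleftrightarrow> ?c" "tgt G d \<in> black G \<longleftrightarrow> ?c"
          unfolding tH td using D(6,10) uv col by (auto simp: H_simps doubleton_eq_iff)
        have "rep G d s" using IHd unfolding Q_def by blast
        then have "wf_tree s" by (rule rep_wf)
        then have wf: "\<forall>t\<in>set ss. wf_tree t" unfolding s by simp
        have "nf (Node ?c (ts1' @ ss' @ ts2')) = nf (Node ?c (ts1 @ ss @ ts2))"
          by (rule nf_Node_cong) (simp add: t1(2) t2(2) bss(2))
        also have "\<dots> = nf (Node ?c (ts1 @ Node ?c ss # ts2))" by (rule nf_merge[OF wf, symmetric])
        finally show ?thesis unfolding c1(1) tsp s c1(2) .
      qed
      ultimately show ?thesis by blast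
    qed
    then show ?thesis using False by blast
  qed
qed

end

section \<open>Removal of vertices of degree 2\<close>

locale removal = plabic_map +
  fixes v a b :: nat
  assumes v: "v \<in> internal G" and ab: "a \<noteq> b" "rev_arc G a \<noteq> b" and outs_v: "outs G v = {a, b}"
begin

abbreviation "a' \<equiv> rev_arc G a"
abbreviation "b' \<equiv> rev_arc G b"
abbreviation "H \<equiv> remove_deg2 G v a b"

lemma a: "a \<in> Ar G" "src G a = v" and b: "b \<in> Ar G" "src G b = v"
proof -
  have "a \<in> outs G v" "b \<in> outs G v" unfolding outs_v by auto
  then show "a \<in> Ar G" "src G a = v" "b \<in> Ar G" "src G b = v" by auto
qed

lemma rev_ab: "b' \<noteq> a" "a' \<noteq> a" "b' \<noteq> b" "a' \<noteq> b'" "a' \<noteq> b" "a \<noteq> b"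
proof -
  show "b' \<noteq> a" using ab(2) by (metis arev_arev)
  show "a' \<noteq> a" "b' \<noteq> b" using a b arev_neq by auto
qed (use ab in \<open>auto simp: arev_eq_iff\<close>)

lemma H_simps:
  "Vs H = Vs G - {v}" "Ar H = Ar G - {a, b}" "src H e = src G e"
  "tgt H e = (if e = b' then tgt G a else if e = a' then tgt G b else tgt G e)"
  "rev_arc H e = (if e = b' then a' else if e = a' then b' else if e = a \<or> e = b then e else rev_arc G e)"
  "rot H e = (if e = a \<or> e = b then e else rot G e)"
  "black H = black G - {v}" "bdry H = bdry G" "internal H = internal G - {v}"
  by (auto simp: remove_deg2_def Let_def internal_def)

lemma tgt_ab: "tgt G a \<noteq> v" "tgt G b \<noteq> v"
proof -
  have "e \<noteq> a' \<Longrightarrow> e \<noteq> b' \<Longrightarrow> tgt G e \<noteq> v" if "e \<in> Ar G" for e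
  proof
    assume e: "e \<noteq> a'" "e \<noteq> b'" "tgt G e = v"
    then have "rev_arc G e \<in> outs G v" using that by auto
    then show False unfolding outs_v using e by auto
  qed
  then show "tgt G a \<noteq> v" "tgt G b \<noteq> v" using a b rev_ab by metis+
qed

lemma tgt_v:
  assumes "e \<in> Ar G" shows "tgt G e = v \<longleftrightarrow> e = a' \<or> e = b'"
proof
  assume "tgt G e = v"
  then have "rev_arc G e \<in> outs G v" using assms by auto
  then show "e = a' \<or> e = b'" unfolding outs_v by auto
qed (use a b in auto)

lemma src_v:
  assumes "e \<in> Ar G" shows "src G e = v \<longleftrightarrow> e = a \<or> e = b"
proof -
  have "src G e = v \<longleftrightarrow> e \<in> outs G v" using assms by simp
  then show ?thesis unfolding outs_v by simp
qed

lemma outs_H: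
  assumes "w \<noteq> v" shows "outs H w = outs G w"
proof (rule set_eqI)
  fix e show "e \<in> outs H w \<longleftrightarrow> e \<in> outs G w"
    using assms src_v[of e] by (auto simp: H_simps)
qed

lemma rot_ab: "rot G a = b" "rot G b = a"
proof -
  have vV: "v \<in> Vs G" using v by (simp add: internal_def)
  have "rot G d \<noteq> d" if "d \<in> {a, b}" for d
  proof
    assume "rot G d = d"
    then have "orbit (rot G) d = {d}" by (simp add: orbit_eq_singleton_iff)
    moreover have "orbit (rot G) d = outs G v"
      by (rule orbit_cyclic_eq3[OF rot_cyclic[OF vV]]) (unfold outs_v, rule that)
    ultimately show False using ab(1) unfolding outs_v by auto
  qed
  moreover have "rot G d \<in> {a, b}" if "d \<in> {a, b}" for d
    using cyclic_on_inI[OF rot_cyclic[OF vV]] that unfolding outs_v by blast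
  ultimately show "rot G a = b" "rot G b = a" by auto
qed

lemma is_ptree_remove:
  assumes "is_ptree G"
  shows "is_ptree H"
proof (rule is_ptree_delete[OF assms, where v = v and ?d1.0 = a and ?d2.0 = b])
  have wfH: "wf_digraph (ugraph H)"
  proof
    fix e assume e: "e \<in> Ar H"
    then have eA: "e \<in> Ar G" "e \<noteq> a" "e \<noteq> b" by (auto simp: H_simps)
    then show "src H e \<in> Vs H" using src_v[of e] by (simp add: H_simps)
    show "tgt H e \<in> Vs H" using eA(1) tgt_ab tgt_v[of e] a(1) b(1) by (simp add: H_simps)
  qed
  show "fin_digraph (ugraph H)"
    using wfH by (simp add: fin_digraph_def fin_digraph_axioms_def H_simps)
  show "bidirected_digraph (ugraph H) (rev_arc H)"
  proof (rule wf_digraph.bidirected_digraphI[OF wfH])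
    fix e assume "e \<notin> Ar H"
    then have "e \<notin> Ar G \<or> e = a \<or> e = b" by (auto simp: H_simps)
    then show "rev_arc H e = e"
    proof (elim disjE)
      assume e: "e \<notin> Ar G"
      then have "e \<noteq> a'" "e \<noteq> b'" using a(1) b(1) by auto
      then show ?thesis using arev_eq[OF e] by (simp add: H_simps)
    qed (use rev_ab in \<open>auto simp: H_simps\<close>)
  next
    fix e assume e: "e \<in> Ar H"
    then have eA: "e \<in> Ar G" "e \<noteq> a" "e \<noteq> b" by (auto simp: H_simps)
    have re: "e \<noteq> a' \<Longrightarrow> e \<noteq> b' \<Longrightarrow> rev_arc G e \<noteq> a \<and> rev_arc G e \<noteq> b \<and> rev_arc G e \<noteq> a' \<and> rev_arc G e \<noteq> b'"
      using eA by (metis arev_arev)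
    show "rev_arc H e \<noteq> e" "rev_arc H (rev_arc H e) = e" "src H (rev_arc H e) = tgt H e"
      using eA re rev_ab arev_neq[of e] a(1) b(1) by (auto simp: H_simps)
  qed
  show "rot H e = e" if "e \<notin> Ar H" for e
    using that rot_permutes by (auto simp: H_simps permutes_not_in)
  show "cyclic_on (rot H) (outs H w)" if w: "w \<in> Vs H" for w
  proof -
    have wv: "w \<noteq> v" "w \<in> Vs G" using w by (auto simp: H_simps)
    have "rot H e = rot G e" if "e \<in> outs G w" for e
      using that wv(1) src_v[of e] by (auto simp: H_simps)
    then have "cyclic_on (rot H) (outs G w) = cyclic_on (rot G) (outs G w)" by (rule cyclic_cong)
    then show ?thesis using rot_cyclic[OF wv(2)] outs_H[OF wv(1)] by simp
  qed
  show "a \<in> Ar G" "b \<in> Ar G" "a \<noteq> b" using a(1) b(1) ab(1) .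
  have nv: "src G (rot G d) \<noteq> v" if "d = a' \<or> d = b'" for d
    using that tgt_ab a(1) b(1) src_rot[of d] by auto
  show "face_succ G a \<noteq> b" "face_succ G b \<noteq> a"
    using nv[of a'] nv[of b'] a(2) b(2) by (auto simp: face_succ_def)
  show "face_succ H e = (if face_succ G e = a then face_succ G a
      else if face_succ G e = b then face_succ G b else face_succ G e)" if "e \<in> Ar H" for e
  proof -
    \<comment> \<open>\<open>rot\<close> exchanges \<open>a\<close> and \<open>b\<close>, so on the
      contour \<open>b\<close> is preceded by \<open>a'\<close> and \<open>a\<close> by
      \<open>b'\<close>.\<close>
    have 1: "face_succ G e = b \<longleftrightarrow> e = a'" "face_succ G e = a \<longleftrightarrow> e = b'"
      unfolding face_succ_def using rot_ab rot_eq_iff arev_arev by metis+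
    have "rev_arc G e \<noteq> a \<and> rev_arc G e \<noteq> b" if "e \<noteq> a'" "e \<noteq> b'"
      using that by (metis arev_arev)
    then show ?thesis unfolding 1 using that rev_ab ab by (auto simp: face_succ_def H_simps)
  qed
  show "deg H w \<noteq> 1" if w: "w \<in> internal H" for w
    using w outs_H[of w] internal_deg[of w] by (auto simp: deg_def out_degree_def H_simps)
  show "src G a \<notin> set (bdry G)" "src G b \<notin> set (bdry G)"
    unfolding a(2) b(2) using v by (auto simp: internal_def)
qed (use v in \<open>auto simp: H_simps\<close>)

lemma card_remove: "card (Ar H) < card (Ar G)"
  unfolding H_simps(2) using a(1) by (intro psubset_card_mono) auto

text \<open>The arcs \<open>a\<close> and \<open>b\<close> leave the erased vertex; their heads are
  now reached by \<open>b'\<close> and \<open>a'\<close>, whence the renaming. An arc into the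
  erased vertex has a single child arc, which is renamed to that same arc, so the node with one
  child drops out of the tree.\<close>

lemma rep_remove:
  assumes "rep G x t"
  shows "\<exists>t'. rep H (if x = a then b' else if x = b then a' else x) t' \<and> nf t' = nf t"
  using assms
proof (induction x t rule: rep.induct)
  case (rep_Leaf x)
  let ?x = "if x = a then b' else if x = b then a' else x"
  have "tgt G x \<noteq> v" using rep_Leaf(2) v by (auto simp: internal_def)
  then have "x \<noteq> a'" "x \<noteq> b'" using tgt_v[OF rep_Leaf(1)] by auto
  then have "?x \<in> Ar H" "tgt H ?x = tgt G x" using rep_Leaf(1) a(1) b(1) rev_ab by (auto simp: H_simps)
  then have "rep H ?x Leaf" using rep_Leaf by (intro rep.rep_Leaf) (auto simp: H_simps)
  then show ?case by blast
next
  case (rep_Node x cs ts)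
  let ?x = "if x = a then b' else if x = b then a' else x"
  let ?c = "tgt G x \<in> black G"
  note x = rep_Node.hyps(1) and xint = rep_Node.hyps(2) and cs = rep_Node.hyps(3-5)
  have IH: "list_all2 (\<lambda>c t. rep G c t \<and> (\<exists>t'. rep H (if c = a then b' else if c = b then a' else c) t' \<and>
    nf t' = nf t)) cs ts"
    using rep_Node.IH by simp
  show ?case
  proof (cases "x = a' \<or> x = b'")
    case True
    obtain d where d: "cs = [d]" "(if d = a then b' else if d = b then a' else d) = x"
    proof -
      obtain d where d: "d = a \<or> d = b" "rev_arc G x = (if d = a then b else a)" "x = (if d = a then b' else a')"
      proof (cases "x = a'")
        case xa: True
        then have "rev_arc G x = a" by simp
        then show ?thesis using that[of b] xa ab(1) by simp
      next
        case False
        then have xb: "x = b'" using True by simp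
        then have "rev_arc G x = b" by simp
        then show ?thesis using that[of a] xb ab(1) by simp
      qed
      have "tgt G x = v" using tgt_v[OF x] True by simp
      then have "set (rev_arc G x # cs) = {a, b}" unfolding cs(2) outs_v[symmetric] by simp
      then have "set (rev_arc G x # cs) = {rev_arc G x, d}" using d(1,2) ab(1) by (auto split: if_splits)
      moreover have "d \<noteq> rev_arc G x" using d(1,2) ab(1) by (auto split: if_splits)
      moreover have "rev_arc G x \<notin> set cs" using cs(1) by simp
      ultimately have "set cs = {d}" by (metis insert_ident list.simps(15) singletonD insert_commute)
      moreover have "distinct cs" using cs(1) by simp
      ultimately have "length cs = 1" "set cs = {d}" using distinct_card[of cs] by auto
      then have "cs = [d]" by (cases cs) auto
      then show ?thesis using that d by auto
    qed
    then obtain s where s: "ts = [s]" "rep G d s" "\<exists>t'. rep H x t' \<and> nf t' = nf s"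
      using IH by (auto simp: list_all2_Cons1)
    have "?x = x" using True rev_ab by auto
    then show ?thesis using s nf_single[OF rep_wf[OF s(2)], of ?c] by metis
  next
    case False
    have w: "tgt G x \<noteq> v" using tgt_v[OF x] False by simp
    have X: "?x \<in> Ar H" "tgt H ?x = tgt G x" "rev_arc H ?x = rev_arc G x"
      using False x a(1) b(1) rev_ab by (auto simp: H_simps)
    have inc: "set (rev_arc G x # cs) \<subseteq> outs G (tgt G x)" unfolding cs(2) by simp
    then have nab: "e \<noteq> a \<and> e \<noteq> b" if "e \<in> set (rev_arc G x # cs)" for e
      using that w a(2) b(2) by auto
    have "list_all2 (\<lambda>c t. \<exists>t'. rep H c t' \<and> nf t' = nf t) cs ts"
      by (rule list.rel_mono_strong[OF IH]) (use nab in auto)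
    then obtain ts' where ts': "list_all2 (rep H) cs ts'" "list_all2 (\<lambda>s t. nf s = nf t) ts' ts"
      by (rule list_all2_choice)
    have "rep H ?x (Node (tgt H ?x \<in> black H) ts')"
    proof (rule rep.rep_Node[OF X(1)])
      show "tgt H ?x \<in> internal H" unfolding X using xint w by (simp add: H_simps)
      show "distinct (rev_arc H ?x # cs)" unfolding X by (rule cs(1))
      show "set (rev_arc H ?x # cs) = outs H (tgt H ?x)" unfolding X outs_H[OF w] by (rule cs(2))
      have "map (rot H) (rev_arc G x # cs) = map (rot G) (rev_arc G x # cs)"
        by (rule map_cong[OF refl]) (use nab in \<open>auto simp: H_simps\<close>)
      then show "map (rot H) (rev_arc H ?x # cs) = cs @ [rev_arc H ?x]" unfolding X cs(3) .
    qed (rule ts'(1))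
    moreover have "tgt H ?x \<in> black H \<longleftrightarrow> ?c" unfolding X using w by (simp add: H_simps)
    ultimately have "rep H ?x (Node ?c ts')" by simp
    then show ?thesis using nf_Node_cong ts'(2) unfolding list_all2_map_eq by blast
  qed
qed

end

section \<open>The normal form is a complete invariant\<close>

lemma root_tree_of:
  assumes "is_ptree G" "is_root G r"
  shows "rep G r (tree_of G)"
proof -
  have pg: "plabic_graph G" "bdry G \<noteq> []" using assms by (auto simp: is_ptree_def)
  obtain s where s: "is_root G s" "rooted_tree G s (tree_of G)"
    using treelike_root[OF is_ptree_treelike[OF assms(1)] pg(2)] .
  then have "r = s" using plabic_map.root_unique[OF plabic_graph_map[OF pg(1)] pg(2) assms(2)] by simp
  then show ?thesis using rooted_tree.rep[OF s(2)] by simp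
qed

lemma root_exists:
  assumes "is_ptree G"
  obtains r where "is_root G r" "src G r \<in> set (bdry G)" "r \<in> Ar G"
proof -
  have pg: "plabic_graph G" "bdry G \<noteq> []" using assms by (auto simp: is_ptree_def)
  obtain r where "is_root G r" using plabic_map.root_ex[OF plabic_graph_map[OF pg(1)] pg(2)] by auto
  then show ?thesis using that pg(2) by (auto simp: is_root_def)
qed

lemma tree_of_rep:
  assumes "is_ptree G" "is_root G r" "rep G r t"
  shows "tree_of G = t"
  using assms plabic_map.tree_ofI[OF plabic_graph_map] by (auto simp: is_ptree_def)

text \<open>Both graphs are plabic by hypothesis, so being a tree is a matter of counting and passes
  through the move in either direction.\<close>

lemma contraction_invariant:
  assumes pg: "plabic_graph G" "plabic_graph H" and m: "contraction_move G H"
  shows "is_ptree G \<longleftrightarrow> is_ptree H" "is_ptree G \<Longrightarrow> nf (tree_of H) = nf (tree_of G)"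
proof -
  obtain a where a: "a \<in> Ar G" "src G a \<noteq> tgt G a" "src G a \<in> internal G" "tgt G a \<in> internal G"
    "src G a \<in> black G \<longleftrightarrow> tgt G a \<in> black G" and H: "H = contract G a"
    using m by (auto simp: contraction_move_def Let_def)
  interpret plabic_map G by (rule plabic_graph_map[OF pg(1)])
  interpret contraction G a by unfold_locales (use a in auto)
  have cV: "card (Vs H) = card (Vs G) - 1" "card (Vs G) \<noteq> 0"
    using int(2) unfolding H H_simps(1) by (auto simp: internal_def)
  have "card (Ar H) = card (Ar G) - 2" "card (Ar G) \<ge> 2"
  proof -
    show "card (Ar H) = card (Ar G) - 2" unfolding H H_simps using a a' by (subst card_Diff_subset) auto
    have "card {a, a'} \<le> card (Ar G)" using a a' by (intro card_mono) auto
    then show "card (Ar G) \<ge> 2" using a'(2) by (simp add: card_insert_if split: if_splits)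
  qed
  then show "is_ptree G \<longleftrightarrow> is_ptree H"
    using cV pg unfolding is_ptree_def H H_simps(8) by auto
  moreover assume G: "is_ptree G"
  ultimately have pH: "is_ptree H" by simp
  obtain r where r: "is_root G r" "src G r \<in> set (bdry G)" "r \<in> Ar G" using root_exists[OF G] .
  then have rn: "r \<noteq> a" "r \<noteq> a'" "src G r \<noteq> v" using int a' by (auto simp: internal_def)
  then have "is_root H r" using r(1) unfolding H is_root_def by (simp add: H_simps)
  moreover obtain t where "rep H r t" "nf t = nf (tree_of G)"
    using rep_contract[OF root_tree_of[OF G r(1)]] rn unfolding H by blast
  ultimately show "nf (tree_of H) = nf (tree_of G)" using tree_of_rep[OF pH] by simp
qed

lemma removal_invariant:
  assumes pg: "plabic_graph G" "plabic_graph H" and m: "removal_move G H"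
  shows "is_ptree G \<longleftrightarrow> is_ptree H" "is_ptree G \<Longrightarrow> nf (tree_of H) = nf (tree_of G)"
proof -
  obtain v a b where vab: "v \<in> internal G" "a \<noteq> b" "rev_arc G a \<noteq> b" "outs G v = {a, b}"
    and H: "H = remove_deg2 G v a b"
    using m by (auto simp: removal_move_def)
  interpret plabic_map G by (rule plabic_graph_map[OF pg(1)])
  interpret removal G v a b by unfold_locales (use vab in auto)
  have cV: "card (Vs H) = card (Vs G) - 1" "card (Vs G) \<noteq> 0"
    using v unfolding H H_simps(1) by (auto simp: internal_def)
  have "card (Ar H) = card (Ar G) - 2" "card (Ar G) \<ge> 2"
  proof -
    show "card (Ar H) = card (Ar G) - 2" unfolding H H_simps using a(1) b(1) ab by (subst card_Diff_subset) auto
    have "card {a, b} \<le> card (Ar G)" using a(1) b(1) by (intro card_mono) auto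
    then show "card (Ar G) \<ge> 2" using ab by (simp add: card_insert_if split: if_splits)
  qed
  then show "is_ptree G \<longleftrightarrow> is_ptree H"
    using cV pg unfolding is_ptree_def H H_simps(8) by auto
  moreover assume G: "is_ptree G"
  ultimately have pH: "is_ptree H" by simp
  obtain r where r: "is_root G r" "src G r \<in> set (bdry G)" "r \<in> Ar G" using root_exists[OF G] .
  then have "src G r \<noteq> v" using v by (auto simp: internal_def)
  then have rn: "r \<noteq> a" "r \<noteq> b" using src_v[OF r(3)] by auto
  then have "is_root H r" using r(1) unfolding H is_root_def by (simp add: H_simps)
  moreover obtain t where "rep H r t" "nf t = nf (tree_of G)"
    using rep_remove[OF root_tree_of[OF G r(1)]] rn unfolding H by auto
  ultimately show "nf (tree_of H) = nf (tree_of G)" using tree_of_rep[OF pH] by simp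
qed

lemma step_invariant:
  assumes s: "plabic_step G H"
  shows "is_ptree G \<longleftrightarrow> is_ptree H" "is_ptree G \<Longrightarrow> nf (tree_of H) = nf (tree_of G)"
proof -
  have pg: "plabic_graph G" "plabic_graph H" using s by (auto simp: plabic_step_def)
  have "(is_ptree G \<longleftrightarrow> is_ptree H) \<and> (is_ptree G \<longrightarrow> nf (tree_of H) = nf (tree_of G))"
    using s unfolding plabic_step_def
  proof (elim conjE disjE)
    assume i: "plabic_iso G H"
    then obtain f g where "bij_betw f (Vs G) (Vs H)" "bij_betw g (Ar G) (Ar H)" "bdry H = map f (bdry G)"
      unfolding plabic_iso_def by blast
    then have "is_ptree H \<Longrightarrow> is_ptree G"
      using pg bij_betw_same_card[of f] bij_betw_same_card[of g] by (auto simp: is_ptree_def)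
    then show ?thesis using iso_invariant[OF _ pg(2) i] by auto
  next
    assume "contraction_move G H"
    then show ?thesis using contraction_invariant[OF pg] by blast
  next
    assume "removal_move G H"
    then show ?thesis using removal_invariant[OF pg] by blast
  next
    assume sq: "square_move G H"
    then have "ugraph H = ugraph G" "bdry H = bdry G" by (auto simp: square_move_def Let_def)
    then have "is_ptree G \<longleftrightarrow> is_ptree H" using pg by (simp add: is_ptree_def)
    then show ?thesis using no_square_move sq by blast
  qed
  then show "is_ptree G \<longleftrightarrow> is_ptree H" "is_ptree G \<Longrightarrow> nf (tree_of H) = nf (tree_of G)" by auto
qed

lemma move_equivalent_invariant:
  assumes "move_equivalent G H" "is_ptree G"
  shows "is_ptree H \<and> nf (tree_of H) = nf (tree_of G)"
  using assms(1) unfolding move_equivalent_def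
proof (induction rule: equivclp_induct)
  case base
  then show ?case using assms(2) by simp
next
  case (step y z)
  then show ?case using step_invariant[of y z] step_invariant[of z y] by auto
qed

lemma move_equivalent_sym: "move_equivalent G H \<Longrightarrow> move_equivalent H G"
  unfolding move_equivalent_def by (rule equivclp_sym)

lemma move_equivalent_trans: "move_equivalent G H \<Longrightarrow> move_equivalent H K \<Longrightarrow> move_equivalent G K"
  unfolding move_equivalent_def by (rule equivclp_trans)

lemma step_move_equivalent: "plabic_step G H \<Longrightarrow> move_equivalent G H"
  unfolding move_equivalent_def by (rule r_into_equivclp)

text \<open>A node with a single child is a vertex of degree 2, and a child with the colour of its
  parent gives an edge to contract. That the result is again a plabic graph, as a step requires, is
  the content of \<open>is_ptree_delete\<close>.\<close>

lemma reducing_step: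
  assumes G: "is_ptree G" and nr: "\<not> reduced (tree_of G)"
  obtains H where "plabic_step G H" "is_ptree H" "card (Ar H) < card (Ar G)"
proof -
  have pg: "plabic_graph G" using G by (simp add: is_ptree_def)
  obtain r where r: "is_root G r" "rooted_tree G r (tree_of G)"
    using treelike_root[OF is_ptree_treelike[OF G]] G by (auto simp: is_ptree_def)
  interpret rooted_tree G r "tree_of G" by (rule r(2))
  obtain p c ts where p: "subt (tree_of G) p = Some (Node c ts)"
    and ts: "length ts = 1 \<or> (\<exists>i<length ts. \<exists>ss. ts ! i = Node c ss)"
    using not_reducedE[OF wf_tree_of[OF G] nr] .
  let ?x = "arc_at G r p"
  have x: "rep G ?x (Node c ts)" by (rule rep_at[OF rep p])
  note n = rep_node[OF x]
  from ts show ?thesis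
  proof
    assume l: "length ts = 1"
    let ?a = "rev_arc G ?x" and ?b = "kid G ?x 0"
    have o: "outs G (tgt G ?x) = {?a, ?b}" using n(4) l by (simp add: lessThan_Suc)
    have ab: "?a \<noteq> ?b" using n(6) l by auto
    have bx: "rev_arc G ?a \<noteq> ?b" using child_neq[OF n(1), of ?b] o ab by auto
    interpret removal G "tgt G ?x" ?a ?b by unfold_locales (use n(2) ab bx o in auto)
    have pH: "is_ptree H" by (rule is_ptree_remove[OF G])
    moreover have "removal_move G H" unfolding removal_move_def using n(2) ab bx o by blast
    then have "plabic_step G H" using pg pH by (auto simp: plabic_step_def is_ptree_def)
    ultimately show ?thesis using that card_remove by blast
  next
    assume "\<exists>i<length ts. \<exists>ss. ts ! i = Node c ss"
    then obtain i ss where i: "i < length ts" "ts ! i = Node c ss" by blast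
    let ?d = "kid G ?x i"
    have d: "rep G ?d (Node c ss)" using n(8)[OF i(1)] i(2) by simp
    note m = rep_node[OF d]
    have "?d \<in> outs G (tgt G ?x)" using n(4) i(1) by auto
    then have sd: "src G ?d = tgt G ?x" "?d \<in> Ar G" by auto
    have uv: "src G ?d \<noteq> tgt G ?d" using src_notin[OF sd(2)] tgt_in_beyond[of G ?d] by auto
    interpret contraction G ?d
      by unfold_locales (use sd uv n(2,3) m(2,3) in auto)
    have pH: "is_ptree H" by (rule is_ptree_contract[OF G])
    moreover have "contraction_move G H"
      unfolding contraction_move_def Let_def using a uv int col by blast
    then have "plabic_step G H" using pg pH by (auto simp: plabic_step_def is_ptree_def)
    ultimately show ?thesis using that card_contract by blast
  qed
qed

lemma move_equivalent_normal_form: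
  "is_ptree G \<Longrightarrow> move_equivalent G (graph_of (nf (tree_of G)))"
proof (induction "card (Ar G)" arbitrary: G rule: less_induct)
  case less
  show ?case
  proof (cases "reduced (tree_of G)")
    case True
    then show ?thesis
      using step_graph_of[OF less.prems] nf_reduced[OF True] step_move_equivalent move_equivalent_sym by simp
  next
    case False
    obtain H where H: "plabic_step G H" "is_ptree H" "card (Ar H) < card (Ar G)"
      using reducing_step[OF less.prems False] .
    have "move_equivalent H (graph_of (nf (tree_of G)))"
      using less.hyps[OF H(3,2)] step_invariant(2)[OF H(1) less.prems] by simp
    then show ?thesis using move_equivalent_trans[OF step_move_equivalent[OF H(1)]] by simp
  qed
qed

lemma move_equivalent_iff:
  assumes "is_ptree G" "is_ptree H"
  shows "move_equivalent G H \<longleftrightarrow> nf (tree_of G) = nf (tree_of H)"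
proof
  assume "nf (tree_of G) = nf (tree_of H)"
  then show "move_equivalent G H"
    using move_equivalent_normal_form[OF assms(1)] move_equivalent_normal_form[OF assms(2)]
      move_equivalent_sym move_equivalent_trans by metis
qed (use move_equivalent_invariant[OF _ assms(1)] in auto)

section \<open>Amplitrees in terms of plane trees\<close>

fun leaves :: "plane_tree \<Rightarrow> nat" where
  "leaves Leaf = 1"
| "leaves (Node c ts) = sum_list (map leaves ts)"

text \<open>A black node \<open>b\<close> contributes \<open>deg b - 2\<close>; its degree also counts the edge to its parent.\<close>

fun excess :: "plane_tree \<Rightarrow> nat" where
  "excess Leaf = 0"
| "excess (Node c ts) = (if c then length ts - 1 else 0) + sum_list (map excess ts)"

definition in_range :: "nat \<Rightarrow> plane_tree \<Rightarrow> bool" where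
  "in_range m t \<longleftrightarrow> m * excess t < leaves t \<and> leaves t \<le> m * excess t + m"

fun bal :: "nat \<Rightarrow> plane_tree \<Rightarrow> bool" where
  "bal m Leaf \<longleftrightarrow> in_range m Leaf"
| "bal m (Node c ts) \<longleftrightarrow> in_range m (Node c ts) \<and> (\<forall>t\<in>set ts. bal m t)"

text \<open>The root vertex is the one boundary vertex among the \<open>k * m + 1\<close> that is
  not a leaf of the plane tree.\<close>

definition normal_trees :: "nat \<Rightarrow> nat \<Rightarrow> plane_tree set" where
  "normal_trees k m = {t. reduced t \<and> leaves t = k * m \<and> excess t + 1 = k \<and> bal m t}"

lemma bal_iff: "bal m t \<longleftrightarrow> in_range m t \<and> (\<forall>s\<in>set (kids t). bal m s)"
  by (cases t) auto

lemma bal_subt: "bal m t \<longleftrightarrow> (\<forall>p s. subt t p = Some s \<longrightarrow> in_range m s)"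
proof (induction t)
  case Leaf
  have "subt Leaf p = Some s \<longleftrightarrow> p = [] \<and> s = Leaf" for p s by (cases p) auto
  then show ?case by auto
next
  case (Node c ts)
  have "(\<forall>p s. subt (Node c ts) p = Some s \<longrightarrow> in_range m s) \<longleftrightarrow>
    in_range m (Node c ts) \<and> (\<forall>i<length ts. \<forall>p s. subt (ts ! i) p = Some s \<longrightarrow> in_range m s)"
  proof (intro iffI conjI allI impI)
    assume *: "\<forall>p s. subt (Node c ts) p = Some s \<longrightarrow> in_range m s"
    show "in_range m (Node c ts)" using *[rule_format, of "[]"] by simp
    fix i p s assume "i < length ts" "subt (ts ! i) p = Some s"
    then show "in_range m s" using *[rule_format, of "i # p"] by simp
  next
    fix p s assume "in_range m (Node c ts) \<and> (\<forall>i<length ts. \<forall>p s. subt (ts ! i) p = Some s \<longrightarrow> in_range m s)"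
      "subt (Node c ts) p = Some s"
    then show "in_range m s" by (cases p) (auto split: if_splits)
  qed
  moreover have "(\<forall>t\<in>set ts. bal m t) \<longleftrightarrow> (\<forall>i<length ts. \<forall>p s. subt (ts ! i) p = Some s \<longrightarrow> in_range m s)"
    using Node.IH by (simp add: all_set_conv_all_nth)
  ultimately show ?case by simp
qed

text \<open>Circumvents the truncated difference \<open>length ts - 1\<close>: for a black node,
  excess plus one is the sum of the same quantity over the children, so it is unchanged when black
  nodes merge.\<close>

definition cexcess :: "bool \<Rightarrow> plane_tree \<Rightarrow> nat" where
  "cexcess c t = excess t + (if c then 1 else 0)"

lemma sum_cexcess: "sum_list (map (cexcess c) ts) = sum_list (map excess ts) + (if c then length ts else 0)"
  by (induction ts) (auto simp: cexcess_def)

lemma excess_Node: "ts \<noteq> [] \<Longrightarrow> excess (Node c ts) + (if c then 1 else 0) = sum_list (map (cexcess c) ts)"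
  by (cases ts) (auto simp: sum_cexcess cexcess_def)

lemma leaves_mk: "leaves (mk c ts) = sum_list (map leaves ts)"
  by (cases ts) (auto simp: mk_def)

lemma excess_mk: "ts \<noteq> [] \<Longrightarrow> excess (mk c ts) + (if c then 1 else 0) = sum_list (map (cexcess c) ts)"
  using excess_Node[of ts c] by (cases ts) (auto simp: mk_def cexcess_def)

lemma leaves_dissolve: "sum_list (map leaves (dissolve c t)) = leaves t"
  by (cases t) auto

lemma cexcess_dissolve: "wf_tree t \<Longrightarrow> sum_list (map (cexcess c) (dissolve c t)) = cexcess c t"
proof (cases t)
  case (Node d ts)
  assume "wf_tree t"
  then have "ts \<noteq> []" using Node by simp
  show ?thesis
  proof (cases "c = d")
    case True
    have "sum_list (map (cexcess d) ts) = cexcess d (Node d ts)"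
      using excess_Node[OF \<open>ts \<noteq> []\<close>, of d] by (simp only: cexcess_def[of d "Node d ts"])
    then show ?thesis using True Node by simp
  qed (simp add: Node)
qed (simp add: cexcess_def)

lemma nf_weights: "wf_tree t \<Longrightarrow> leaves (nf t) = leaves t \<and> excess (nf t) = excess t"
proof (induction t)
  case (Node c ts)
  let ?l = "concat (map (\<lambda>t. dissolve c (nf t)) ts)"
  have wf: "\<forall>t\<in>set ts. wf_tree t" and ne: "ts \<noteq> []" using Node.prems by auto
  have ih: "leaves (nf t) = leaves t" "excess (nf t) = excess t" "wf_tree (nf t)" if "t \<in> set ts" for t
    using Node.IH[OF that] wf that reduced_wf[OF reduced_nf] by auto
  have lne: "?l \<noteq> []" using ne wf reduced_dissolve(2)[OF reduced_nf] by (cases ts) auto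
  have "sum_list (map leaves ?l) = sum_list (map leaves ts)"
    using ih by (induction ts) (auto simp: leaves_dissolve)
  moreover have "sum_list (map (cexcess c) ?l) = sum_list (map (cexcess c) ts)"
    using ih by (induction ts) (auto simp: cexcess_dissolve, simp add: cexcess_def)
  ultimately show ?case
    using leaves_mk[of c ?l] excess_mk[OF lne, of c] excess_Node[OF ne, of c] by (auto split: if_splits)
qed simp

lemma bal_dissolve: "bal m t \<Longrightarrow> \<forall>s\<in>set (dissolve c t). bal m s"
  by (cases t) auto

text \<open>The proper subtrees of the normal form come from the normal forms of the children, and
  the range condition at the root depends only on the weights kept by
  \<open>nf_weights\<close>.\<close>

lemma bal_nf: "wf_tree t \<Longrightarrow> bal m t \<Longrightarrow> bal m (nf t)"
proof (induction t)
  case (Node c ts)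
  let ?l = "concat (map (\<lambda>t. dissolve c (nf t)) ts)"
  have "\<forall>s\<in>set ?l. bal m s" using Node bal_dissolve by fastforce
  moreover have "in_range m (nf (Node c ts))"
    using nf_weights[OF Node.prems(1)] Node.prems(2) by (simp add: in_range_def del: nf.simps leaves.simps excess.simps)
  moreover have "nf (Node c ts) = hd ?l \<and> hd ?l \<in> set ?l \<or> nf (Node c ts) = Node c ?l"
  proof (cases "length ?l = 1")
    case True
    then have "?l \<noteq> []" by (metis length_0_conv zero_neq_one)
    then show ?thesis using True hd_in_set[of ?l] by (simp add: mk_def)
  next
    case False
    then show ?thesis by (simp add: mk_def)
  qed
  ultimately show ?case
  proof (elim disjE conjE)
    assume *: "\<forall>s\<in>set ?l. bal m s" "nf (Node c ts) = hd ?l" "hd ?l \<in> set ?l"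
    show ?thesis unfolding *(2) using *(1,3) by blast
  next
    assume *: "\<forall>s\<in>set ?l. bal m s" "in_range m (nf (Node c ts))" "nf (Node c ts) = Node c ?l"
    show ?thesis using *(1,2) unfolding *(3) bal.simps(2) by (rule conjI[rotated])
  qed
qed simp

text \<open>Leaves and the root vertex count as black.\<close>

fun bip :: "bool \<Rightarrow> plane_tree \<Rightarrow> plane_tree" where
  "bip c Leaf = (if c then Node False [Leaf] else Leaf)"
| "bip c (Node d ts) = (if c = d then Node (\<not> d) [Node d (map (bip d) ts)] else Node d (map (bip d) ts))"

fun shade :: "plane_tree \<Rightarrow> bool" where
  "shade Leaf = True"
| "shade (Node c ts) = c"

lemma bip_weights: "leaves (bip c t) = leaves t \<and> excess (bip c t) = excess t"
proof (induction t arbitrary: c)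
  case (Node d ts)
  have "map (leaves \<circ> bip d) ts = map leaves ts" "map (excess \<circ> bip d) ts = map excess ts"
    using Node.IH by auto
  then have "sum_list (map (leaves \<circ> bip d) ts) = sum_list (map leaves ts)"
    "sum_list (map (excess \<circ> bip d) ts) = sum_list (map excess ts)"
    by (simp_all only:)
  then show ?case by (cases d) auto
qed simp

lemma wf_bip: "wf_tree t \<Longrightarrow> wf_tree (bip c t)"
  by (induction t arbitrary: c) auto

lemma bal_bip: "bal m t \<Longrightarrow> bal m (bip c t)"
proof (induction t arbitrary: c)
  case Leaf
  then show ?case by (auto simp: in_range_def)
next
  case (Node d ts)
  have "leaves (bip (\<not> d) (Node d ts)) = leaves (Node d ts)" "excess (bip (\<not> d) (Node d ts)) = excess (Node d ts)"
    using bip_weights by blast+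
  then have "in_range m (Node d (map (bip d) ts))"
    using Node.prems by (simp add: in_range_def del: leaves.simps excess.simps)
  moreover have "in_range m (Node e [t]) = in_range m t" for e t by (simp add: in_range_def)
  ultimately show ?case using Node by auto
qed

text \<open>The nodes inserted by \<open>bip\<close> have a single child and are erased
  again.\<close>

lemma nf_bip: "wf_tree t \<Longrightarrow> nf (bip c t) = nf t"
proof (induction t arbitrary: c)
  case (Node d ts)
  have "nf (Node d (map (bip d) ts)) = nf (Node d ts)"
    by (rule nf_Node_cong) (use Node in auto)
  moreover have "wf_tree (Node d (map (bip d) ts))" using wf_bip Node.prems by auto
  ultimately show ?case using nf_single by (simp del: nf.simps)
qed (auto simp: mk_def)

text \<open>So \<open>bip c t\<close> can be attached below a vertex of shade \<open>c\<close>
  without an edge between equal colours.\<close>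

lemma shade_bip: "shade (bip c t) \<noteq> c"
  by (cases t) auto

lemma shade_kids_bip:
  "subt (bip c t) p = Some s \<Longrightarrow> i < length (kids s) \<Longrightarrow> shade (kids s ! i) \<noteq> shade s"
proof (induction t arbitrary: c p)
  case Leaf
  then show ?case by (cases p; cases "tl p") (auto split: if_splits)
next
  case (Node d ts)
  have *: ?case if s: "subt (Node d (map (bip d) ts)) q = Some s" for q
  proof (cases q)
    case Nil
    then have "s = Node d (map (bip d) ts)" using s by simp
    then show ?thesis using Node.prems(2) shade_bip[of d "ts ! i"] by simp
  next
    case (Cons j q')
    then have "j < length ts" "subt (bip d (ts ! j)) q' = Some s" using s by (auto split: if_splits)
    then show ?thesis using Node.IH[of "ts ! j" d q'] Node.prems(2) by auto
  qed
  show ?case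
  proof (cases "c = d")
    case True
    then show ?thesis
    proof (cases p)
      case Nil
      then show ?thesis using Node.prems True by auto
    next
      case (Cons j q)
      then show ?thesis using * Node.prems True by (auto split: if_splits)
    qed
  qed (use * Node.prems in auto)
qed

lemma bipartite_graph_of:
  assumes root: "\<not> shade t"
    and alt: "\<And>p s i. subt t p = Some s \<Longrightarrow> i < length (kids s) \<Longrightarrow> shade (kids s ! i) \<noteq> shade s"
  shows "bipartite (graph_of t)"
proof -
  let ?G = "graph_of t"
  let ?B = "black ?G \<union> set (bdry ?G)"
  have nd: "nd p \<in> ?B \<longleftrightarrow> shade s" if "subt t p = Some s" for p s
    using that by (cases s) (auto simp: black_graph set_bdry_graph)
  have "par p \<in> ?B \<longleftrightarrow> nd p \<notin> ?B" if p: "p \<in> pos t" for p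
  proof (cases "p = []")
    case True
    then show ?thesis using nd[of "[]" t] root by (simp add: set_bdry_graph)
  next
    case False
    then obtain q i where q: "p = q @ [i]" by (metis append_butlast_last_id)
    then obtain s where s: "subt t q = Some s" using pos_snocD[of q i t] p by (auto simp: pos_def)
    have i: "i < length (kids s)" using pos_snoc_iff[OF s] p q by simp
    have "subt t p = Some (kids s ! i)" using subt_snoc[OF s] i q by simp
    then show ?thesis using nd[OF s] nd[of p] alt[OF s i] q by simp
  qed
  note col = this
  show ?thesis
    unfolding bipartite_def
  proof
    fix e assume "e \<in> Ar ?G"
    then show "(src ?G e \<in> ?B) \<noteq> (tgt ?G e \<in> ?B)"
    proof (cases rule: Ar_graph_cases)
      case (1 p)
      then show ?thesis using col[OF 1(2)] by (simp only: src_dn tgt_dn) blast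
    next
      case (2 p)
      then show ?thesis using col[OF 2(2)] by (simp only: src_up tgt_up) blast
    qed
  qed
qed

section \<open>Boundary vertices and degrees on the two sides of an edge\<close>

context treelike_map
begin

lemma rep_count:
  "rep G x t \<Longrightarrow> card (set (bdry G) \<inter> beyond G x) = leaves t \<and>
     (\<Sum>b\<in>beyond G x \<inter> black G. int (deg G b) - 2) = int (excess t)"
proof (induction t arbitrary: x)
  case Leaf
  have x: "x \<in> Ar G" using Leaf by (rule rep_in)
  have "beyond G x = {tgt G x}"
    unfolding beyond_children[OF x] using rep_kids(1)[OF Leaf] by simp
  then show ?case using rep_tgt[OF Leaf] by simp
next
  case (Node c ts)
  note n = rep_node[OF Node.prems]
  let ?D = "\<lambda>i. beyond G (kid G x i)" and ?f = "\<lambda>b. int (deg G b) - 2"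
  have kin: "kid G x i \<in> Ar G" "src G (kid G x i) = tgt G x" if "i < length ts" for i
    using n(4) that by auto
  have b: "beyond G x = insert (tgt G x) (\<Union>i<length ts. ?D i)"
    unfolding beyond_children[OF n(1)] using n(4,6) by auto
  have disj: "?D i \<inter> ?D j = {}" if "i < length ts" "j < length ts" "i \<noteq> j" for i j
    using children_disj[of "kid G x i" "kid G x j"] kin that n(5) by (auto simp: inj_on_def)
  have fin: "finite (?D i)" if "i < length ts" for i using finite_beyond kin that by simp
  have notin: "tgt G x \<notin> ?D i" if "i < length ts" for i
    using src_notin[OF kin(1)[OF that]] kin(2)[OF that] by simp
  have ih: "card (set (bdry G) \<inter> ?D i) = leaves (ts ! i)"
    "sum ?f (?D i \<inter> black G) = int (excess (ts ! i))" if "i < length ts" for i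
    using Node.IH[OF nth_mem[OF that] n(8)[OF that]] by auto
  have "tgt G x \<notin> set (bdry G)" using n(2) by (simp add: internal_def)
  then have "set (bdry G) \<inter> beyond G x = (\<Union>i<length ts. set (bdry G) \<inter> ?D i)"
    unfolding b by auto
  also have "card \<dots> = (\<Sum>i<length ts. card (set (bdry G) \<inter> ?D i))"
    by (rule card_UN_disjoint) (use disj in auto)
  also have "\<dots> = (\<Sum>i<length ts. leaves (ts ! i))"
    by (rule sum.cong) (use ih in auto)
  also have "\<dots> = leaves (Node c ts)"
    by (simp add: sum_list_sum_nth atLeast0LessThan)
  finally have 1: "card (set (bdry G) \<inter> beyond G x) = leaves (Node c ts)" .
  have s: "(\<Sum>b\<in>(\<Union>i<length ts. ?D i \<inter> black G). ?f b) = (\<Sum>i<length ts. int (excess (ts ! i)))"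
  proof -
    have "(\<Sum>b\<in>(\<Union>i<length ts. ?D i \<inter> black G). ?f b) = (\<Sum>i<length ts. sum ?f (?D i \<inter> black G))"
      by (rule sum.UNION_disjoint) (use disj fin in auto)
    then show ?thesis using ih by simp
  qed
  have "card (outs G (tgt G x)) = Suc (length ts)"
    unfolding n(4) using n(5,6) by (subst card_insert_disjoint) (auto simp: card_image)
  then have dg: "deg G (tgt G x) = Suc (length ts)" by (simp add: deg_def out_degree_def)
  have ne: "ts \<noteq> []" using rep_wf[OF Node.prems] by simp
  have "(\<Sum>b\<in>beyond G x \<inter> black G. ?f b) = int (excess (Node c ts))"
  proof (cases c)
    case True
    then have "beyond G x \<inter> black G = insert (tgt G x) (\<Union>i<length ts. ?D i \<inter> black G)"
      unfolding b using n(3) by auto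
    moreover have "tgt G x \<notin> (\<Union>i<length ts. ?D i \<inter> black G)" using notin by auto
    moreover have "finite (\<Union>i<length ts. ?D i \<inter> black G)" using fin by auto
    ultimately have "(\<Sum>b\<in>beyond G x \<inter> black G. ?f b) = ?f (tgt G x) + (\<Sum>i<length ts. int (excess (ts ! i)))"
      using s by simp
    then show ?thesis using True dg ne
      by (simp add: sum_list_sum_nth atLeast0LessThan of_nat_diff Suc_le_eq)
  next
    case False
    then have "beyond G x \<inter> black G = (\<Union>i<length ts. ?D i \<inter> black G)"
      unfolding b using n(3) by auto
    then show ?thesis using s False by (simp add: sum_list_sum_nth atLeast0LessThan)
  qed
  then show ?case using 1 by simp
qed

end

context rooted_tree
begin

lemma finite_black: "finite (black G)"
  using black_sub finite_verts by (auto simp: internal_def intro: finite_subset)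

lemma Vs_root: "Vs G = insert (src G r) (beyond G r)"
proof -
  have "beyond G (rev_arc G r) = {src G r}"
    using beyond_children[of "rev_arc G r"] outs_bdry[OF root] root(1) by simp
  then show ?thesis using beyond_Un[OF root(1)] by auto
qed

lemma totals:
  assumes "distinct (bdry G)"
  shows "length (bdry G) = leaves t + 1" "(\<Sum>b\<in>black G. int (deg G b) - 2) = int (excess t)"
proof -
  have "set (bdry G) = insert (src G r) (set (bdry G) \<inter> beyond G r)"
    using bdry_sub Vs_root root(2) by auto
  moreover have "src G r \<notin> set (bdry G) \<inter> beyond G r" using src_notin root(1) by auto
  ultimately have "card (set (bdry G)) = Suc (card (set (bdry G) \<inter> beyond G r))"
    by (metis List.finite_set card_insert_disjoint finite_Int)
  then show "length (bdry G) = leaves t + 1"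
    using rep_count[OF rep] distinct_card[OF assms] by simp
  have "black G = beyond G r \<inter> black G"
    using black_sub Vs_root root(2) by (auto simp: internal_def)
  then show "(\<Sum>b\<in>black G. int (deg G b) - 2) = int (excess t)"
    using rep_count[OF rep] by simp
qed

text \<open>By \<open>l\<close> the quantities of the two sides of an edge add up to
  \<open>m + 1\<close>. The bounds 1 and \<open>m\<close> for one side are therefore those for the
  other, and only the sides away from the root, the subtrees, have to be checked.\<close>

lemma balanced_iff:
  assumes d: "distinct (bdry G)" and l: "leaves t = m * excess t + m"
  shows "balanced m G \<longleftrightarrow> bal m t"
proof -
  define f where "f a = int (card (set (bdry G) \<inter> side G a))
                - int m * (\<Sum>b\<in>side G a \<inter> black G. int (deg G b) - 2)" for a
  have f1: "f (rev_arc G (arc_at G r p)) = int (leaves s) - int m * int (excess s)"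
    and f2: "f (arc_at G r p) = int m + 1 - f (rev_arc G (arc_at G r p))"
    if s: "subt t p = Some s" for p s
  proof -
    let ?x = "arc_at G r p"
    have rx: "rep G ?x s" by (rule rep_at[OF rep s])
    have x: "?x \<in> Ar G" by (rule rep_in[OF rx])
    have sd: "side G (rev_arc G ?x) = beyond G ?x" "side G ?x = beyond G (rev_arc G ?x)"
      using side_rev[OF x] side_rev[of "rev_arc G ?x"] x by auto
    show "f (rev_arc G ?x) = int (leaves s) - int m * int (excess s)"
      unfolding f_def sd(1) using rep_count[OF rx] by simp
    have un: "beyond G ?x \<union> beyond G (rev_arc G ?x) = Vs G" by (rule beyond_Un[OF x])
    have dj: "beyond G ?x \<inter> beyond G (rev_arc G ?x) = {}" by (rule beyond_rev_disj[OF x])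
    have "set (bdry G) = (set (bdry G) \<inter> beyond G ?x) \<union> (set (bdry G) \<inter> beyond G (rev_arc G ?x))"
      using bdry_sub un by auto
    then have "card (set (bdry G)) = card (set (bdry G) \<inter> beyond G ?x) + card (set (bdry G) \<inter> beyond G (rev_arc G ?x))"
      using dj by (metis (no_types, lifting) List.finite_set card_Un_disjoint finite_Int inf_assoc inf_bot_right inf_left_commute)
    then have c: "int (leaves t) + 1 = int (card (set (bdry G) \<inter> beyond G ?x)) +
      int (card (set (bdry G) \<inter> beyond G (rev_arc G ?x)))"
      using distinct_card[OF d] totals(1)[OF d] by simp
    have "black G = (beyond G ?x \<inter> black G) \<union> (beyond G (rev_arc G ?x) \<inter> black G)"
      using black_sub un by (auto simp: internal_def)
    then have "(\<Sum>b\<in>black G. int (deg G b) - 2) = (\<Sum>b\<in>(beyond G ?x \<inter> black G) \<union> (beyond G (rev_arc G ?x) \<inter> black G). int (deg G b) - 2)"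
      by simp
    also have "\<dots> = (\<Sum>b\<in>beyond G ?x \<inter> black G. int (deg G b) - 2) +
      (\<Sum>b\<in>beyond G (rev_arc G ?x) \<inter> black G. int (deg G b) - 2)"
      by (rule sum.union_disjoint) (use dj finite_black in auto)
    finally have e: "int (excess t) = (\<Sum>b\<in>beyond G ?x \<inter> black G. int (deg G b) - 2) +
      (\<Sum>b\<in>beyond G (rev_arc G ?x) \<inter> black G. int (deg G b) - 2)"
      using totals(2)[OF d] by simp
    have lt: "int (leaves t) = int m * int (excess t) + int m" unfolding l by simp
    have "f ?x + f (rev_arc G ?x) = int (leaves t) + 1 - int m * int (excess t)"
      unfolding f_def sd c e by (simp add: algebra_simps)
    then show "f ?x = int m + 1 - f (rev_arc G ?x)" using lt by simp
  qed
  have "balanced m G \<longleftrightarrow> (\<forall>a\<in>Ar G. 1 \<le> f a \<and> f a \<le> int m)"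
    unfolding balanced_def f_def Let_def ..
  also have "\<dots> \<longleftrightarrow> (\<forall>e\<in>Ar T. 1 \<le> f (amap G r e) \<and> f (amap G r e) \<le> int m)"
    unfolding amap_surj[symmetric] by blast
  also have "\<dots> \<longleftrightarrow> (\<forall>p\<in>pos t. (1 \<le> f (arc_at G r p) \<and> f (arc_at G r p) \<le> int m) \<and>
      (1 \<le> f (rev_arc G (arc_at G r p)) \<and> f (rev_arc G (arc_at G r p)) \<le> int m))"
    unfolding Ar_graph ball_Un by (simp add: ball_conj_distrib)
  also have "\<dots> \<longleftrightarrow> (\<forall>p s. subt t p = Some s \<longrightarrow> in_range m s)"
  proof -
    have "(1 \<le> f (arc_at G r p) \<and> f (arc_at G r p) \<le> int m) \<and>
      (1 \<le> f (rev_arc G (arc_at G r p)) \<and> f (rev_arc G (arc_at G r p)) \<le> int m) \<longleftrightarrow> in_range m s"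
      if "subt t p = Some s" for p s
    proof -
      have "in_range m s \<longleftrightarrow> int m * int (excess s) < int (leaves s) \<and> int (leaves s) \<le> int m * int (excess s) + int m"
        unfolding in_range_def by (metis of_nat_add of_nat_le_iff of_nat_less_iff of_nat_mult)
      then show ?thesis unfolding f2[OF that] f1[OF that] by linarith
    qed
    then show ?thesis unfolding pos_def by auto
  qed
  finally show ?thesis unfolding bal_subt .
qed

end

lemma amplitree_iff:
  assumes "is_ptree G"
  shows "amplitree k m G \<longleftrightarrow> bipartite G \<and> leaves (tree_of G) = k * m \<and> excess (tree_of G) + 1 = k \<and>
    bal m (tree_of G)"
proof -
  have pg: "plabic_graph G" "bdry G \<noteq> []" using assms by (auto simp: is_ptree_def)
  then have d: "distinct (bdry G)" by (simp add: plabic_graph_def)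
  obtain r where "rooted_tree G r (tree_of G)"
    using treelike_root[OF is_ptree_treelike[OF assms] pg(2)] .
  then interpret rooted_tree G r "tree_of G" .
  have t: "has_type G k (k * m + 1) \<longleftrightarrow> leaves (tree_of G) = k * m \<and> excess (tree_of G) + 1 = k"
    unfolding has_type_def totals[OF d] by auto
  have "balanced m G \<longleftrightarrow> bal m (tree_of G)" if "leaves (tree_of G) = k * m" "excess (tree_of G) + 1 = k"
    by (rule balanced_iff[OF d]) (use that in \<open>auto simp: algebra_simps\<close>)
  then show ?thesis unfolding amplitree_def t using is_ptree_plabic_tree[OF assms] by auto
qed

lemma amplitree_is_ptree:
  assumes "amplitree k m G"
  shows "is_ptree G"
  by (rule plabic_tree_is_ptree) (use assms in \<open>auto simp: amplitree_def has_type_def\<close>)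

lemma normal_form_image:
  "(\<lambda>G. nf (tree_of G)) ` {G. amplitree k m G} = normal_trees k m"
proof (intro equalityI subsetI)
  fix t assume "t \<in> (\<lambda>G. nf (tree_of G)) ` {G. amplitree k m G}"
  then obtain G where G: "amplitree k m G" "t = nf (tree_of G)" by auto
  have p: "is_ptree G" by (rule amplitree_is_ptree[OF G(1)])
  note w = wf_tree_of[OF p]
  show "t \<in> normal_trees k m"
    using G(1)[unfolded amplitree_iff[OF p]] nf_weights[OF w] reduced_nf[OF w] bal_nf[OF w]
    unfolding normal_trees_def G(2) by simp
next
  fix t assume t: "t \<in> normal_trees k m"
  then have red: "reduced t" by (simp add: normal_trees_def)
  then have wf: "wf_tree t" by (rule reduced_wf)
  \<comment> \<open>The parameter is \<open>True\<close> because the root vertex is a boundary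
    vertex and counts as black.\<close>
  let ?s = "bip True t"
  have ws: "wf_tree ?s" by (rule wf_bip[OF wf])
  note p = is_ptree_graph_of[OF ws]
  have "bipartite (graph_of ?s)"
    by (rule bipartite_graph_of) (use shade_bip[of True t] shade_kids_bip[of True t] in auto)
  then have "amplitree k m (graph_of ?s)"
    unfolding amplitree_iff[OF p(1)] p(2) using t bip_weights bal_bip by (auto simp: normal_trees_def)
  moreover have "nf (tree_of (graph_of ?s)) = t"
    unfolding p(2) using nf_bip[OF wf] nf_reduced[OF red] by simp
  ultimately show "t \<in> (\<lambda>G. nf (tree_of G)) ` {G. amplitree k m G}" by force
qed

lemma card_quotient_kernel:
  "card (A // {(x, y). x \<in> A \<and> y \<in> A \<and> f x = f y}) = card (f ` A)"
proof -
  let ?c = "\<lambda>t. {x \<in> A. f x = t}"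
  have "{(x, y). x \<in> A \<and> y \<in> A \<and> f x = f y} `` {a} = ?c (f a)" if "a \<in> A" for a
    using that by auto
  then have "A // {(x, y). x \<in> A \<and> y \<in> A \<and> f x = f y} = ?c ` f ` A"
    unfolding quotient_def by auto
  moreover have "inj_on ?c (f ` A)"
    by (rule inj_onI) (auto simp: set_eq_iff)
  ultimately show ?thesis by (simp add: card_image)
qed

lemma num_amplitree_classes_eq: "num_amplitree_classes k m = card (normal_trees k m)"
proof -
  let ?A = "{G. amplitree k m G}" and ?f = "\<lambda>G. nf (tree_of G)"
  have "{(G, H). amplitree k m G \<and> amplitree k m H \<and> move_equivalent G H} =
    {(x, y). x \<in> ?A \<and> y \<in> ?A \<and> ?f x = ?f y}"
    using move_equivalent_iff amplitree_is_ptree by blast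
  then show ?thesis
    unfolding num_amplitree_classes_def amplitree_classes_def
    using card_quotient_kernel[of ?A ?f] normal_form_image[of k m] by simp
qed

section \<open>Reduced trees of excess at most 2\<close>

abbreviation L :: "nat \<Rightarrow> plane_tree list" where "L n \<equiv> replicate n Leaf"

text \<open>The only reduced tree of excess 0 with \<open>n\<close> leaves, for n at least 1
  (\<open>reduced_excess_0\<close>); through \<open>mk\<close> it is a bare leaf when n = 1.\<close>

definition branch :: "nat \<Rightarrow> plane_tree" where "branch n = mk False (L n)"

abbreviation fork :: "nat \<Rightarrow> nat \<Rightarrow> plane_tree" where "fork a b \<equiv> Node True [branch a, branch b]"

text \<open>Nonempty lists of this kind correspond to reduced trees through \<open>mk False\<close>
  and \<open>dissolve False\<close>. A tree whose root is not white appears as a list of length one,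
  so the colour of the root needs no separate case.\<close>

definition white_list :: "plane_tree list \<Rightarrow> bool" where
  "white_list ts \<longleftrightarrow> (\<forall>t\<in>set ts. reduced t \<and> \<not> rooted False t)"

lemma white_list_simps [simp]:
  "white_list []" "white_list (t # ts) \<longleftrightarrow> reduced t \<and> \<not> rooted False t \<and> white_list ts"
  "white_list (us @ ts) \<longleftrightarrow> white_list us \<and> white_list ts" "white_list (L n)"
  by (auto simp: white_list_def)

lemma excess_mk_False: "ts \<noteq> [] \<Longrightarrow> excess (mk False ts) = sum_list (map excess ts)"
  using excess_mk[of ts False] sum_cexcess[of False ts] by simp

lemma bal_mk:
  assumes "ts \<noteq> []"
  shows "bal m (mk False ts) \<longleftrightarrow> in_range m (mk False ts) \<and> (\<forall>t\<in>set ts. bal m t)"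
proof (cases "length ts = 1")
  case True
  then obtain t where "ts = [t]" by (auto simp: length_Suc_conv)
  then show ?thesis using bal_iff[of m t] by (auto simp: mk_def)
qed (simp add: mk_def)

lemma branch_weights:
  assumes "n \<ge> 1"
  shows "leaves (branch n) = n" "excess (branch n) = 0" "reduced (branch n)" "\<not> rooted True (branch n)"
proof -
  have ne: "L n \<noteq> []" using assms by simp
  show "leaves (branch n) = n" by (simp add: branch_def leaves_mk sum_list_replicate)
  show "excess (branch n) = 0" unfolding branch_def excess_mk_False[OF ne] by (simp add: sum_list_replicate)
  show "reduced (branch n)" unfolding branch_def by (rule reduced_mk[OF _ ne]) auto
  show "\<not> rooted True (branch n)" using assms by (cases n) (auto simp: branch_def mk_def)
qed

lemma bal_branch:
  assumes "n \<ge> 1"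
  shows "bal m (branch n) \<longleftrightarrow> n \<le> m"
proof -
  have ne: "L n \<noteq> []" using assms by simp
  have "in_range m (branch n) \<longleftrightarrow> n \<le> m" using branch_weights[OF assms] assms by (simp add: in_range_def)
  then show ?thesis using bal_mk[OF ne, of m] assms by (auto simp: branch_def in_range_def)
qed

lemma mk_dissolve: "reduced t \<Longrightarrow> mk False (dissolve False t) = t"
  by (cases t) (auto simp: mk_def)

lemma mk_False_inj:
  assumes "white_list us" "white_list ts" "mk False us = mk False ts"
  shows "us = ts"
proof -
  have "dissolve False (mk False us) = us" "dissolve False (mk False ts) = ts"
    using assms(1,2) dissolve_mk unfolding white_list_def by blast+
  then show ?thesis using assms(3) by argo
qed

lemma excess_black:
  assumes "reduced (Node True ts)"
  shows "excess (Node True ts) + 1 = length ts + sum_list (map excess ts)" "2 \<le> length ts"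
proof -
  show "2 \<le> length ts" using assms by simp
  then show "excess (Node True ts) + 1 = length ts + sum_list (map excess ts)"
    unfolding excess.simps if_True by linarith
qed

lemma excess_black_pos: "reduced (Node True ts) \<Longrightarrow> excess (Node True ts) \<ge> 1"
  using excess_black[of ts] by linarith

lemma black_or_Leaf: "\<not> rooted False t \<Longrightarrow> t \<noteq> Leaf \<Longrightarrow> \<exists>ts. t = Node True ts"
  by (cases t) auto

lemma white_list_0: "white_list ts \<Longrightarrow> sum_list (map excess ts) = 0 \<Longrightarrow> ts = L (length ts)"
proof (induction ts)
  case (Cons t ts)
  then have "t = Leaf" using black_or_Leaf[of t] excess_black_pos by force
  moreover have "L (length ts) = ts" using Cons by simp
  ultimately show ?case by simp
qed simp

lemma white_list_pos:
  "white_list ts \<Longrightarrow> sum_list (map excess ts) > 0 \<Longrightarrow> \<exists>p us vs. ts = L p @ Node True us # vs"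
proof (induction ts)
  case (Cons t ts)
  show ?case
  proof (cases "t = Leaf")
    case True
    then obtain p us vs where "ts = L p @ Node True us # vs" using Cons by auto
    then show ?thesis using True by (intro exI[of _ "Suc p"]) auto
  next
    case False
    then obtain us where "t = Node True us" using black_or_Leaf[of t] Cons.prems by auto
    then show ?thesis by (intro exI[of _ 0]) auto
  qed
qed simp

lemma reduced_dissolve_False:
  assumes "reduced t"
  shows "white_list (dissolve False t)" "dissolve False t \<noteq> []"
    "sum_list (map excess (dissolve False t)) = excess t" "sum_list (map leaves (dissolve False t)) = leaves t"
    "bal m t \<Longrightarrow> \<forall>s\<in>set (dissolve False t). bal m s"
proof -
  show "white_list (dissolve False t)" "dissolve False t \<noteq> []"
    using reduced_dissolve[OF assms, of False] by (auto simp: white_list_def)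
  then show "sum_list (map excess (dissolve False t)) = excess t"
    using excess_mk_False[of "dissolve False t"] mk_dissolve[OF assms] by simp
qed (use leaves_dissolve bal_dissolve in auto)

lemma reduced_excess_0:
  assumes "reduced t" "excess t = 0"
  shows "t = branch (leaves t)" "leaves t \<ge> 1"
proof -
  note d = reduced_dissolve_False[OF assms(1)]
  have l: "dissolve False t = L (length (dissolve False t))"
    using white_list_0[OF d(1)] d(3) assms(2) by simp
  then have "leaves t = length (dissolve False t)"
    using d(4) by (metis leaves.simps(1) map_replicate mult.right_neutral sum_list_replicate of_nat_id)
  then show "t = branch (leaves t)" "leaves t \<ge> 1"
    using mk_dissolve[OF assms(1)] l d(2) by (auto simp: branch_def Suc_le_eq)
qed

lemma black_excess_1:
  assumes "reduced (Node True ts)" "excess (Node True ts) = 1"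
  obtains a b where "ts = [branch a, branch b]" "a \<ge> 1" "b \<ge> 1"
proof -
  have "length ts = 2" "sum_list (map excess ts) = 0"
    using excess_black[OF assms(1)] assms(2) by linarith+
  then obtain x y where "ts = [x, y]" by (auto simp: length_Suc_conv numeral_2_eq_2)
  then show ?thesis
    using that assms reduced_excess_0[of x] reduced_excess_0[of y] by auto
qed

text \<open>The excess comes from one black child, and all other children are leaves. A reduced
  white node has a second child, hence \<open>r + s \<ge> 1\<close>.\<close>

lemma white_excess_1:
  assumes "reduced t" "excess t = 1" "\<not> rooted True t"
  obtains r s a b where "t = Node False (L r @ fork a b # L s)" "a \<ge> 1" "b \<ge> 1" "r + s \<ge> 1"
proof -
  note d = reduced_dissolve_False[OF assms(1)]
  obtain p us vs where sp: "dissolve False t = L p @ Node True us # vs"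
    using white_list_pos[OF d(1)] d(3) assms(2) by auto
  have us: "reduced (Node True us)" and vs: "white_list vs" using d(1) unfolding sp by auto
  have "excess (Node True us) + sum_list (map excess vs) = 1"
    using d(3) assms(2) unfolding sp by (simp add: sum_list_replicate)
  then have e: "excess (Node True us) = 1" "sum_list (map excess vs) = 0"
    using excess_black_pos[OF us] by linarith+
  obtain a b where ab: "us = [branch a, branch b]" "a \<ge> 1" "b \<ge> 1" using black_excess_1[OF us e(1)] .
  have dt: "dissolve False t = L p @ fork a b # L (length vs)"
    using sp ab(1) white_list_0[OF vs e(2)] by simp
  have pv: "p + length vs \<ge> 1"
  proof (rule ccontr)
    assume "\<not> p + length vs \<ge> 1"
    then have "p = 0" "length vs = 0" by linarith+
    then have "dissolve False t = [fork a b]" using dt by simp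
    then have "t = fork a b" using mk_dissolve[OF assms(1)] by (simp add: mk_def)
    then show False using assms(3) by simp
  qed
  then have "t = Node False (L p @ fork a b # L (length vs))"
    using dt mk_dissolve[OF assms(1)] by (auto simp: mk_def)
  then show ?thesis using that ab pv by blast
qed

text \<open>The children of the root of a normal tree with \<open>k = 3\<close>, the root being white; it is erased by
  \<^const>\<open>mk\<close> if it has a single child. The numbers \<open>p\<close>, \<open>q\<close>, \<open>r\<close>, \<open>s\<close> count single leaves, the others are
  sizes of branches at black nodes. There is one black node with three children in \<open>FA\<close>, a black node
  below another one in \<open>FB\<close> and \<open>FB'\<close>, and two incomparable ones in \<open>FC\<close>.\<close>

definition SA :: "nat \<Rightarrow> (nat \<times> nat \<times> nat \<times> nat \<times> nat) set" where
  "SA m = {(p, q, a, b, c). p + q < m \<and> 1 \<le> a \<and> a \<le> m \<and> 1 \<le> b \<and> b \<le> m \<and> 1 \<le> c \<and> c \<le> m \<and>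
     p + q + a + b + c = 3 * m}"

definition SB :: "nat \<Rightarrow> (nat \<times> nat \<times> nat \<times> nat \<times> nat \<times> nat \<times> nat) set" where
  "SB m = {(p, q, d, r, s, a, b). p + q < m \<and> m \<le> p + q + d \<and> 1 \<le> d \<and> d \<le> m \<and> 1 \<le> a \<and> a \<le> m \<and>
     1 \<le> b \<and> b \<le> m \<and> m < a + b \<and> 1 \<le> r + s \<and> p + q + d + r + s + a + b = 3 * m}"

definition SC :: "nat \<Rightarrow> (nat \<times> nat \<times> nat \<times> nat \<times> nat \<times> nat \<times> nat) set" where
  "SC m = {(p, q, r, a, b, c, d). 1 \<le> a \<and> a \<le> m \<and> 1 \<le> b \<and> b \<le> m \<and> 1 \<le> c \<and> c \<le> m \<and> 1 \<le> d \<and> d \<le> m \<and>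
     m < a + b \<and> m < c + d \<and> p + q + r + a + b + c + d = 3 * m}"

fun FA :: "nat \<times> nat \<times> nat \<times> nat \<times> nat \<Rightarrow> plane_tree list" where
  "FA (p, q, a, b, c) = L p @ Node True [branch a, branch b, branch c] # L q"

fun FB :: "nat \<times> nat \<times> nat \<times> nat \<times> nat \<times> nat \<times> nat \<Rightarrow> plane_tree list" where
  "FB (p, q, d, r, s, a, b) = L p @ Node True [branch d, Node False (L r @ fork a b # L s)] # L q"

fun FB' :: "nat \<times> nat \<times> nat \<times> nat \<times> nat \<times> nat \<times> nat \<Rightarrow> plane_tree list" where
  "FB' (p, q, d, r, s, a, b) = L p @ Node True [Node False (L r @ fork a b # L s), branch d] # L q"

fun FC :: "nat \<times> nat \<times> nat \<times> nat \<times> nat \<times> nat \<times> nat \<Rightarrow> plane_tree list" where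
  "FC (p, q, r, a, b, c, d) = L p @ fork a b # L q @ fork c d # L r"

definition valid_list :: "nat \<Rightarrow> plane_tree list \<Rightarrow> bool" where
  "valid_list m ts \<longleftrightarrow> white_list ts \<and> sum_list (map excess ts) = 2 \<and> sum_list (map leaves ts) = 3 * m \<and>
     (\<forall>t\<in>set ts. bal m t)"

lemma normal_trees_3:
  assumes "m \<ge> 1"
  shows "normal_trees 3 m = mk False ` {ts. valid_list m ts}" "inj_on (mk False) {ts. valid_list m ts}"
proof -
  show "inj_on (mk False) {ts. valid_list m ts}"
    by (rule inj_onI) (auto simp: valid_list_def intro: mk_False_inj)
  show "normal_trees 3 m = mk False ` {ts. valid_list m ts}"
  proof (intro equalityI subsetI)
    fix t assume "t \<in> normal_trees 3 m"
    then have t: "reduced t" "leaves t = 3 * m" "excess t = 2" "bal m t" by (auto simp: normal_trees_def)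
    have "valid_list m (dissolve False t)"
      using reduced_dissolve_False[OF t(1)] t by (simp add: valid_list_def)
    then show "t \<in> mk False ` {ts. valid_list m ts}" using mk_dissolve[OF t(1)] by force
  next
    fix t assume "t \<in> mk False ` {ts. valid_list m ts}"
    then obtain ts where t: "t = mk False ts" and v: "valid_list m ts" by auto
    then have ne: "ts \<noteq> []" by (auto simp: valid_list_def)
    have "excess t = 2" "leaves t = 3 * m" "reduced t"
      using v excess_mk_False[OF ne] leaves_mk[of False ts] reduced_mk[of ts False] ne
      unfolding t valid_list_def white_list_def by auto
    \<comment> \<open>At the root the range condition reads 2 * m < 3 * m, with equality in the
      upper bound, so it holds since \<open>m\<close> is positive.\<close>
    moreover have "bal m t"
      unfolding t bal_mk[OF ne] using v calculation assms t by (simp add: valid_list_def in_range_def)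
    ultimately show "t \<in> normal_trees 3 m" by (simp add: normal_trees_def)
  qed
qed

text \<open>The upper bound 2 * m on the leaves of the fork follows from the bounds on its branches;
  only the lower bound is a new condition.\<close>

lemma bal_fork:
  assumes "a \<ge> 1" "b \<ge> 1"
  shows "bal m (fork a b) \<longleftrightarrow> a \<le> m \<and> b \<le> m \<and> m < a + b"
proof -
  have "leaves (fork a b) = a + b" "excess (fork a b) = 1"
    using branch_weights[OF assms(1)] branch_weights[OF assms(2)] by simp_all
  then have "in_range m (fork a b) \<longleftrightarrow> m < a + b \<and> a + b \<le> 2 * m"
    unfolding in_range_def by auto
  moreover have "bal m (fork a b) \<longleftrightarrow> in_range m (fork a b) \<and> bal m (branch a) \<and> bal m (branch b)"
    by simp
  ultimately show ?thesis unfolding bal_branch[OF assms(1)] bal_branch[OF assms(2)] by linarith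
qed

lemma bal_white_1:
  assumes "m \<ge> 1" "a \<ge> 1" "b \<ge> 1"
  shows "bal m (Node False (L r @ fork a b # L s)) \<longleftrightarrow>
    a \<le> m \<and> b \<le> m \<and> m < a + b \<and> r + s + a + b \<le> 2 * m"
proof -
  define x where "x = fork a b"
  have x: "leaves x = a + b" "excess x = 1"
    using branch_weights[OF assms(2)] branch_weights[OF assms(3)] by (simp_all add: x_def)
  have bL: "bal m Leaf" using assms(1) by (simp add: in_range_def)
  have "in_range m (Node False (L r @ x # L s)) \<longleftrightarrow> m < r + s + a + b \<and> r + s + a + b \<le> 2 * m"
    using x by (auto simp: in_range_def sum_list_replicate)
  moreover have "bal m (Node False (L r @ x # L s)) \<longleftrightarrow> in_range m (Node False (L r @ x # L s)) \<and> bal m x"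
    using bL by auto
  moreover have "bal m x \<longleftrightarrow> a \<le> m \<and> b \<le> m \<and> m < a + b"
    unfolding x_def by (rule bal_fork[OF assms(2,3)])
  ultimately show ?thesis unfolding x_def by linarith
qed

text \<open>As the leaves total 3 * m, the lower bound 2 * m < a + b + c at the black node turns
  into p + q < m.\<close>

lemma valid_FA:
  assumes "m \<ge> 1" "a \<ge> 1" "b \<ge> 1" "c \<ge> 1"
  shows "valid_list m (FA (p, q, a, b, c)) \<longleftrightarrow> (p, q, a, b, c) \<in> SA m"
proof -
  note w = branch_weights[OF assms(2)] branch_weights[OF assms(3)] branch_weights[OF assms(4)]
  define x where "x = Node True [branch a, branch b, branch c]"
  have x: "leaves x = a + b + c" "excess x = 2" "reduced x" "\<not> rooted False x"
    using w by (simp_all add: x_def)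
  have bL: "bal m Leaf" using assms(1) by (simp add: in_range_def)
  have "bal m x \<longleftrightarrow> in_range m x \<and> bal m (branch a) \<and> bal m (branch b) \<and> bal m (branch c)"
    by (simp add: x_def)
  moreover have "in_range m x \<longleftrightarrow> 2 * m < a + b + c \<and> a + b + c \<le> 3 * m"
    using x(1,2) by (auto simp: in_range_def)
  ultimately have bx: "bal m x \<longleftrightarrow> a \<le> m \<and> b \<le> m \<and> c \<le> m \<and> 2 * m < a + b + c \<and> a + b + c \<le> 3 * m"
    unfolding bal_branch[OF assms(2)] bal_branch[OF assms(3)] bal_branch[OF assms(4)] by linarith
  have "valid_list m (L p @ x # L q) \<longleftrightarrow> p + q + a + b + c = 3 * m \<and> bal m x"
    using x bL by (auto simp: valid_list_def sum_list_replicate)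
  then show ?thesis unfolding FA.simps x_def[symmetric] bx SA_def using assms by auto
qed

text \<open>With total 3 * m, the upper bound r + s + a + b \<le> 2 * m at the white node becomes m
  \<le> p + q + d, and the lower bound at the upper black node becomes p + q < m.\<close>

lemma valid_FB:
  assumes "m \<ge> 1" "a \<ge> 1" "b \<ge> 1" "d \<ge> 1" "r + s \<ge> 1"
  shows "valid_list m (FB (p, q, d, r, s, a, b)) \<longleftrightarrow> (p, q, d, r, s, a, b) \<in> SB m"
    "valid_list m (FB' (p, q, d, r, s, a, b)) \<longleftrightarrow> (p, q, d, r, s, a, b) \<in> SB m"
proof -
  let ?X = "Node False (L r @ fork a b # L s)"
  note w = branch_weights[OF assms(2)] branch_weights[OF assms(3)] branch_weights[OF assms(4)]
  have X: "leaves ?X = r + s + a + b" "excess ?X = 1" "reduced ?X" "\<not> rooted True ?X"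
    using w assms(5) by (auto simp: sum_list_replicate)
  have bX: "bal m ?X \<longleftrightarrow> a \<le> m \<and> b \<le> m \<and> m < a + b \<and> r + s + a + b \<le> 2 * m"
    by (rule bal_white_1[OF assms(1-3)])
  have bL: "bal m Leaf" using assms(1) by (simp add: in_range_def)
  define x where "x = ?X"
  note X' = X[folded x_def] and bX' = bX[folded x_def]
  have 1: "valid_list m (L p @ Node True [branch d, x] # L q) \<longleftrightarrow>
    p + q + d + r + s + a + b = 3 * m \<and> d \<le> m \<and> bal m x \<and> in_range m (Node True [branch d, x])"
    using w X' bal_branch[OF assms(4)] bL by (auto simp: valid_list_def sum_list_replicate)
  have 2: "valid_list m (L p @ Node True [x, branch d] # L q) \<longleftrightarrow>
    p + q + d + r + s + a + b = 3 * m \<and> d \<le> m \<and> bal m x \<and> in_range m (Node True [x, branch d])"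
    using w X' bal_branch[OF assms(4)] bL by (auto simp: valid_list_def sum_list_replicate)
  have 3: "in_range m (Node True [branch d, x]) \<longleftrightarrow> 2 * m < d + r + s + a + b \<and> d + r + s + a + b \<le> 3 * m"
    "in_range m (Node True [x, branch d]) \<longleftrightarrow> 2 * m < d + r + s + a + b \<and> d + r + s + a + b \<le> 3 * m"
    using w X' by (auto simp: in_range_def)
  show "valid_list m (FB (p, q, d, r, s, a, b)) \<longleftrightarrow> (p, q, d, r, s, a, b) \<in> SB m"
    unfolding FB.simps x_def[symmetric] 1 3 bX' SB_def using assms by auto
  show "valid_list m (FB' (p, q, d, r, s, a, b)) \<longleftrightarrow> (p, q, d, r, s, a, b) \<in> SB m"
    unfolding FB'.simps x_def[symmetric] 2 3 bX' SB_def using assms by auto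
qed

lemma valid_FC:
  assumes "m \<ge> 1" "a \<ge> 1" "b \<ge> 1" "c \<ge> 1" "d \<ge> 1"
  shows "valid_list m (FC (p, q, r, a, b, c, d)) \<longleftrightarrow> (p, q, r, a, b, c, d) \<in> SC m"
proof -
  note w = branch_weights[OF assms(2)] branch_weights[OF assms(3)] branch_weights[OF assms(4)]
    branch_weights[OF assms(5)]
  have bL: "bal m Leaf" using assms(1) by (simp add: in_range_def)
  have f: "leaves (fork a b) = a + b" "leaves (fork c d) = c + d" "excess (fork a b) = 1" "excess (fork c d) = 1"
    "reduced (fork a b)" "reduced (fork c d)"
    using w by auto
  define x y where xy: "x = fork a b" "y = fork c d"
  have nr: "\<not> rooted False x" "\<not> rooted False y" unfolding xy by auto
  have "valid_list m (L p @ x # L q @ y # L r) \<longleftrightarrow>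
    p + q + r + a + b + c + d = 3 * m \<and> bal m x \<and> bal m y"
    using f[folded xy] nr bL by (auto simp: valid_list_def sum_list_replicate)
  then show ?thesis
    unfolding FC.simps xy bal_fork[OF assms(2,3)] bal_fork[OF assms(4,5)] SC_def using assms by auto
qed

text \<open>The number of children plus their excesses is 3, with at least two children: either
  three of excess 0, or two whose excesses are 0 and 1 in some order.\<close>

lemma black_excess_2:
  assumes "reduced (Node True ts)" "excess (Node True ts) = 2"
  shows "(\<exists>a b c. ts = [branch a, branch b, branch c] \<and> a \<ge> 1 \<and> b \<ge> 1 \<and> c \<ge> 1) \<or>
    (\<exists>d r s a b. (ts = [branch d, Node False (L r @ fork a b # L s)] \<or>
       ts = [Node False (L r @ fork a b # L s), branch d]) \<and> a \<ge> 1 \<and> b \<ge> 1 \<and> d \<ge> 1 \<and> r + s \<ge> 1)"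
proof -
  have len: "length ts = 2 \<and> sum_list (map excess ts) = 1 \<or> length ts = 3 \<and> sum_list (map excess ts) = 0"
    using excess_black[OF assms(1)] assms(2) by linarith
  have red: "\<forall>t\<in>set ts. reduced t \<and> \<not> rooted True t" using assms(1) by simp
  show ?thesis
    using len
  proof (elim disjE conjE)
    assume "length ts = 3" "sum_list (map excess ts) = 0"
    then obtain x y z where "ts = [x, y, z]" by (auto simp: length_Suc_conv numeral_3_eq_3)
    then show ?thesis
      using \<open>sum_list (map excess ts) = 0\<close> red reduced_excess_0[of x] reduced_excess_0[of y] reduced_excess_0[of z]
      by auto
  next
    assume l: "length ts = 2" "sum_list (map excess ts) = 1"
    then obtain x y where ts: "ts = [x, y]" by (auto simp: length_Suc_conv numeral_2_eq_2)
    then have "excess x = 0 \<and> excess y = 1 \<or> excess x = 1 \<and> excess y = 0" using l(2) by auto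
    then show ?thesis
    proof (elim disjE conjE)
      assume e: "excess x = 0" "excess y = 1"
      have z: "reduced y" "\<not> rooted True y" using red ts by auto
      obtain r s a b where "y = Node False (L r @ fork a b # L s)" "a \<ge> 1" "b \<ge> 1" "r + s \<ge> 1"
        using white_excess_1[OF z(1) e(2) z(2)] .
      moreover have "x = branch (leaves x)" "leaves x \<ge> 1" using reduced_excess_0[of x] e(1) red ts by auto
      ultimately show ?thesis unfolding ts by blast
    next
      assume e: "excess x = 1" "excess y = 0"
      have z: "reduced x" "\<not> rooted True x" using red ts by auto
      obtain r s a b where "x = Node False (L r @ fork a b # L s)" "a \<ge> 1" "b \<ge> 1" "r + s \<ge> 1"
        using white_excess_1[OF z(1) e(1) z(2)] .
      moreover have "y = branch (leaves y)" "leaves y \<ge> 1" using reduced_excess_0[of y] e(2) red ts by auto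
      ultimately show ?thesis unfolding ts by blast
    qed
  qed
qed

text \<open>Each black entry has excess at least 1, so a total of 2 is carried by one black entry or
  shared by two of excess 1; all other entries are leaves.\<close>

lemma valid_lists:
  assumes m: "m \<ge> 1"
  shows "{ts. valid_list m ts} = FA ` SA m \<union> FB ` SB m \<union> FB' ` SB m \<union> FC ` SC m"
proof (intro equalityI subsetI)
  fix ts assume "ts \<in> FA ` SA m \<union> FB ` SB m \<union> FB' ` SB m \<union> FC ` SC m"
  then show "ts \<in> {ts. valid_list m ts}"
  proof (elim UnE imageE)
    fix w assume w: "ts = FA w" "w \<in> SA m"
    obtain p q a b c where wd: "w = (p, q, a, b, c)" by (cases w) auto
    then show ?thesis using valid_FA[of m a b c p q] w m by (auto simp: SA_def simp del: FA.simps)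
  next
    fix w assume w: "ts = FB w" "w \<in> SB m"
    obtain p q d r s a b where wd: "w = (p, q, d, r, s, a, b)" by (cases w) auto
    then show ?thesis using valid_FB(1)[of m a b d r s p q] w m by (auto simp: SB_def simp del: FB.simps)
  next
    fix w assume w: "ts = FB' w" "w \<in> SB m"
    obtain p q d r s a b where wd: "w = (p, q, d, r, s, a, b)" by (cases w) auto
    then show ?thesis using valid_FB(2)[of m a b d r s p q] w m by (auto simp: SB_def simp del: FB'.simps)
  next
    fix w assume w: "ts = FC w" "w \<in> SC m"
    obtain p q r a b c d where wd: "w = (p, q, r, a, b, c, d)" by (cases w) auto
    then show ?thesis using valid_FC[of m a b c d p q r] w m by (auto simp: SC_def simp del: FC.simps)
  qed
next
  fix ts assume "ts \<in> {ts. valid_list m ts}"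
  then have v: "valid_list m ts" by simp
  then have wl: "white_list ts" "sum_list (map excess ts) = 2" by (auto simp: valid_list_def)
  obtain p us vs where sp: "ts = L p @ Node True us # vs" using white_list_pos[OF wl(1)] wl(2) by auto
  have us: "reduced (Node True us)" and vs: "white_list vs" using wl(1) unfolding sp by auto
  have "excess (Node True us) + sum_list (map excess vs) = 2"
    using wl(2) unfolding sp by (simp add: sum_list_replicate)
  then consider "excess (Node True us) = 2" "sum_list (map excess vs) = 0"
    | "excess (Node True us) = 1" "sum_list (map excess vs) = 1"
    using excess_black_pos[OF us] by linarith
  then show "ts \<in> FA ` SA m \<union> FB ` SB m \<union> FB' ` SB m \<union> FC ` SC m"
  proof cases
    case 1
    have ts: "ts = L p @ Node True us # L (length vs)" using sp white_list_0[OF vs 1(2)] by simp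
    from black_excess_2[OF us 1(1)] show ?thesis
    proof (elim disjE exE conjE)
      fix a b c assume "us = [branch a, branch b, branch c]" and *: "a \<ge> 1" "b \<ge> 1" "c \<ge> 1"
      then have t: "ts = FA (p, length vs, a, b, c)" using ts by simp
      then have "(p, length vs, a, b, c) \<in> SA m" using v valid_FA[OF m *] by (simp only:)
      then show ?thesis using t by blast
    next
      fix d r s a b assume "us = [branch d, Node False (L r @ fork a b # L s)]"
        and *: "a \<ge> 1" "b \<ge> 1" "d \<ge> 1" "r + s \<ge> 1"
      then have t: "ts = FB (p, length vs, d, r, s, a, b)" using ts by simp
      then have "(p, length vs, d, r, s, a, b) \<in> SB m" using v valid_FB(1)[OF m *] by (simp only:)
      then show ?thesis using t by blast
    next
      fix d r s a b assume "us = [Node False (L r @ fork a b # L s), branch d]"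
        and *: "a \<ge> 1" "b \<ge> 1" "d \<ge> 1" "r + s \<ge> 1"
      then have t: "ts = FB' (p, length vs, d, r, s, a, b)" using ts by simp
      then have "(p, length vs, d, r, s, a, b) \<in> SB m" using v valid_FB(2)[OF m *] by (simp only:)
      then show ?thesis using t by blast
    qed
  next
    case 2
    obtain a b where ab: "us = [branch a, branch b]" "a \<ge> 1" "b \<ge> 1" using black_excess_1[OF us 2(1)] .
    obtain q us' ws where sp': "vs = L q @ Node True us' # ws" using white_list_pos[OF vs] 2(2) by auto
    have us': "reduced (Node True us')" and ws: "white_list ws" using vs unfolding sp' by auto
    have "excess (Node True us') + sum_list (map excess ws) = 1"
      using 2(2) unfolding sp' by (simp add: sum_list_replicate)
    then have e: "excess (Node True us') = 1" "sum_list (map excess ws) = 0"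
      using excess_black_pos[OF us'] by linarith+
    obtain c d where cd: "us' = [branch c, branch d]" "c \<ge> 1" "d \<ge> 1" using black_excess_1[OF us' e(1)] .
    have t: "ts = FC (p, q, length ws, a, b, c, d)" using sp sp' ab(1) cd(1) white_list_0[OF ws e(2)] by simp
    then have "(p, q, length ws, a, b, c, d) \<in> SC m" using v valid_FC[OF m ab(2,3) cd(2,3)] by (simp only:)
    then show ?thesis using t by blast
  qed
qed

section \<open>Injectivity and disjointness of the four families\<close>

lemma L_split:
  "L p @ x # us = L q @ y # vs \<Longrightarrow> x \<noteq> Leaf \<Longrightarrow> y \<noteq> Leaf \<Longrightarrow> p = q \<and> x = y \<and> us = vs"
proof (induction p arbitrary: q)
  case 0
  then show ?case by (cases q) auto
next
  case (Suc p)
  then show ?case by (cases q) auto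
qed

lemma L_eq: "L p = L q \<longleftrightarrow> p = q"
  by (metis length_replicate)

lemma branch_inj: "branch a = branch b \<Longrightarrow> a \<ge> 1 \<Longrightarrow> b \<ge> 1 \<Longrightarrow> a = b"
  by (metis branch_weights(1))

lemma inj_FA: "inj_on FA (SA m)"
proof (rule inj_onI)
  fix w w' assume w: "w \<in> SA m" "w' \<in> SA m" "FA w = FA w'"
  obtain p q a b c p' q' a' b' c' where wd: "w = (p, q, a, b, c)" "w' = (p', q', a', b', c')"
    by (cases w, cases w') auto
  have 1: "p = p'" "branch a = branch a'" "branch b = branch b'" "branch c = branch c'" "q = q'"
    using w(3) unfolding wd FA.simps by (auto dest!: L_split simp: L_eq)
  have 2: "a \<ge> 1" "b \<ge> 1" "c \<ge> 1" "a' \<ge> 1" "b' \<ge> 1" "c' \<ge> 1"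
    using w(1,2) unfolding wd SA_def by simp_all
  have "a = a'" "b = b'" "c = c'" using 1(2-4) 2 branch_inj by blast+
  then show "w = w'" using 1(1,5) unfolding wd by simp
qed

lemma inj_FB: "inj_on FB (SB m)" "inj_on FB' (SB m)"
proof -
  have *: "w = w'" if w: "w \<in> SB m" "w' \<in> SB m" and e: "FB w = FB w' \<or> FB' w = FB' w'" for w w'
  proof -
    obtain p q d r s a b p' q' d' r' s' a' b' where
      wd: "w = (p, q, d, r, s, a, b)" "w' = (p', q', d', r', s', a', b')"
      by (cases w, cases w') auto
    have 1: "p = p' \<and> branch d = branch d' \<and> L r @ fork a b # L s = L r' @ fork a' b' # L s' \<and> L q = L q'"
      using e
    proof
      assume "FB w = FB w'"
      then show ?thesis unfolding wd FB.simps by (auto dest!: L_split)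
    next
      assume "FB' w = FB' w'"
      then show ?thesis unfolding wd FB'.simps by (auto dest!: L_split)
    qed
    then have "r = r' \<and> fork a b = fork a' b' \<and> L s = L s'"
      using L_split[of r "fork a b" "L s" r' "fork a' b'" "L s'"] by blast
    then have 2: "r = r'" "s = s'" "branch a = branch a'" "branch b = branch b'" by (simp_all add: L_eq)
    have 3: "a \<ge> 1" "b \<ge> 1" "d \<ge> 1" "a' \<ge> 1" "b' \<ge> 1" "d' \<ge> 1"
      using w unfolding wd SB_def by simp_all
    have "a = a'" "b = b'" "d = d'" using 1 2(3,4) 3 branch_inj by blast+
    then show ?thesis using 1 2(1,2) unfolding wd by (simp add: L_eq)
  qed
  show "inj_on FB (SB m)" "inj_on FB' (SB m)" using * by (auto intro!: inj_onI simp del: FB.simps FB'.simps)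
qed

lemma inj_FC: "inj_on FC (SC m)"
proof (rule inj_onI)
  fix w w' assume w: "w \<in> SC m" "w' \<in> SC m" "FC w = FC w'"
  obtain p q r a b c d p' q' r' a' b' c' d' where
    wd: "w = (p, q, r, a, b, c, d)" "w' = (p', q', r', a', b', c', d')"
    by (cases w, cases w') auto
  have 1: "p = p' \<and> fork a b = fork a' b' \<and> L q @ fork c d # L r = L q' @ fork c' d' # L r'"
    using w(3) unfolding wd FC.simps by (auto dest!: L_split)
  then have "q = q' \<and> fork c d = fork c' d' \<and> L r = L r'"
    using L_split[of q "fork c d" "L r" q' "fork c' d'" "L r'"] by blast
  then have 2: "q = q'" "r = r'" "branch c = branch c'" "branch d = branch d'" by (simp_all add: L_eq)
  have 3: "a \<ge> 1" "b \<ge> 1" "c \<ge> 1" "d \<ge> 1" "a' \<ge> 1" "b' \<ge> 1" "c' \<ge> 1" "d' \<ge> 1"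
    using w(1,2) unfolding wd SC_def by simp_all
  have "branch a = branch a'" "branch b = branch b'" using 1 by simp_all
  then have "a = a'" "b = b'" "c = c'" "d = d'" using 2(3,4) 3 branch_inj by blast+
  then show "w = w'" using 1 2(1,2) unfolding wd by simp
qed

text \<open>An invariant that is constant on each family and tells the four apart, mirror images
  included.\<close>

definition sig :: "plane_tree list \<Rightarrow> nat list list" where
  "sig ts = map (\<lambda>t. map excess (kids t)) (filter (\<lambda>t. t \<noteq> Leaf) ts)"

lemma sig_F:
  "w \<in> SA m \<Longrightarrow> sig (FA w) = [[0, 0, 0]]" "v \<in> SB m \<Longrightarrow> sig (FB v) = [[0, 1]]"
  "v \<in> SB m \<Longrightarrow> sig (FB' v) = [[1, 0]]" "v \<in> SC m \<Longrightarrow> sig (FC v) = [[0, 0], [0, 0]]"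
  by (auto simp: sig_def SA_def SB_def SC_def branch_weights(2) sum_list_replicate)

lemma finite_SABC: "finite (SA m)" "finite (SB m)" "finite (SC m)"
proof -
  let ?N = "{..3 * m}"
  show "finite (SA m)"
    by (rule finite_subset[of _ "?N \<times> ?N \<times> ?N \<times> ?N \<times> ?N"]) (clarsimp simp: SA_def, simp)
  show "finite (SB m)"
    by (rule finite_subset[of _ "?N \<times> ?N \<times> ?N \<times> ?N \<times> ?N \<times> ?N \<times> ?N"]) (clarsimp simp: SB_def, simp)
  show "finite (SC m)"
    by (rule finite_subset[of _ "?N \<times> ?N \<times> ?N \<times> ?N \<times> ?N \<times> ?N \<times> ?N"]) (clarsimp simp: SC_def, simp)
qed

lemma card_normal_trees_3:
  assumes "m \<ge> 1"
  shows "card (normal_trees 3 m) = card (SA m) + 2 * card (SB m) + card (SC m)"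
proof -
  have d: "FA ` SA m \<inter> FB ` SB m = {}" "(FA ` SA m \<union> FB ` SB m) \<inter> FB' ` SB m = {}"
    "(FA ` SA m \<union> FB ` SB m \<union> FB' ` SB m) \<inter> FC ` SC m = {}"
    using sig_F[of _ m] by (fastforce simp del: FA.simps FB.simps FB'.simps FC.simps)+
  have "card (normal_trees 3 m) = card (FA ` SA m \<union> FB ` SB m \<union> FB' ` SB m \<union> FC ` SC m)"
    using normal_trees_3[OF assms] valid_lists[OF assms] by (simp add: card_image)
  also have "\<dots> = card (FA ` SA m) + card (FB ` SB m) + card (FB' ` SB m) + card (FC ` SC m)"
    using d finite_SABC[of m] by (subst card_Un_disjoint; (simp; fail)?)+
  finally show ?thesis
    using card_image[OF inj_FA] card_image[OF inj_FB(1)] card_image[OF inj_FB(2)] card_image[OF inj_FC] by simp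
qed

section \<open>Counting\<close>

text \<open>In terms of the defects \<open>m - a\<close> of the branch sizes the constraints become triangular, so that the
  parameters can be summed one after the other.\<close>

lemma card_SA: "card (SA (Suc M)) = (\<Sum>i\<le>M. (i + 1) * (\<Sum>s\<le>i. s + 1))"
proof -
  \<comment> \<open>Here \<open>i\<close> is \<open>p + q\<close>, which equals the sum of the three
    defects because the total is 3 * m. \<open>x\<close> is the defect of \<open>a\<close>, and
    \<open>s\<close> is the sum of the defects of \<open>a\<close> and \<open>b\<close>.\<close>
  let ?P = "SIGMA i:{..M}. {..i} \<times> (SIGMA s:{..i}. {..s})"
  have "bij_betw (\<lambda>(i, p, s, x). (p, i - p, Suc M - x, Suc M - (s - x), Suc M - (i - s))) ?P (SA (Suc M))"
    by (rule bij_betw_byWitness[where f' = "\<lambda>(p, q, a, b, c). (p + q, p, (Suc M - a) + (Suc M - b), Suc M - a)"])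
      (auto simp: SA_def)
  then have "card (SA (Suc M)) = card ?P" by (rule bij_betw_same_card[symmetric])
  then show ?thesis by simp
qed

lemma card_SB: "card (SB (Suc M)) =
  (\<Sum>e\<le>M. (\<Sum>j\<le>M - e. e + j + 1) * (\<Sum>w<M - e. (e + w + 2) * (w + 2)))"
proof -
  \<comment> \<open>Here \<open>e\<close> is p + q + d - m, \<open>j\<close> the defect of
    \<open>d\<close> and \<open>x\<close> that of \<open>a\<close>. Since \<open>r + s\<close> is
    positive it is written as \<open>w + 1\<close>. The defects of \<open>a\<close> and
    \<open>b\<close> then add up to \<open>e + w + 1\<close>, and m < a + b becomes w < M -
    e.\<close>
  let ?P = "SIGMA e:{..M}. (SIGMA j:{..M - e}. {..e + j}) \<times> (SIGMA w:{..<M - e}. {..e + w + 1} \<times> {..w + 1})"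
  have "bij_betw (\<lambda>(e, (j, p), w, x, r). (p, e + j - p, Suc M - j, r, w + 1 - r, Suc M - x, Suc M - (e + 1 + w - x)))
    ?P (SB (Suc M))"
    by (rule bij_betw_byWitness[where f' = "\<lambda>(p, q, d, r, s, a, b).
        (p + q + d - Suc M, (Suc M - d, p), r + s - 1, Suc M - a, r)"])
      (auto simp: SB_def)
  then have "card (SB (Suc M)) = card ?P" by (rule bij_betw_same_card[symmetric])
  then show ?thesis by simp
qed

lemma card_SC: "card (SC (Suc M)) =
  (\<Sum>u\<le>M. \<Sum>w<u. (u + 1) * ((M - u + w + 2) * (\<Sum>l\<le>w. l + 1)))"
proof -
  \<comment> \<open>Here \<open>u\<close> is the sum of the defects of \<open>a\<close> and
    \<open>b\<close>, \<open>w\<close> is p + q + r and \<open>l\<close> is p + q, while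
    \<open>x\<close> and \<open>y\<close> are the defects of \<open>a\<close> and \<open>c\<close>.
    All four defects add up to m + w, so the second fork has M - u + 1 + w, and m < c + d becomes w
    < u.\<close>
  let ?P = "SIGMA u:{..M}. SIGMA w:{..<u}. {..u} \<times> {..M - u + 1 + w} \<times> (SIGMA l:{..w}. {..l})"
  have "bij_betw (\<lambda>(u, w, x, y, l, p). (p, l - p, w - l, Suc M - x, Suc M - (u - x), Suc M - y,
      Suc M - (M - u + 1 + w - y))) ?P (SC (Suc M))"
    by (rule bij_betw_byWitness[where f' = "\<lambda>(p, q, r, a, b, c, d).
        ((Suc M - a) + (Suc M - b), p + q + r, Suc M - a, Suc M - c, p + q, p)"])
      (auto simp: SC_def)
  then have "card (SC (Suc M)) = card ?P" by (rule bij_betw_same_card[symmetric])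
  then show ?thesis by simp
qed

text \<open>The polynomials below were found by interpolation. In the outer sums the upper limit and \<open>M\<close> are
  kept apart to make induction on the limit possible.\<close>

lemma sum_tri: "(\<Sum>s\<le>n. of_nat s + 1 :: rat) = (of_nat n + 1) * (of_nat n + 2) / 2"
  by (induction n) (simp_all add: field_simps)

lemma sum_A: "(\<Sum>i\<le>n. (of_nat i + 1) * ((of_nat i + 1) * (of_nat i + 2) / 2) :: rat) =
  (let n = of_nat n in (3*n^4 + 22*n^3 + 57*n^2 + 62*n + 24) / 24)"
proof (induction n)
  case (Suc n)
  show ?case unfolding sum.atMost_Suc Suc.IH of_nat_Suc Let_def by (simp add: field_simps; algebra)
qed simp

text \<open>The variable \<open>z\<close> stands for M - u. As a free variable it stays fixed in the
  induction on the limit of the inner sum.\<close>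

definition inner_C :: "rat \<Rightarrow> rat \<Rightarrow> rat" where
  "inner_C u z = (3*u^4 + 4*u^3*z + 14*u^3 + 12*u^2*z + 21*u^2 + 8*u*z + 10*u) / 24"

lemma sum_inner_C:
  "(\<Sum>w<u. (z + of_nat w + 2) * ((of_nat w + 1) * (of_nat w + 2) / 2)) = inner_C (of_nat u) z"
proof (induction u)
  case (Suc u)
  show ?case unfolding sum.lessThan_Suc Suc.IH of_nat_Suc inner_C_def by (simp add: field_simps; algebra)
qed (simp add: inner_C_def)

lemma sum_C: "(\<Sum>u\<le>k. (of_nat u + 1) * inner_C (of_nat u) (M - of_nat u)) =
  (let k = of_nat k in (- 5*k^6 + 24*k^5*M - 9*k^5 + 180*k^4*M + 115*k^4 + 480*k^3*M + 465*k^3 +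
     540*k^2*M + 610*k^2 + 216*k*M + 264*k) / 720)"
proof (induction k)
  case (Suc k)
  show ?case unfolding sum.atMost_Suc Suc.IH of_nat_Suc unfolding Let_def inner_C_def
    by (simp add: field_simps; algebra)
qed (simp add: inner_C_def)

lemma sum_B1: "(\<Sum>j\<le>K. e + of_nat j + 1 :: rat) = (let K = of_nat K in (2*e*K + 2*e + K^2 + 3*K + 2) / 2)"
proof (induction K)
  case (Suc K)
  show ?case unfolding sum.atMost_Suc Suc.IH of_nat_Suc Let_def by (simp add: field_simps; algebra)
qed simp

lemma sum_B2: "(\<Sum>w<K. (e + of_nat w + 2) * (of_nat w + 2) :: rat) =
  (let K = of_nat K in (3*e*K^2 + 9*e*K + 2*K^3 + 9*K^2 + 13*K) / 6)"
proof (induction K)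
  case (Suc K)
  show ?case unfolding sum.lessThan_Suc Suc.IH of_nat_Suc Let_def by (simp add: field_simps; algebra)
qed simp

text \<open>The product of the closed forms in \<open>sum_B1\<close> and \<open>sum_B2\<close>, with
  \<open>K\<close> standing for M - e.\<close>

definition inner_B :: "rat \<Rightarrow> rat \<Rightarrow> rat" where
  "inner_B e K = (2*e*K + 2*e + K^2 + 3*K + 2) / 2 * ((3*e*K^2 + 9*e*K + 2*K^3 + 9*K^2 + 13*K) / 6)"

lemma sum_B: "(\<Sum>e\<le>k. inner_B (of_nat e) (M - of_nat e)) =
  (let k = of_nat k in (- 5*k^6 - 21*k^5 + 30*k^4*M^2 + 90*k^4*M + 85*k^4 - 20*k^3*M^3 + 140*k^3*M + 345*k^3
     - 45*k^2*M^4 - 330*k^2*M^3 - 885*k^2*M^2 - 1020*k^2*M - 80*k^2 + 60*k*M^5 + 405*k*M^4 + 1010*k*M^3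
     + 855*k*M^2 - 290*k*M - 324*k + 60*M^5 + 450*M^4 + 1320*M^3 + 1710*M^2 + 780*M) / 360)"
proof (induction k)
  case 0
  show ?case by (simp add: inner_B_def field_simps) algebra
next
  case (Suc k)
  show ?case unfolding sum.atMost_Suc Suc.IH of_nat_Suc unfolding Let_def inner_B_def
    by (simp add: field_simps; algebra)
qed

lemma choose_6: "(of_nat (n choose 6) :: rat) =
  (let x = of_nat n in x * (x - 1) * (x - 2) * (x - 3) * (x - 4) * (x - 5) / 720)"
  unfolding binomial_gbinomial gbinomial_prod_rev Let_def
  by (simp add: numeral_eq_Suc fact_numeral)

text \<open>Over the rationals both sides are polynomials in \<open>n\<close> of degree 6, and their
  equality is a polynomial identity. The four binomials come from the four terms of the numerator,
  and the cardinality of \<open>SB\<close> enters twice because of the mirror images in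
  \<open>FB'\<close>.\<close>

lemma card_normal_trees_3_closed:
  "card (normal_trees 3 (Suc n)) =
    ((n + 6) choose 6) + 28 * ((n + 5) choose 6) + 56 * ((n + 4) choose 6) + 14 * ((n + 3) choose 6)"
proof -
  let ?x = "of_nat n :: rat"
  have tri: "of_nat (\<Sum>l\<le>k. l + 1) = ((of_nat k + 1) * (of_nat k + 2) / 2 :: rat)" for k
    using sum_tri[of k] by (simp add: add.commute)
  have A: "of_nat (card (SA (Suc n))) = (3*?x^4 + 22*?x^3 + 57*?x^2 + 62*?x + 24) / 24"
  proof -
    have "of_nat (card (SA (Suc n))) = (\<Sum>i\<le>n. (of_nat i + 1) * of_nat (\<Sum>s\<le>i. s + 1) :: rat)"
      unfolding card_SA of_nat_sum[of _ "{..n}"] by (simp only: of_nat_mult of_nat_add of_nat_1)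
    then show ?thesis unfolding tri sum_A by (simp add: Let_def)
  qed
  have B: "of_nat (card (SB (Suc n))) = (\<Sum>e\<le>n. inner_B (of_nat e) (?x - of_nat e))"
  proof -
    have "of_nat ((\<Sum>j\<le>n - e. e + j + 1) * (\<Sum>w<n - e. (e + w + 2) * (w + 2))) =
      inner_B (of_nat e) (?x - of_nat e)" if "e \<le> n" for e
    proof -
      have "of_nat ((\<Sum>j\<le>n - e. e + j + 1) * (\<Sum>w<n - e. (e + w + 2) * (w + 2))) =
        (\<Sum>j\<le>n - e. of_nat e + of_nat j + 1) * (\<Sum>w<n - e. (of_nat e + of_nat w + 2) * (of_nat w + 2) :: rat)"
        by (simp only: of_nat_mult of_nat_sum of_nat_add of_nat_1 of_nat_numeral)
      then show ?thesis unfolding sum_B1 sum_B2 inner_B_def using that by (simp add: Let_def of_nat_diff)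
    qed
    then show ?thesis unfolding card_SB of_nat_sum[of _ "{..n}"] by (intro sum.cong) simp_all
  qed
  have C: "of_nat (card (SC (Suc n))) = (\<Sum>u\<le>n. (of_nat u + 1) * inner_C (of_nat u) (?x - of_nat u))"
  proof -
    have "of_nat (\<Sum>w<u. (u + 1) * ((n - u + w + 2) * (\<Sum>l\<le>w. l + 1))) =
      (of_nat u + 1) * inner_C (of_nat u) (?x - of_nat u)" if "u \<le> n" for u
    proof -
      have "of_nat (\<Sum>w<u. (u + 1) * ((n - u + w + 2) * (\<Sum>l\<le>w. l + 1))) =
        (\<Sum>w<u. (of_nat u + 1) * ((?x - of_nat u + of_nat w + 2) * of_nat (\<Sum>l\<le>w. l + 1)))"
        unfolding of_nat_sum[of _ "{..<u}"]
        by (simp only: of_nat_mult of_nat_add of_nat_1 of_nat_numeral of_nat_diff[OF that])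
      then show ?thesis unfolding tri sum_distrib_left[symmetric] sum_inner_C .
    qed
    then show ?thesis unfolding card_SC of_nat_sum[of _ "{..n}"] by (intro sum.cong) simp_all
  qed
  have "of_nat (card (normal_trees 3 (Suc n))) =
    (of_nat (((n + 6) choose 6) + 28 * ((n + 5) choose 6) + 56 * ((n + 4) choose 6) + 14 * ((n + 3) choose 6)) :: rat)"
    unfolding card_normal_trees_3[of "Suc n", simplified] of_nat_add of_nat_mult A B C sum_B sum_C choose_6 Let_def
    by (simp add: field_simps; algebra)
  then show ?thesis by (simp only: of_nat_eq_iff)
qed

section \<open>The generating function\<close>

lemma inverse_one_minus_X_power_7:
  "inverse ((1 - fps_X :: rat fps) ^ 7) = Abs_fps (\<lambda>k. of_nat ((k + 6) choose 6))"
proof -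
  have "(7 + k - 1) choose k = (k + 6) choose 6" for k
    using binomial_symmetric[of k "k + 6"] by (simp add: add.commute)
  then show ?thesis using one_minus_const_fps_X_neg_power'[of 7 "1 :: rat"] by simp
qed

theorem theorem7p25:
  shows "Abs_fps (\<lambda>m. of_nat (num_amplitree_classes 3 (m + 1)) :: rat) =
           (1 + 28 * fps_X + 56 * fps_X ^ 2 + 14 * fps_X ^ 3) / (1 - fps_X) ^ 7"
proof -
  define D :: "rat fps" where "D = Abs_fps (\<lambda>k. of_nat ((k + 6) choose 6))"
  \<comment> \<open>For \<open>j \<le> 6\<close> the subtraction does not truncate, and for n < j
    the binomial vanishes, in agreement with the missing coefficients of the shifted series.\<close>
  have shift: "fps_nth (fps_X ^ j * D) n = of_nat ((n + 6 - j) choose 6)" if "j \<le> 6" for j n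
    using that by (auto simp: fps_X_power_mult_nth D_def binomial_eq_0)
  have "(1 + 28 * fps_X + 56 * fps_X ^ 2 + 14 * fps_X ^ 3) / (1 - fps_X) ^ 7 =
    (1 + 28 * fps_X + 56 * fps_X ^ 2 + 14 * fps_X ^ 3) * D"
    by (subst fps_divide_unit) (simp_all add: inverse_one_minus_X_power_7 D_def)
  also have "\<dots> = D + fps_const 28 * (fps_X ^ 1 * D) + fps_const 56 * (fps_X ^ 2 * D) + fps_const 14 * (fps_X ^ 3 * D)"
    by (simp add: numeral_fps_const algebra_simps)
  also have "\<dots> = Abs_fps (\<lambda>m. of_nat (num_amplitree_classes 3 (m + 1)))"
  proof (rule fps_ext)
    fix n
    show "fps_nth (D + fps_const 28 * (fps_X ^ 1 * D) + fps_const 56 * (fps_X ^ 2 * D) +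
        fps_const 14 * (fps_X ^ 3 * D)) n = fps_nth (Abs_fps (\<lambda>m. of_nat (num_amplitree_classes 3 (m + 1)))) n"
      unfolding fps_add_nth fps_mult_left_const_nth
      using shift[of 0 n] shift[of 1 n] shift[of 2 n] shift[of 3 n]
      by (simp add: num_amplitree_classes_eq card_normal_trees_3_closed add.commute[of _ n])
  qed
  finally show ?thesis ..
qed

end
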